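(* Let $l>1$ be an odd integer and $q\in\mathbb K$ a primitive $l$-th root of unity. The algebra $\mathscr D_q^\circ$ is an Azumaya algebra over its centre $Z_{l,\Delta^l}$.
   Context: $\mathbb K$ is an algebraically closed field of characteristic $0$ and $n\ge1$. $\mathscr D_q$ is the $\mathbb K$-algebra generated by $x_1,\dots,x_n,\partial_1,\dots,\partial_n$ with relations, for $q_{ij}=q$ if $i<j$ and $q_{ij}=q^{-1}$ if $i>j$: $x_ix_j=q_{ij}x_jx_i$, $\partial_i\partial_j=q_{ij}\partial_j\partial_i$, $\partial_ix_j=q_{ij}^{-1}x_j\partial_i$ for $i\ne j$, and $\partial_ix_i=q\,x_i\partial_i+(q-1)$ for all $i$. Its $l$-centre is the central subalgebra $Z_l=\mathbb K[x_1^l,\dots,x_n^l,\partial_1^l,\dots,\partial_n^l]$ (a polynomial ring in these $2n$ elements). Put $\alpha_i=1+x_i\partial_i$ and $\Delta=\prod_{i=1}^n\alpha_i$; then $\Delta^l\in Z_l$. $Z_{l,\Delta^l}=Z_l[(\Delta^l)^{-1}]$ and $\mathscr D_q^\circ=\mathscr D_q\otimes_{Z_l}Z_{l,\Delta^l}$. An algebra $A$ over a commutative ring $R$, finitely generated and projective as an $R$-module, is Azumaya if the natural map $A\otimes_RA^{opp}\to \mathrm{End}_R(A)$ is an isomorphism. *)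

theory Defs
  imports
    "HOL-Algebra.Algebra"
    "HOL-Algebra.Algebraic_Closure_Type"
    "HOL-Algebra.Free_Abelian_Groups"
    "HOL-Computational_Algebra.Polynomial"
begin

section \<open>Algebras over commutative rings and Azumaya algebras\<close>

text \<open>The library locale \<^locale>\<open>algebra\<close> only covers commutative algebras.\<close>

locale assoc_algebra = module R A + ring A for R and A +
  assumes smult_mult_left:
      "\<lbrakk>r \<in> carrier R; a \<in> carrier A; b \<in> carrier A\<rbrakk> \<Longrightarrow> (r \<odot>\<^bsub>A\<^esub> a) \<otimes>\<^bsub>A\<^esub> b = r \<odot>\<^bsub>A\<^esub> (a \<otimes>\<^bsub>A\<^esub> b)"
    and smult_mult_right:
      "\<lbrakk>r \<in> carrier R; a \<in> carrier A; b \<in> carrier A\<rbrakk> \<Longrightarrow> a \<otimes>\<^bsub>A\<^esub> (r \<odot>\<^bsub>A\<^esub> b) = r \<odot>\<^bsub>A\<^esub> (a \<otimes>\<^bsub>A\<^esub> b)"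

text \<open>The algebra structure on a ring \<open>A\<close> given by a structure homomorphism \<open>\<phi>\<close> into \<open>A\<close>
  (with central image).\<close>

definition algebra_of_hom :: "('r \<Rightarrow> 'a) \<Rightarrow> ('a, 'x) ring_scheme \<Rightarrow> ('r, 'a) module" where
  "algebra_of_hom \<phi> A =
    \<lparr>carrier = carrier A, monoid.mult = monoid.mult A, one = \<one>\<^bsub>A\<^esub>,
     ring.zero = \<zero>\<^bsub>A\<^esub>, add = add A, module.smult = (\<lambda>r a. \<phi> r \<otimes>\<^bsub>A\<^esub> a)\<rparr>"

definition opposite_algebra :: "('r, 'a) module \<Rightarrow> ('r, 'a) module" where
  "opposite_algebra A = A\<lparr>monoid.mult := (\<lambda>a b. b \<otimes>\<^bsub>A\<^esub> a)\<rparr>"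

definition ring_centre :: "('a, 'x) ring_scheme \<Rightarrow> 'a set" where
  "ring_centre A = {z \<in> carrier A. \<forall>a\<in>carrier A. z \<otimes>\<^bsub>A\<^esub> a = a \<otimes>\<^bsub>A\<^esub> z}"

definition module_homs ::
    "('r, 'x) ring_scheme \<Rightarrow> ('r, 'a) module \<Rightarrow> ('r, 'b) module \<Rightarrow> ('a \<Rightarrow> 'b) set" where
  "module_homs R M N =
    {f \<in> carrier M \<rightarrow> carrier N.
       (\<forall>a\<in>carrier M. \<forall>b\<in>carrier M. f (a \<oplus>\<^bsub>M\<^esub> b) = f a \<oplus>\<^bsub>N\<^esub> f b) \<and>
       (\<forall>r\<in>carrier R. \<forall>a\<in>carrier M. f (r \<odot>\<^bsub>M\<^esub> a) = r \<odot>\<^bsub>N\<^esub> f a)}"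

definition algebra_isos ::
    "('r, 'x) ring_scheme \<Rightarrow> ('r, 'a) module \<Rightarrow> ('r, 'b) module \<Rightarrow> ('a \<Rightarrow> 'b) set" where
  "algebra_isos R A B = ring_iso A B \<inter> module_homs R A B"

definition fin_gen_module :: "('r, 'x) ring_scheme \<Rightarrow> ('r, 'a) module \<Rightarrow> bool" where
  "fin_gen_module R M \<longleftrightarrow>
    (\<exists>S. finite S \<and> S \<subseteq> carrier M \<and>
      (\<forall>m\<in>carrier M. \<exists>c. c \<in> S \<rightarrow> carrier R \<and> m = (\<Oplus>\<^bsub>M\<^esub>s\<in>S. c s \<odot>\<^bsub>M\<^esub> s)))"

text \<open>The free module on a set \<open>I\<close>: finitely supported functions \<open>I \<rightarrow> R\<close>, extended by zero.
  Only the module part of the record is meaningful.\<close>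

definition free_module :: "('r, 'x) ring_scheme \<Rightarrow> 'i set \<Rightarrow> ('r, 'i \<Rightarrow> 'r) module" where
  "free_module R I =
    \<lparr>carrier = {f. (\<forall>i. f i \<in> carrier R) \<and> (\<forall>i. i \<notin> I \<longrightarrow> f i = \<zero>\<^bsub>R\<^esub>) \<and> finite {i. f i \<noteq> \<zero>\<^bsub>R\<^esub>}},
     monoid.mult = undefined, one = undefined,
     ring.zero = (\<lambda>i. \<zero>\<^bsub>R\<^esub>), add = (\<lambda>f g i. f i \<oplus>\<^bsub>R\<^esub> g i), module.smult = (\<lambda>r f i. r \<otimes>\<^bsub>R\<^esub> f i)\<rparr>"

text \<open>A module is projective if it is a direct summand of a free module. Index sets inside the
  type of the module suffice, since a projective module \<open>M\<close> is a direct summand of the free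
  module on its own underlying set.\<close>

definition projective_module :: "('r, 'x) ring_scheme \<Rightarrow> ('r, 'a) module \<Rightarrow> bool" where
  "projective_module R M \<longleftrightarrow>
    (\<exists>(I :: 'a set) \<iota> \<pi>. \<iota> \<in> module_homs R M (free_module R I) \<and>
       \<pi> \<in> module_homs R (free_module R I) M \<and> (\<forall>m\<in>carrier M. \<pi> (\<iota> m) = m))"

definition endo_algebra :: "('r, 'x) ring_scheme \<Rightarrow> ('r, 'a) module \<Rightarrow> ('r, 'a \<Rightarrow> 'a) module" where
  "endo_algebra R M =
    \<lparr>carrier = module_homs R M M \<inter> extensional (carrier M),
     monoid.mult = (\<lambda>f g. \<lambda>m\<in>carrier M. f (g m)), one = (\<lambda>m\<in>carrier M. m),
     ring.zero = (\<lambda>m\<in>carrier M. \<zero>\<^bsub>M\<^esub>), add = (\<lambda>f g. \<lambda>m\<in>carrier M. f m \<oplus>\<^bsub>M\<^esub> g m),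
     module.smult = (\<lambda>r f. \<lambda>m\<in>carrier M. r \<odot>\<^bsub>M\<^esub> f m)\<rparr>"

subsection \<open>Tensor products of algebras\<close>

text \<open>\<open>A \<otimes>\<^sub>R B\<close> is the free abelian group on \<open>A \<times> B\<close> modulo the subgroup generated by the
  relations of biadditivity and \<open>R\<close>-balancedness; operations are induced from those on
  formal sums, in the style of \<^const>\<open>rcoset_mult\<close>.\<close>

definition tensor_free :: "('r, 'a) module \<Rightarrow> ('r, 'b) module \<Rightarrow> ('a \<times> 'b \<Rightarrow>\<^sub>0 int) monoid" where
  "tensor_free A B = free_Abelian_group (carrier A \<times> carrier B)"

definition tensor_relations ::
    "('r, 'x) ring_scheme \<Rightarrow> ('r, 'a) module \<Rightarrow> ('r, 'b) module \<Rightarrow> ('a \<times> 'b \<Rightarrow>\<^sub>0 int) set" where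
  "tensor_relations R A B =
    {frag_of (a \<oplus>\<^bsub>A\<^esub> a', b) - frag_of (a, b) - frag_of (a', b) | a a' b.
       a \<in> carrier A \<and> a' \<in> carrier A \<and> b \<in> carrier B} \<union>
    {frag_of (a, b \<oplus>\<^bsub>B\<^esub> b') - frag_of (a, b) - frag_of (a, b') | a b b'.
       a \<in> carrier A \<and> b \<in> carrier B \<and> b' \<in> carrier B} \<union>
    {frag_of (r \<odot>\<^bsub>A\<^esub> a, b) - frag_of (a, r \<odot>\<^bsub>B\<^esub> b) | r a b.
       r \<in> carrier R \<and> a \<in> carrier A \<and> b \<in> carrier B}"

definition tensor_subgroup ::
    "('r, 'x) ring_scheme \<Rightarrow> ('r, 'a) module \<Rightarrow> ('r, 'b) module \<Rightarrow> ('a \<times> 'b \<Rightarrow>\<^sub>0 int) set" where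
  "tensor_subgroup R A B = generate (tensor_free A B) (tensor_relations R A B)"

definition tensor_class ::
    "('r, 'x) ring_scheme \<Rightarrow> ('r, 'a) module \<Rightarrow> ('r, 'b) module
      \<Rightarrow> ('a \<times> 'b \<Rightarrow>\<^sub>0 int) \<Rightarrow> ('a \<times> 'b \<Rightarrow>\<^sub>0 int) set" where
  "tensor_class R A B u = tensor_subgroup R A B #>\<^bsub>tensor_free A B\<^esub> u"

definition pure_tensor ::
    "('r, 'x) ring_scheme \<Rightarrow> ('r, 'a) module \<Rightarrow> ('r, 'b) module
      \<Rightarrow> 'a \<Rightarrow> 'b \<Rightarrow> ('a \<times> 'b \<Rightarrow>\<^sub>0 int) set" where
  "pure_tensor R A B a b = tensor_class R A B (frag_of (a, b))"

text \<open>The biadditive extension of \<open>(a, b) (c, d) = (a c, b d)\<close> to formal sums.\<close>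

definition formal_mult ::
    "('r, 'a) module \<Rightarrow> ('r, 'b) module
      \<Rightarrow> ('a \<times> 'b \<Rightarrow>\<^sub>0 int) \<Rightarrow> ('a \<times> 'b \<Rightarrow>\<^sub>0 int) \<Rightarrow> ('a \<times> 'b \<Rightarrow>\<^sub>0 int)" where
  "formal_mult A B u v =
    frag_extend (\<lambda>(a, b). frag_extend (\<lambda>(c, d). frag_of (a \<otimes>\<^bsub>A\<^esub> c, b \<otimes>\<^bsub>B\<^esub> d)) v) u"

definition tensor_algebra ::
    "('r, 'x) ring_scheme \<Rightarrow> ('r, 'a) module \<Rightarrow> ('r, 'b) module
      \<Rightarrow> ('r, ('a \<times> 'b \<Rightarrow>\<^sub>0 int) set) module" where
  "tensor_algebra R A B =
    (let G = tensor_free A B Mod tensor_subgroup R A B in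
      \<lparr>carrier = carrier G,
       monoid.mult = (\<lambda>U V. \<Union>u\<in>U. \<Union>v\<in>V. tensor_class R A B (formal_mult A B u v)),
       one = pure_tensor R A B \<one>\<^bsub>A\<^esub> \<one>\<^bsub>B\<^esub>,
       ring.zero = \<one>\<^bsub>G\<^esub>, add = monoid.mult G,
       module.smult = (\<lambda>r U. \<Union>u\<in>U. tensor_class R A B
                  (frag_extend (\<lambda>(a, b). frag_of (r \<odot>\<^bsub>A\<^esub> a, b)) u))\<rparr>)"

subsection \<open>Azumaya algebras\<close>

text \<open>The natural map sends \<open>a \<otimes> b\<close> to the endomorphism \<open>x \<mapsto> a x b\<close>; it is evaluated on an
  arbitrary representative of a class, on which its value does not depend.\<close>

definition natural_map ::
    "('r, 'a) module \<Rightarrow> ('a \<times> 'a \<Rightarrow>\<^sub>0 int) set \<Rightarrow> ('a \<Rightarrow> 'a)" where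
  "natural_map A U = the_elem
    ((\<lambda>u. \<lambda>x\<in>carrier A. \<Oplus>\<^bsub>A\<^esub>p\<in>Poly_Mapping.keys u.
        [Poly_Mapping.lookup u p] \<cdot>\<^bsub>A\<^esub> (fst p \<otimes>\<^bsub>A\<^esub> x \<otimes>\<^bsub>A\<^esub> snd p)) ` U)"

definition azumaya_algebra :: "('r, 'x) ring_scheme \<Rightarrow> ('r, 'a) module \<Rightarrow> bool" where
  "azumaya_algebra R A \<longleftrightarrow>
    assoc_algebra R A \<and> fin_gen_module R A \<and> projective_module R A \<and>
    natural_map A \<in> algebra_isos R (tensor_algebra R A (opposite_algebra A)) (endo_algebra R A)"

section \<open>Localization of commutative rings\<close>

text \<open>A fraction \<open>a / s\<close> is the set of all pairs \<open>(b, t)\<close> with \<open>b / t = a / s\<close>. Zero divisors in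
  the multiplicative set \<open>S\<close> are allowed.\<close>

definition loc_frac :: "('a, 'x) ring_scheme \<Rightarrow> 'a set \<Rightarrow> 'a \<Rightarrow> 'a \<Rightarrow> ('a \<times> 'a) set" where
  "loc_frac R S a s =
    {(b, t). b \<in> carrier R \<and> t \<in> S \<and>
       (\<exists>u\<in>S. u \<otimes>\<^bsub>R\<^esub> (t \<otimes>\<^bsub>R\<^esub> a) = u \<otimes>\<^bsub>R\<^esub> (s \<otimes>\<^bsub>R\<^esub> b))}"

definition localization :: "('a, 'x) ring_scheme \<Rightarrow> 'a set \<Rightarrow> ('a \<times> 'a) set ring" where
  "localization R S =
    \<lparr>carrier = {loc_frac R S a s | a s. a \<in> carrier R \<and> s \<in> S},
     monoid.mult = (\<lambda>U V. \<Union>(a, s)\<in>U. \<Union>(b, t)\<in>V. loc_frac R S (a \<otimes>\<^bsub>R\<^esub> b) (s \<otimes>\<^bsub>R\<^esub> t)),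
     one = loc_frac R S \<one>\<^bsub>R\<^esub> \<one>\<^bsub>R\<^esub>, ring.zero = loc_frac R S \<zero>\<^bsub>R\<^esub> \<one>\<^bsub>R\<^esub>,
     add = (\<lambda>U V. \<Union>(a, s)\<in>U. \<Union>(b, t)\<in>V.
              loc_frac R S (t \<otimes>\<^bsub>R\<^esub> a \<oplus>\<^bsub>R\<^esub> s \<otimes>\<^bsub>R\<^esub> b) (s \<otimes>\<^bsub>R\<^esub> t))\<rparr>"

definition loc_map :: "('a, 'x) ring_scheme \<Rightarrow> 'a set \<Rightarrow> 'a \<Rightarrow> ('a \<times> 'a) set" where
  "loc_map R S a = loc_frac R S a \<one>\<^bsub>R\<^esub>"

section \<open>The algebra of quantum differential operators\<close>

subsection \<open>Free algebras\<close>

text \<open>With words as a monoid under concatenation, the convolution product makes the type of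
  finitely supported functions from words to \<open>K\<close> the free associative algebra.\<close>

instantiation list :: (type) monoid_add
begin
definition zero_list :: "'a list" where "zero_list = []"
definition plus_list :: "'a list \<Rightarrow> 'a list \<Rightarrow> 'a list" where "plus_list = (@)"
instance by standard (simp_all add: zero_list_def plus_list_def)
end

datatype qgen = Xgen nat | Dgen nat

type_synonym 'k free_alg = "qgen list \<Rightarrow>\<^sub>0 'k"

definition free_algebra :: "nat \<Rightarrow> 'k::field free_alg ring" where
  "free_algebra n = ring_of_type_algebra
    \<lparr>carrier := {p. \<forall>w\<in>Poly_Mapping.keys p. set w \<subseteq> Xgen ` {1..n} \<union> Dgen ` {1..n}}\<rparr>"

definition fscalar :: "'k::field \<Rightarrow> 'k free_alg" where
  "fscalar c = Poly_Mapping.single [] c"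

definition fx :: "nat \<Rightarrow> 'k::field free_alg" where
  "fx i = Poly_Mapping.single [Xgen i] 1"

definition fd :: "nat \<Rightarrow> 'k::field free_alg" where
  "fd i = Poly_Mapping.single [Dgen i] 1"

subsection \<open>Generators and relations\<close>

text \<open>The constants \<open>q\<^sub>i\<^sub>j\<close>; only used for \<open>i \<noteq> j\<close>.\<close>

definition qsgn :: "'k::field \<Rightarrow> nat \<Rightarrow> nat \<Rightarrow> 'k" where
  "qsgn q i j = (if i < j then q else inverse q)"

definition Dq_relations :: "nat \<Rightarrow> 'k::field \<Rightarrow> 'k free_alg set" where
  "Dq_relations n q =
    {fx i * fx j - fscalar (qsgn q i j) * fx j * fx i | i j.
       i \<in> {1..n} \<and> j \<in> {1..n} \<and> i \<noteq> j} \<union>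
    {fd i * fd j - fscalar (qsgn q i j) * fd j * fd i | i j.
       i \<in> {1..n} \<and> j \<in> {1..n} \<and> i \<noteq> j} \<union>
    {fd i * fx j - fscalar (inverse (qsgn q i j)) * fx j * fd i | i j.
       i \<in> {1..n} \<and> j \<in> {1..n} \<and> i \<noteq> j} \<union>
    {fd i * fx i - (fscalar q * fx i * fd i + fscalar (q - 1)) | i. i \<in> {1..n}}"

definition Dq_ideal :: "nat \<Rightarrow> 'k::field \<Rightarrow> 'k free_alg set" where
  "Dq_ideal n q = Idl\<^bsub>free_algebra n\<^esub> (Dq_relations n q)"

definition Dq :: "nat \<Rightarrow> 'k::field \<Rightarrow> 'k free_alg set ring" where
  "Dq n q = free_algebra n Quot Dq_ideal n q"

definition Dq_class :: "nat \<Rightarrow> 'k::field \<Rightarrow> 'k free_alg \<Rightarrow> 'k free_alg set" where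
  "Dq_class n q p = Dq_ideal n q +>\<^bsub>free_algebra n\<^esub> p"

definition Dq_scalar :: "nat \<Rightarrow> 'k::field \<Rightarrow> 'k \<Rightarrow> 'k free_alg set" where
  "Dq_scalar n q c = Dq_class n q (fscalar c)"

definition Dq_x :: "nat \<Rightarrow> 'k::field \<Rightarrow> nat \<Rightarrow> 'k free_alg set" where
  "Dq_x n q i = Dq_class n q (fx i)"

definition Dq_d :: "nat \<Rightarrow> 'k::field \<Rightarrow> nat \<Rightarrow> 'k free_alg set" where
  "Dq_d n q i = Dq_class n q (fd i)"

definition Dq_alpha :: "nat \<Rightarrow> 'k::field \<Rightarrow> nat \<Rightarrow> 'k free_alg set" where
  "Dq_alpha n q i = \<one>\<^bsub>Dq n q\<^esub> \<oplus>\<^bsub>Dq n q\<^esub> Dq_x n q i \<otimes>\<^bsub>Dq n q\<^esub> Dq_d n q i"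

text \<open>The factors commute, so the order of the product is immaterial; \<^const>\<open>finprod\<close> is only
  meaningful in commutative monoids.\<close>

definition Dq_Delta :: "nat \<Rightarrow> 'k::field \<Rightarrow> 'k free_alg set" where
  "Dq_Delta n q = foldr (\<lambda>i y. Dq_alpha n q i \<otimes>\<^bsub>Dq n q\<^esub> y) [1..<Suc n] \<one>\<^bsub>Dq n q\<^esub>"

subsection \<open>The \<open>l\<close>-centre and the localized algebra\<close>

text \<open>The subring generated by the scalars and the \<open>l\<close>-th powers is the \<open>K\<close>-subalgebra generated
  by the \<open>l\<close>-th powers.\<close>

definition l_centre :: "nat \<Rightarrow> 'k::field \<Rightarrow> nat \<Rightarrow> 'k free_alg set ring" where
  "l_centre n q l = (Dq n q)
    \<lparr>carrier := generate_ring (Dq n q)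
       (range (Dq_scalar n q) \<union>
        {Dq_x n q i [^]\<^bsub>Dq n q\<^esub> l | i. i \<in> {1..n}} \<union>
        {Dq_d n q i [^]\<^bsub>Dq n q\<^esub> l | i. i \<in> {1..n}})\<rparr>"

definition Delta_powers :: "nat \<Rightarrow> 'k::field \<Rightarrow> nat \<Rightarrow> 'k free_alg set set" where
  "Delta_powers n q l = {(Dq_Delta n q [^]\<^bsub>Dq n q\<^esub> l) [^]\<^bsub>Dq n q\<^esub> k | k :: nat. True}"

definition l_centre_loc ::
    "nat \<Rightarrow> 'k::field \<Rightarrow> nat \<Rightarrow> ('k free_alg set \<times> 'k free_alg set) set ring" where
  "l_centre_loc n q l = localization (l_centre n q l) (Delta_powers n q l)"

text \<open>The two factors of the tensor product, as algebras over the \<open>l\<close>-centre.\<close>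

definition Dq_over_l_centre ::
    "nat \<Rightarrow> 'k::field \<Rightarrow> ('k free_alg set, 'k free_alg set) module" where
  "Dq_over_l_centre n q = algebra_of_hom (\<lambda>z. z) (Dq n q)"

definition loc_over_l_centre ::
    "nat \<Rightarrow> 'k::field \<Rightarrow> nat
      \<Rightarrow> ('k free_alg set, ('k free_alg set \<times> 'k free_alg set) set) module" where
  "loc_over_l_centre n q l =
    algebra_of_hom (loc_map (l_centre n q l) (Delta_powers n q l)) (l_centre_loc n q l)"

type_synonym 'k Dq_loc_elem =
  "('k free_alg set \<times> ('k free_alg set \<times> 'k free_alg set) set \<Rightarrow>\<^sub>0 int) set"

definition loc_structure_map ::
    "nat \<Rightarrow> 'k::field \<Rightarrow> nat \<Rightarrow> ('k free_alg set \<times> 'k free_alg set) set \<Rightarrow> 'k Dq_loc_elem" where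
  "loc_structure_map n q l w =
    pure_tensor (l_centre n q l) (Dq_over_l_centre n q) (loc_over_l_centre n q l) \<one>\<^bsub>Dq n q\<^esub> w"

text \<open>\<open>\<D>\<^sub>q\<^sup>\<circ> = \<D>\<^sub>q \<otimes> Z\<^sub>l\<^sub>,\<^sub>\<Delta>\<close>, viewed as an algebra over the localized \<open>l\<close>-centre via \<open>w \<mapsto> 1 \<otimes> w\<close>.\<close>

definition Dq_loc ::
    "nat \<Rightarrow> 'k::field \<Rightarrow> nat
      \<Rightarrow> (('k free_alg set \<times> 'k free_alg set) set, 'k Dq_loc_elem) module" where
  "Dq_loc n q l = algebra_of_hom (loc_structure_map n q l)
    (tensor_algebra (l_centre n q l) (Dq_over_l_centre n q) (loc_over_l_centre n q l))"

definition primitive_root_of_unity :: "nat \<Rightarrow> 'k::field \<Rightarrow> bool" where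
  "primitive_root_of_unity l q \<longleftrightarrow> 0 < l \<and> q ^ l = 1 \<and> (\<forall>k. 0 < k \<and> k < l \<longrightarrow> q ^ k \<noteq> 1)"

end

theory Submission
  imports Defs
begin

text \<open>Let \<open>A\<close> be an algebra over \<open>R\<close> with enveloping algebra \<open>B = A \<otimes> A\<^sup>o\<^sup>p\<close>, where \<open>lam a = a \<otimes> 1\<close> and
  \<open>rho a = 1 \<otimes> a\<close>. Suppose \<open>e \<in> B\<close> satisfies \<open>lam a e = rho a e\<close> for all \<open>a\<close>, maps \<open>A\<close> into \<open>R\<close>, fixes \<open>1\<close>,
  and \<open>1 = \<Sum> lam u e lam v\<close> for finitely many pairs \<open>(u, v)\<close>. The last identity exhibits a dual basis of
  \<open>A\<close> and an inverse of the natural map, and \<open>z = e \<cdot> z\<close> lies in \<open>R\<close> for central \<open>z\<close>.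

  For one pair \<open>x, \<partial>\<close> with \<open>\<alpha> = 1 + x \<partial>\<close> invertible, averaging the conjugations by powers of \<open>\<alpha>\<close> projects
  onto \<open>R[\<alpha>]\<close>. Since \<open>x \<partial>\<close> and \<open>\<partial>\<^sup>l\<^sup>-\<^sup>1 x\<^sup>l\<^sup>-\<^sup>1\<close> are coprime polynomials in \<open>\<alpha>\<close>, the automorphism
  \<open>\<alpha> \<mapsto> q\<^sup>-\<^sup>1 \<alpha>\<close> of \<open>R[\<alpha>]\<close> is given by an element of \<open>B\<close>, and averaging its powers projects onto \<open>R\<close>.
  The composite of the two projections is \<open>e\<close>. For several pairs, twisting the generators by products
  of the \<open>\<alpha>\<^sub>i\<close> makes different pairs commute, and the product of their idempotents serves as \<open>e\<close>.
  No basis of \<open>\<D>\<^sub>q\<close> over its \<open>l\<close>-centre is needed.\<close>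

text \<open>Writing \<open>b 1\<close> for the action of \<open>b\<close> on the unit, one has
  \<open>b e = lam (b 1) e\<close>. So \<open>B e\<close> is a copy of \<open>A\<close>, and the
  expression of \<open>1\<close> through \<open>e\<close> says that this copy generates
  \<open>B\<close>: a Morita argument in explicit formulas. Inverting \<Delta> makes each \<alpha>_i
  invertible, so conjugation by \<alpha>_i is available. The same cannot be done with x_i, because
  x_i \<partial>_i = \<alpha>_i - 1 is not made invertible. The automorphism that conjugation by x_i
  would induce on polynomials in \<alpha>_i has to be glued from two pairs of elements of opposite
  weights, by a Bezout identity. Oddness of \<open>l\<close> enters through the product of all
  \<open>l\<close>-th roots of unity, which is then 1. It gives \<alpha>^l = 1 + x^l \<partial>^l
  with the right sign, and so puts \<alpha>^l and \<Delta>^l into the \<open>l\<close>-centre.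
  Averaging over roots of unity needs \<open>1 / l\<close> in the field. Most computations take
  place in polynomials in one element: \<alpha> in \<open>A\<close>, and in \<open>B\<close> the
  elements \<open>g\<close> (conjugation by \<alpha>) and \<open>S\<close> (the glued substitute for
  conjugation by \<open>x\<close>).\<close>

section \<open>Additive spans of generating sets\<close>

inductive_set add_span :: "('a, 'x) ring_scheme \<Rightarrow> 'a set \<Rightarrow> 'a set" for G S where
  zero: "\<zero>\<^bsub>G\<^esub> \<in> add_span G S"
| add: "\<lbrakk>s \<in> S; y \<in> add_span G S\<rbrakk> \<Longrightarrow> s \<oplus>\<^bsub>G\<^esub> y \<in> add_span G S"

context abelian_group
begin

lemma add_span_closed:
  assumes "S \<subseteq> carrier G" "x \<in> add_span G S" shows "x \<in> carrier G"
  using assms(2) by induction (use assms(1) in auto)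

lemma add_span_incl:
  assumes "S \<subseteq> carrier G" "s \<in> S" shows "s \<in> add_span G S"
  using add_span.add[OF assms(2) add_span.zero, of G] assms by auto

lemma add_span_plus:
  assumes S: "S \<subseteq> carrier G" and "x \<in> add_span G S" and y: "y \<in> add_span G S"
  shows "x \<oplus> y \<in> add_span G S"
  using assms(2)
proof induction
  case zero
  then show ?case using y add_span_closed[OF S y] by simp
next
  case (add s z)
  have "s \<oplus> z \<oplus> y = s \<oplus> (z \<oplus> y)"
    using add S add_span_closed[OF S] y by (intro a_assoc) auto
  then show ?case using add by (simp add: add_span.add)
qed

lemma add_span_induct [consumes 2, case_names zero incl plus]:
  assumes S: "S \<subseteq> carrier G" and x: "x \<in> add_span G S"
    and "P \<zero>" and "\<And>s. s \<in> S \<Longrightarrow> P s"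
    and "\<And>a b. \<lbrakk>a \<in> carrier G; b \<in> carrier G; P a; P b\<rbrakk> \<Longrightarrow> P (a \<oplus> b)"
  shows "P x"
  using x by induction (use assms add_span_closed[OF S] in blast)+

text \<open>With \<open>f\<close> a multiplication by a fixed element, a negation or an action, this
  reduces membership claims to the generators.\<close>

lemma add_span_image:
  assumes "abelian_group H" and S: "S \<subseteq> carrier G" and T: "T \<subseteq> carrier H" and x: "x \<in> add_span G S"
    and f0: "f \<zero> = \<zero>\<^bsub>H\<^esub>"
    and fa: "\<And>a b. \<lbrakk>a \<in> carrier G; b \<in> carrier G\<rbrakk> \<Longrightarrow> f (a \<oplus> b) = f a \<oplus>\<^bsub>H\<^esub> f b"
    and ST: "\<And>s. s \<in> S \<Longrightarrow> f s \<in> add_span H T"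
  shows "f x \<in> add_span H T"
  using S x
  by (induction rule: add_span_induct)
    (auto simp: f0 fa ST add_span.zero abelian_group.add_span_plus[OF assms(1) T])

end

lemma (in ring) add_span_mult:
  assumes S: "S \<subseteq> carrier R" and T: "T \<subseteq> carrier R" and U: "U \<subseteq> carrier R"
    and x: "x \<in> add_span R S" and y: "y \<in> add_span R T"
    and ST: "\<And>s t. \<lbrakk>s \<in> S; t \<in> T\<rbrakk> \<Longrightarrow> s \<otimes> t \<in> add_span R U"
  shows "x \<otimes> y \<in> add_span R U"
proof -
  have yc: "y \<in> carrier R" using add_span_closed[OF T y] .
  have 1: "s \<otimes> y \<in> add_span R U" if "s \<in> S" for s
    by (rule add_span_image[OF abelian_group_axioms T U y])
      (use that S ST in \<open>auto simp: r_distr\<close>)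
  show ?thesis
    by (rule add_span_image[OF abelian_group_axioms S U x, where f = "\<lambda>a. a \<otimes> y"])
      (use 1 yc in \<open>auto simp: l_distr\<close>)
qed

text \<open>The inductive set contains sums only, so signs have to be absorbed by the generators; in
  the applications a factor from a subring carries them.\<close>

lemma (in ring) subring_add_span:
  assumes S: "S \<subseteq> carrier R" and one: "\<one> \<in> add_span R S"
    and neg: "\<And>s. s \<in> S \<Longrightarrow> \<ominus> s \<in> add_span R S"
    and mult: "\<And>s t. \<lbrakk>s \<in> S; t \<in> S\<rbrakk> \<Longrightarrow> s \<otimes> t \<in> add_span R S"
  shows "subring (add_span R S) R"
proof (rule subringI)
  fix h assume "h \<in> add_span R S"
  then show "\<ominus> h \<in> add_span R S"
    by (rule add_span_image[OF abelian_group_axioms S S]) (auto simp: neg minus_add)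
qed (use add_span_closed[OF S] one add_span_mult[OF S S S _ _ mult] add_span_plus[OF S] in auto)

section \<open>Rings with central scalars and evaluation of polynomials\<close>

text \<open>The ground field enters as a central ring homomorphism instead of a scalar
  multiplication, so that one evaluation of polynomials serves both an algebra (\<open>KA\<close>)
  and its enveloping algebra (\<open>KB\<close>).\<close>

locale scalar_ring = ring R for R :: "('a, 'x) ring_scheme" (structure) +
  fixes \<kappa> :: "'k::field \<Rightarrow> 'a"
  assumes kappa_closed [simp, intro]: "\<kappa> a \<in> carrier R"
    and kappa_add: "\<kappa> (a + b) = \<kappa> a \<oplus> \<kappa> b"
    and kappa_mult: "\<kappa> (a * b) = \<kappa> a \<otimes> \<kappa> b"
    and kappa_1 [simp]: "\<kappa> 1 = \<one>"
    and kappa_central: "x \<in> carrier R \<Longrightarrow> x \<otimes> \<kappa> a = \<kappa> a \<otimes> x"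
begin

lemma kappa_0 [simp]: "\<kappa> 0 = \<zero>"
  using kappa_add[of 0 0] by (metis add.l_cancel_one' add_0 kappa_closed)

lemma kappa_minus: "\<kappa> (- a) = \<ominus> \<kappa> a"
  using kappa_add[of "- a" a] by (metis add.inv_equality ab_left_minus kappa_0 kappa_closed a_inv_def)

lemma kappa_diff: "\<kappa> (a - b) = \<kappa> a \<ominus> \<kappa> b"
  using kappa_add[of a "- b"] by (simp add: kappa_minus a_minus_def)

lemma kappa_left_comm:
  "\<lbrakk>x \<in> carrier R; y \<in> carrier R\<rbrakk> \<Longrightarrow> x \<otimes> (\<kappa> a \<otimes> y) = \<kappa> a \<otimes> (x \<otimes> y)"
  by (metis kappa_central kappa_closed m_assoc)

lemma kappa_kappa: "x \<in> carrier R \<Longrightarrow> \<kappa> a \<otimes> (\<kappa> b \<otimes> x) = \<kappa> (a * b) \<otimes> x"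
  by (simp add: kappa_mult m_assoc)

lemma kappa_inverse: "\<lbrakk>x \<in> carrier R; a \<noteq> 0\<rbrakk> \<Longrightarrow> \<kappa> (inverse a) \<otimes> (\<kappa> a \<otimes> x) = x"
  "\<lbrakk>x \<in> carrier R; a \<noteq> 0\<rbrakk> \<Longrightarrow> \<kappa> a \<otimes> (\<kappa> (inverse a) \<otimes> x) = x"
  by (simp_all add: kappa_kappa)

text \<open>Horner's scheme, chosen because it recurses along \<open>pCons\<close>. It is
  multiplicative in the polynomial, so identities of \<open>'k poly\<close> hold for every single
  element of a noncommutative ring.\<close>

definition ev :: "'a \<Rightarrow> 'k poly \<Rightarrow> 'a" where
  "ev g p = foldr (\<lambda>c y. \<kappa> c \<oplus> g \<otimes> y) (coeffs p) \<zero>"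

lemma ev_0 [simp]: "ev g 0 = \<zero>"
  by (simp add: ev_def)

lemma ev_pCons [simp]: "g \<in> carrier R \<Longrightarrow> ev g (pCons c p) = \<kappa> c \<oplus> g \<otimes> ev g p"
  by (auto simp: ev_def cCons_def)

lemma ev_closed [simp, intro]: "g \<in> carrier R \<Longrightarrow> ev g p \<in> carrier R"
  by (induction p) auto

lemma ev_1 [simp]: "g \<in> carrier R \<Longrightarrow> ev g 1 = \<one>"
  by (simp add: one_pCons)

lemma ev_add: "g \<in> carrier R \<Longrightarrow> ev g (p + r) = ev g p \<oplus> ev g r"
proof (induction p r rule: poly_induct2)
  case (pCons a p b r)
  then show ?case
    by (simp add: kappa_add r_distr a_ac)
qed auto

lemma ev_smult: "g \<in> carrier R \<Longrightarrow> ev g (Polynomial.smult c p) = \<kappa> c \<otimes> ev g p"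
  by (induction p) (auto simp: kappa_mult r_distr kappa_left_comm)

lemma ev_mult: "g \<in> carrier R \<Longrightarrow> ev g (p * r) = ev g p \<otimes> ev g r"
  by (induction p) (auto simp: mult_pCons_left ev_add ev_smult l_distr m_assoc)

lemma ev_minus:
  assumes [simp]: "g \<in> carrier R" shows "ev g (p - r) = ev g p \<ominus> ev g r"
proof -
  have "ev g (p - r) = ev g (p + Polynomial.smult (-1) r)" by simp
  then show ?thesis
    unfolding ev_add[OF assms] ev_smult[OF assms]
    by (simp add: kappa_minus l_minus a_minus_def)
qed

lemma ev_monom: "g \<in> carrier R \<Longrightarrow> ev g (Polynomial.monom c n) = \<kappa> c \<otimes> g [^] n"
proof (induction n)
  case (Suc n)
  have "g \<otimes> g [^] n = g [^] n \<otimes> g" using Suc by (metis nat_pow_Suc nat_pow_Suc2)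
  then show ?case using Suc by (simp add: Polynomial.monom_Suc kappa_left_comm)
qed (auto simp: Polynomial.monom_0)

text \<open>\<open>pcompose p [:0, w:]\<close> is the polynomial p(w T). A commutation up to the
  scalar \<open>w\<close> thus becomes a rescaling of the variable, which is how nearly all
  reorderings below are done.\<close>

lemma ev_intertwine:
  assumes [simp]: "b \<in> carrier R" "g \<in> carrier R" "g' \<in> carrier R"
    and eq: "b \<otimes> g = \<kappa> w \<otimes> (g' \<otimes> b)"
  shows "b \<otimes> ev g p = ev g' (pcompose p [:0, w:]) \<otimes> b"
proof (induction p)
  case (pCons a p)
  have "b \<otimes> (g \<otimes> ev g p) = \<kappa> w \<otimes> (g' \<otimes> (b \<otimes> ev g p))"
    using eq by (simp add: m_assoc flip: m_assoc[of b])
  also have "\<dots> = \<kappa> w \<otimes> (g' \<otimes> ev g' (pcompose p [:0, w:])) \<otimes> b"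
    by (simp add: pCons m_assoc)
  finally show ?case
    by (simp add: pcompose_pCons ev_add ev_mult ev_smult r_distr l_distr kappa_central kappa_left_comm m_assoc)
qed simp

lemma ev_comm:
  assumes "b \<in> carrier R" "g \<in> carrier R" "b \<otimes> g = g \<otimes> b"
  shows "b \<otimes> ev g p = ev g p \<otimes> b"
  using ev_intertwine[of b g g 1 p] assms by (simp add: pcompose_idR)

text \<open>Meant for families of polynomials whose sum is 1: it then puts the unit into
  \<open>M\<close>.\<close>

lemma ev_sum_closed:
  assumes "g \<in> carrier R" "\<zero> \<in> M" "\<And>x y. \<lbrakk>x \<in> M; y \<in> M\<rbrakk> \<Longrightarrow> x \<oplus> y \<in> M"
    and "\<And>i::nat. i < m \<Longrightarrow> ev g (P i) \<in> M"
  shows "ev g (\<Sum>i<m. P i) \<in> M"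
  using assms(4) by (induction m) (auto simp: assms ev_add)

end

section \<open>Roots of unity and averaging polynomials\<close>

lemma primitive_root_of_unity_power_eq_1_iff:
  assumes "primitive_root_of_unity l q"
  shows "q ^ a = 1 \<longleftrightarrow> l dvd a"
proof -
  have l: "l > 0" "q ^ l = 1" and *: "\<And>k. 0 < k \<Longrightarrow> k < l \<Longrightarrow> q ^ k \<noteq> 1"
    using assms by (auto simp: primitive_root_of_unity_def)
  have "q ^ a = q ^ (l * (a div l) + a mod l)" by simp
  also have "\<dots> = q ^ (a mod l)" by (simp only: power_add power_mult l(2)) simp
  finally show ?thesis
    using *[of "a mod l"] l(1) by (auto simp: dvd_eq_mod_eq_0 intro: gr0I)
qed

lemma primitive_root_of_unity_nonzero: "primitive_root_of_unity l q \<Longrightarrow> q \<noteq> 0"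
  by (auto simp: primitive_root_of_unity_def power_0_left)

lemma primitive_root_of_unity_inverse:
  assumes "primitive_root_of_unity l q" shows "primitive_root_of_unity l (inverse q)"
  using assms by (auto simp: primitive_root_of_unity_def power_inverse)

text \<open>Evaluated at an operator of order dividing \<open>l\<close>, this is the projector onto
  the fixed vectors: at an \<open>l\<close>-th root of unity it takes the value 1 or 0.\<close>

definition avg_poly :: "nat \<Rightarrow> 'k::field poly" where
  "avg_poly l = (\<Sum>k<l. Polynomial.monom (1 / of_nat l) k)"

lemma coeff_avg_poly: "coeff (avg_poly l) i = (if i < l then 1 / of_nat l else 0)"
  by (simp add: avg_poly_def coeff_sum if_distrib cong: if_cong)

lemma poly_avg_poly_1: "of_nat l \<noteq> (0::'k::field) \<Longrightarrow> poly (avg_poly l) (1::'k) = 1"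
  by (simp add: avg_poly_def poly_sum poly_monom)

lemma poly_avg_poly:
  fixes w :: "'k::field"
  assumes "w ^ l = 1" "w \<noteq> 1" shows "poly (avg_poly l) w = 0"
proof -
  have "poly (avg_poly l) w = 1 / of_nat l * (\<Sum>k<l. w ^ k)"
    by (simp add: avg_poly_def poly_sum poly_monom sum_divide_distrib)
  then show ?thesis using assms by (simp add: geometric_sum)
qed

text \<open>The geometric sum. It is the reason why an average of powers of \<open>s\<close> is
  fixed by \<open>s\<close> wherever \<open>s ^ l\<close> acts as the identity.\<close>

lemma avg_poly_telescope:
  "[:- 1, 1:] * avg_poly l = Polynomial.smult (1 / of_nat l) (Polynomial.monom 1 l - (1::'k::field poly))"
proof (rule poly_eqI)
  fix i
  show "coeff ([:- 1, 1:] * avg_poly l) i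
    = coeff (Polynomial.smult (1 / of_nat l) (Polynomial.monom 1 l - (1::'k poly))) i"
    by (cases i) (auto simp: coeff_avg_poly coeff_pCons' mult_pCons_left)
qed

text \<open>The projectors onto the eigenspaces for all powers of \<open>q\<close> add up to the
  identity. The \<open>i\<close>-th coefficient is a sum of powers of \<open>q ^ i\<close>, which
  vanishes for 0 < i < l, and there are no coefficients beyond.\<close>

lemma sum_avg_poly:
  assumes q: "primitive_root_of_unity l (q::'k::field)" and l: "of_nat l \<noteq> (0::'k)"
  shows "(\<Sum>c<l. pcompose (avg_poly l) [:0, q ^ c:]) = 1"
proof (rule poly_eqI)
  fix i
  have "coeff (\<Sum>c<l. pcompose (avg_poly l) [:0, q ^ c:]) i
      = (\<Sum>c<l. (q ^ i) ^ c) * coeff (avg_poly l) i"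
    by (simp add: coeff_sum coeff_pcompose_linear sum_distrib_left mult.commute flip: power_mult)
  also have "\<dots> = coeff 1 i"
  proof (cases "0 < i \<and> i < l")
    case True
    then have "q ^ i \<noteq> 1" using q by (auto simp: primitive_root_of_unity_def)
    moreover have "(q ^ i) ^ l = 1"
      using q by (metis mult.commute power_mult power_one primitive_root_of_unity_def)
    ultimately show ?thesis using True by (simp add: geometric_sum)
  qed (use l q in \<open>auto simp: coeff_avg_poly primitive_root_of_unity_def\<close>)
  finally show "coeff (\<Sum>c<l. pcompose (avg_poly l) [:0, q ^ c:]) i = coeff 1 i" .
qed

lemma pcompose_scale:
  fixes v w :: "'k::field"
  shows "pcompose (pcompose p [:0, v:]) [:0, w:] = pcompose p [:0, v * w:]"
  by (rule poly_eqI) (simp add: coeff_pcompose_linear power_mult_distrib)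

text \<open>Both sides are monic of degree \<open>l\<close>, so their difference has degree below
  \<open>l\<close>, yet it vanishes at the \<open>l\<close> distinct powers of
  \<open>q\<close>.\<close>

lemma prod_roots_of_unity_poly:
  fixes q :: "'k::field"
  assumes q: "primitive_root_of_unity l q"
  shows "(\<Prod>k<l. [:- (q ^ k), 1:]) = Polynomial.monom 1 l - 1"
proof -
  have l: "l > 0" "q ^ l = 1" using q by (auto simp: primitive_root_of_unity_def)
  have dl: "degree (\<Prod>k<m. [:- (q ^ k), 1:]) = m \<and> lead_coeff (\<Prod>k<m. [:- (q ^ k), 1:]) = 1" for m
  proof (induction m)
    case (Suc m)
    then have "(\<Prod>k<m. [:- (q ^ k), 1:]) \<noteq> 0" by auto
    then show ?case
      unfolding prod.lessThan_Suc lead_coeff_mult using Suc by (subst degree_mult_eq) auto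
  qed simp
  let ?D = "(\<Prod>k<l. [:- (q ^ k), 1:]) - (Polynomial.monom 1 l - 1)"
  show ?thesis
  proof (rule ccontr)
    assume "\<not> ?thesis"
    then have D: "?D \<noteq> 0" by simp
    have "degree ?D < l"
    proof -
      have "degree ?D \<le> l"
        by (intro degree_diff_le) (use dl[of l] in \<open>auto simp: degree_monom_eq\<close>)
      moreover have "coeff (\<Prod>k<l. [:- (q ^ k), 1:]) l = 1" using dl[of l] by metis
      then have "coeff ?D l = 0" using l(1) by simp
      ultimately show ?thesis
        using D by (metis le_neq_implies_less leading_coeff_0_iff)
    qed
    moreover have "card {x. poly ?D x = 0} \<ge> l"
    proof -
      have inj: "inj_on (\<lambda>k. q ^ k) {..<l}"
      proof (rule linorder_inj_onI')
        fix i j assume "i \<in> {..<l}" "j \<in> {..<l}" "i < j"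
        then have "q ^ (j - i) \<noteq> 1" using q by (auto simp: primitive_root_of_unity_def)
        moreover have "q ^ j = q ^ i * q ^ (j - i)" using \<open>i < j\<close> by (simp flip: power_add)
        ultimately show "q ^ i \<noteq> q ^ j"
          using primitive_root_of_unity_nonzero[OF q] by auto
      qed
      have "(\<lambda>k. q ^ k) ` {..<l} \<subseteq> {x. poly ?D x = 0}"
      proof clarify
        fix k assume k: "k < l"
        have "(q ^ k) ^ l = 1" by (metis l(2) mult.commute power_mult power_one)
        moreover have "(\<Prod>i<l. q ^ k - q ^ i) = 0" using k by (intro prod_zero) auto
        ultimately show "poly ?D (q ^ k) = 0" by (simp add: poly_prod poly_monom)
      qed
      from card_mono[OF poly_roots_finite[OF D] this] show ?thesis
        unfolding card_image[OF inj] card_lessThan .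
    qed
    ultimately show False using card_poly_roots_bound[OF D] by simp
  qed
qed

text \<open>Normalizing each factor to be monic costs the product of all
  \<open>inverse q ^ k\<close>, an inverse power of \<open>q\<close> with exponent l (l - 1) / 2.
  For odd \<open>l\<close> this is a multiple of \<open>l\<close>, so the product is 1.\<close>

lemma prod_inverse_roots_of_unity_poly:
  fixes q :: "'k::field"
  assumes q: "primitive_root_of_unity l q" and "odd l"
  shows "(\<Prod>k<l. [:- 1, inverse q ^ k:]) = Polynomial.monom 1 l - 1"
proof -
  have q0: "q \<noteq> 0" using primitive_root_of_unity_nonzero[OF q] .
  have "[:- 1, inverse q ^ k:] = Polynomial.smult (inverse q ^ k) [:- (q ^ k), 1:]" for k
    using q0 by (simp add: power_inverse)
  then have "(\<Prod>k<l. [:- 1, inverse q ^ k:])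
      = Polynomial.smult (\<Prod>k<l. inverse q ^ k) (\<Prod>k<l. [:- (q ^ k), 1:])"
    by (simp only: prod_smult)
  moreover have "(\<Prod>k<l. inverse q ^ k) = 1"
  proof -
    obtain m where m: "l = 2 * m + 1" using \<open>odd l\<close> by (auto elim: oddE)
    have "(\<Prod>k<n. inverse q ^ k) = inverse q ^ (\<Sum>k<n. k)" for n
      by (simp add: power_sum)
    moreover have "(\<Sum>k<2 * m + 1. k) = (2 * m + 1) * m"
      by (induction m) (auto simp: algebra_simps)
    ultimately show ?thesis
      using q unfolding primitive_root_of_unity_def m
      by (simp only: power_mult) (metis inverse_1 power_inverse power_one)
  qed
  ultimately show ?thesis by (simp add: prod_roots_of_unity_poly[OF q])
qed

text \<open>The product does not vanish at 1, the only root of the linear factor. Divided by its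
  value \<open>c^-1\<close> at 1 and subtracted from 1, it leaves a polynomial divisible by
  \<open>T - 1\<close>. The two polynomials are those that express \<open>x d\<close> and
  \<open>d^(l-1) x^(l-1)\<close> in \<open>al\<close>.\<close>

lemma bezout_roots_of_unity:
  fixes q :: "'k::field"
  assumes q: "primitive_root_of_unity l q"
  shows "\<exists>U c. U * [:- 1, 1:] + Polynomial.smult c (\<Prod>k<l - 1. [:- 1, q ^ Suc k:]) = 1"
proof -
  let ?G = "\<Prod>k<l - 1. [:- 1, q ^ Suc k:]"
  have "q ^ Suc k \<noteq> 1" if "k < l - 1" for k
    using q that by (auto simp: primitive_root_of_unity_def simp del: power_Suc)
  then have "poly ?G 1 \<noteq> 0" by (auto simp: poly_prod)
  then have "poly (1 - Polynomial.smult (inverse (poly ?G 1)) ?G) 1 = 0" by simp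
  then obtain U where "1 - Polynomial.smult (inverse (poly ?G 1)) ?G = [:- 1, 1:] * U"
    unfolding poly_eq_0_iff_dvd by (elim dvdE)
  then show ?thesis by (metis add.commute diff_eq_eq mult.commute)
qed

section \<open>A single pair of generators\<close>

text \<open>Kept independent of the presentation, because it is applied to the generators of
  \<open>Dq\<close>, to their images in the localized algebra and to twisted generators.\<close>

locale weyl_pair = scalar_ring A \<kappa> for A (structure) and \<kappa> :: "'k::field \<Rightarrow> 'a" +
  fixes q :: 'k and x d :: 'a
  assumes q_nonzero: "q \<noteq> 0"
    and x_closed [simp, intro]: "x \<in> carrier A" and d_closed [simp, intro]: "d \<in> carrier A"
    and dx: "d \<otimes> x = \<kappa> q \<otimes> (x \<otimes> d) \<oplus> \<kappa> (q - 1)"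
begin

definition al :: 'a where "al = \<one> \<oplus> x \<otimes> d"

lemma al_closed [simp, intro]: "al \<in> carrier A"
  by (simp add: al_def)

lemma xd_eq: "x \<otimes> d = ev al [:- 1, 1:]"
proof -
  have "ev al [:- 1, 1:] = \<ominus> \<one> \<oplus> (\<one> \<oplus> x \<otimes> d)"
    by (simp add: kappa_minus) (simp add: al_def)
  then show ?thesis by (simp add: a_assoc[symmetric] l_neg)
qed

text \<open>The defining relation reads \<open>1 + d x = q (1 + x d)\<close>. This makes
  \<open>al\<close> the natural variable: both products of \<open>x\<close> and \<open>d\<close> are
  linear in it.\<close>

lemma dx_eq: "d \<otimes> x = ev al [:- 1, q:]"
proof -
  have "ev al [:- 1, q:] = \<ominus> \<one> \<oplus> \<kappa> q \<otimes> al"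
    by (simp add: kappa_minus kappa_central)
  also have "\<dots> = \<ominus> \<one> \<oplus> (\<kappa> q \<oplus> \<kappa> q \<otimes> (x \<otimes> d))" by (simp add: al_def r_distr)
  also have "\<dots> = \<kappa> q \<otimes> (x \<otimes> d) \<oplus> (\<kappa> q \<ominus> \<one>)"
    by (simp add: a_minus_def a_ac)
  finally show ?thesis by (simp add: dx kappa_diff)
qed

lemma ev_linear: "ev al [:a, b:] = \<kappa> a \<oplus> \<kappa> b \<otimes> al"
  by (simp add: kappa_central)

lemma al_x: "al \<otimes> x = \<kappa> q \<otimes> (x \<otimes> al)"
proof -
  have "al \<otimes> x = x \<oplus> x \<otimes> (d \<otimes> x)" by (simp add: al_def l_distr m_assoc)
  also have "\<dots> = x \<oplus> x \<otimes> (\<ominus> \<one> \<oplus> \<kappa> q \<otimes> al)"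
    unfolding dx_eq ev_linear by (simp add: kappa_minus)
  also have "\<dots> = x \<oplus> (\<ominus> x \<oplus> \<kappa> q \<otimes> (x \<otimes> al))"
    by (simp add: r_distr r_minus kappa_left_comm)
  finally show ?thesis by (simp add: a_assoc[symmetric] r_neg)
qed

lemma d_al: "d \<otimes> al = \<kappa> q \<otimes> (al \<otimes> d)"
proof -
  have "d \<otimes> al = d \<oplus> (d \<otimes> x) \<otimes> d" by (simp add: al_def r_distr m_assoc)
  also have "\<dots> = d \<oplus> (\<ominus> \<one> \<oplus> \<kappa> q \<otimes> al) \<otimes> d"
    unfolding dx_eq ev_linear by (simp add: kappa_minus)
  also have "\<dots> = d \<oplus> (\<ominus> d \<oplus> \<kappa> q \<otimes> (al \<otimes> d))"
    by (simp add: l_distr l_minus m_assoc)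
  finally show ?thesis by (simp add: a_assoc[symmetric] r_neg)
qed

lemma al_d: "al \<otimes> d = \<kappa> (inverse q) \<otimes> (d \<otimes> al)"
  by (simp add: d_al kappa_kappa q_nonzero)

text \<open>An eigenvector of conjugation by \<open>al\<close> with eigenvalue \<open>w\<close>,
  written without an inverse of \<open>al\<close>, which does not exist in \<open>Dq\<close> before
  localization.\<close>

definition wt :: "'k \<Rightarrow> 'a \<Rightarrow> bool" where
  "wt w h \<longleftrightarrow> h \<in> carrier A \<and> al \<otimes> h = \<kappa> w \<otimes> (h \<otimes> al)"

lemma wt_closed: "wt w h \<Longrightarrow> h \<in> carrier A"
  by (simp add: wt_def)

lemma wt_x: "wt q x" and wt_d: "wt (inverse q) d" and wt_al: "wt 1 al" and wt_one: "wt 1 \<one>"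
  and wt_kappa: "wt 1 (\<kappa> c)"
  by (simp_all add: wt_def al_x al_d kappa_central)

lemma wt_mult:
  assumes "wt v a" "wt w b" shows "wt (v * w) (a \<otimes> b)"
proof -
  have [simp]: "a \<in> carrier A" "b \<in> carrier A" using assms by (auto simp: wt_def)
  have "al \<otimes> (a \<otimes> b) = \<kappa> v \<otimes> (a \<otimes> (al \<otimes> b))"
    using assms(1) by (simp add: wt_def m_assoc flip: m_assoc[of al])
  also have "al \<otimes> b = \<kappa> w \<otimes> (b \<otimes> al)" using assms(2) by (simp add: wt_def)
  also have "a \<otimes> (\<kappa> w \<otimes> (b \<otimes> al)) = \<kappa> w \<otimes> (a \<otimes> (b \<otimes> al))"
    by (simp add: kappa_left_comm[of a])
  finally show ?thesis by (simp add: wt_def kappa_kappa m_assoc)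
qed

lemma wt_pow: "wt w a \<Longrightarrow> wt (w ^ n) (a [^] n)" for n :: nat
proof (induction n)
  case (Suc n)
  then show ?case using wt_mult[of "w ^ n" "a [^] n" w a] by (simp add: mult.commute)
qed (simp add: wt_one)

lemma wt_central: "\<lbrakk>z \<in> carrier A; z \<otimes> al = al \<otimes> z\<rbrakk> \<Longrightarrow> wt 1 z"
  by (simp add: wt_def)

lemma wt_ev: "wt 1 (ev al p)"
  unfolding wt_def using ev_comm[OF al_closed al_closed refl, of p] by simp

lemma wt_swap: "\<lbrakk>wt w h; w \<noteq> 0\<rbrakk> \<Longrightarrow> h \<otimes> al = \<kappa> (inverse w) \<otimes> (al \<otimes> h)"
  unfolding wt_def by (metis al_closed kappa_inverse(1) m_closed)

lemma wt_ev_swap: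
  assumes "wt w h" "w \<noteq> 0"
  shows "h \<otimes> ev al p = ev al (pcompose p [:0, inverse w:]) \<otimes> h"
  using assms by (intro ev_intertwine) (auto simp: wt_swap wt_closed)

lemma wt_ev_swap':
  assumes "wt w h" "w \<noteq> 0"
  shows "ev al p \<otimes> h = h \<otimes> ev al (pcompose p [:0, w:])"
  using wt_ev_swap[OF assms, of "pcompose p [:0, w:]"] assms
  by (simp add: pcompose_scale pcompose_idR)

text \<open>In the induction the innermost \<open>x d = al - 1\<close> is moved past
  \<open>d^m\<close>, which has weight \<open>inverse q ^ m\<close> and rescales \<open>al\<close>
  accordingly.\<close>

lemma x_pow_d_pow: "x [^] m \<otimes> d [^] m = ev al (\<Prod>k<m. [:- 1, inverse q ^ k:])"
proof (induction m)
  case (Suc m)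
  have "x [^] Suc m \<otimes> d [^] Suc m = x [^] m \<otimes> ((x \<otimes> d) \<otimes> d [^] m)"
    unfolding nat_pow_Suc2[OF d_closed] by (simp add: m_assoc)
  also have "(x \<otimes> d) \<otimes> d [^] m = d [^] m \<otimes> ev al [:- 1, inverse q ^ m:]"
    unfolding xd_eq using wt_ev_swap'[OF wt_pow[OF wt_d, of m], of "[:- 1, 1:]"] q_nonzero
    by (simp add: pcompose_pCons del: ev_pCons)
  also have "x [^] m \<otimes> (d [^] m \<otimes> ev al [:- 1, inverse q ^ m:]) = x [^] m \<otimes> d [^] m \<otimes> ev al [:- 1, inverse q ^ m:]"
    by (simp add: m_assoc del: ev_pCons)
  finally show ?case unfolding Suc prod.lessThan_Suc ev_mult[OF al_closed] .
qed simp

text \<open>As for \<open>x_pow_d_pow\<close>; the exponent \<open>Suc k\<close> arises because the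
  innermost product is \<open>d x = q al - 1\<close> instead of \<open>al - 1\<close>.\<close>

lemma d_pow_x_pow: "d [^] m \<otimes> x [^] m = ev al (\<Prod>k<m. [:- 1, q ^ Suc k:])"
proof (induction m)
  case (Suc m)
  have "d [^] Suc m \<otimes> x [^] Suc m = d [^] m \<otimes> ((d \<otimes> x) \<otimes> x [^] m)"
    unfolding nat_pow_Suc2[OF x_closed] by (simp add: m_assoc)
  also have "(d \<otimes> x) \<otimes> x [^] m = x [^] m \<otimes> ev al [:- 1, q ^ Suc m:]"
    unfolding dx_eq using wt_ev_swap'[OF wt_pow[OF wt_x, of m], of "[:- 1, q:]"] q_nonzero
    by (simp add: pcompose_pCons mult.commute del: ev_pCons)
  also have "d [^] m \<otimes> (x [^] m \<otimes> ev al [:- 1, q ^ Suc m:]) = d [^] m \<otimes> x [^] m \<otimes> ev al [:- 1, q ^ Suc m:]"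
    by (simp add: m_assoc del: ev_pCons)
  finally show ?case unfolding Suc prod.lessThan_Suc ev_mult[OF al_closed] .
qed simp

text \<open>For exponent \<open>l\<close> the product in \<open>x_pow_d_pow\<close> runs over all
  \<open>l\<close>-th roots of unity and collapses to \<open>al^l - 1\<close>. Hence
  \<open>al^l\<close> is central as soon as \<open>x^l\<close> and \<open>d^l\<close> are.\<close>

lemma al_pow_root:
  assumes "primitive_root_of_unity l q" "odd l"
  shows "al [^] l = \<one> \<oplus> x [^] l \<otimes> d [^] l"
proof -
  have "x [^] l \<otimes> d [^] l = al [^] l \<ominus> \<one>"
    by (simp add: x_pow_d_pow prod_inverse_roots_of_unity_poly[OF assms] ev_minus ev_monom)
  then show ?thesis using a_lcomm[of \<one> "al [^] l" "\<ominus> \<one>"] by (simp add: a_minus_def r_neg)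
qed

end

section \<open>Enveloping algebras\<close>

text \<open>The properties of A \<otimes> A^opp on which the construction of the idempotent rests,
  with \<open>Zc\<close> the image of the base ring in \<open>A\<close>. The quotient of formal sums
  stays hidden until the end.\<close>

locale enveloping = A: ring A + B: ring B
  for A :: "('a, 'x) ring_scheme" (structure) and B :: "('b, 'y) ring_scheme" +
  fixes Zc :: "'a set" and \<kappa> :: "'k::field \<Rightarrow> 'a"
    and lam rho :: "'a \<Rightarrow> 'b" and act :: "'b \<Rightarrow> 'a \<Rightarrow> 'a"
  assumes Zc_subring: "subring Zc A"
    and Zc_central: "\<lbrakk>z \<in> Zc; a \<in> carrier A\<rbrakk> \<Longrightarrow> z \<otimes> a = a \<otimes> z"
    and kappa_Zc: "\<kappa> k \<in> Zc"
    and k_add: "\<kappa> (k + m) = \<kappa> k \<oplus> \<kappa> m"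
    and k_mult: "\<kappa> (k * m) = \<kappa> k \<otimes> \<kappa> m"
    and k_one: "\<kappa> 1 = \<one>"
    and lam_closed [simp, intro]: "a \<in> carrier A \<Longrightarrow> lam a \<in> carrier B"
    and rho_closed [simp, intro]: "a \<in> carrier A \<Longrightarrow> rho a \<in> carrier B"
    and lam_add: "\<lbrakk>a \<in> carrier A; b \<in> carrier A\<rbrakk> \<Longrightarrow> lam (a \<oplus> b) = lam a \<oplus>\<^bsub>B\<^esub> lam b"
    and rho_add: "\<lbrakk>a \<in> carrier A; b \<in> carrier A\<rbrakk> \<Longrightarrow> rho (a \<oplus> b) = rho a \<oplus>\<^bsub>B\<^esub> rho b"
    and lam_mult: "\<lbrakk>a \<in> carrier A; b \<in> carrier A\<rbrakk> \<Longrightarrow> lam (a \<otimes> b) = lam a \<otimes>\<^bsub>B\<^esub> lam b"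
    and rho_mult: "\<lbrakk>a \<in> carrier A; b \<in> carrier A\<rbrakk> \<Longrightarrow> rho (a \<otimes> b) = rho b \<otimes>\<^bsub>B\<^esub> rho a"
    and lam_one [simp]: "lam \<one> = \<one>\<^bsub>B\<^esub>"
    and rho_one [simp]: "rho \<one> = \<one>\<^bsub>B\<^esub>"
    and rho_lam: "\<lbrakk>a \<in> carrier A; b \<in> carrier A\<rbrakk> \<Longrightarrow> rho b \<otimes>\<^bsub>B\<^esub> lam a = lam a \<otimes>\<^bsub>B\<^esub> rho b"
    and lam_Zc: "z \<in> Zc \<Longrightarrow> lam z = rho z"
    and B_span: "s \<in> carrier B \<Longrightarrow>
          s \<in> add_span B {lam a \<otimes>\<^bsub>B\<^esub> rho b | a b. a \<in> carrier A \<and> b \<in> carrier A}"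
    and act_closed [simp, intro]: "\<lbrakk>s \<in> carrier B; a \<in> carrier A\<rbrakk> \<Longrightarrow> act s a \<in> carrier A"
    and act_add_left: "\<lbrakk>s \<in> carrier B; t \<in> carrier B; a \<in> carrier A\<rbrakk>
          \<Longrightarrow> act (s \<oplus>\<^bsub>B\<^esub> t) a = act s a \<oplus> act t a"
    and act_add_right: "\<lbrakk>s \<in> carrier B; a \<in> carrier A; b \<in> carrier A\<rbrakk>
          \<Longrightarrow> act s (a \<oplus> b) = act s a \<oplus> act s b"
    and act_mult: "\<lbrakk>s \<in> carrier B; t \<in> carrier B; a \<in> carrier A\<rbrakk>
          \<Longrightarrow> act (s \<otimes>\<^bsub>B\<^esub> t) a = act s (act t a)"
    and act_lam: "\<lbrakk>a \<in> carrier A; b \<in> carrier A\<rbrakk> \<Longrightarrow> act (lam a) b = a \<otimes> b"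
    and act_rho: "\<lbrakk>a \<in> carrier A; b \<in> carrier A\<rbrakk> \<Longrightarrow> act (rho a) b = b \<otimes> a"
begin

abbreviation B_mult (infixl "\<bullet>" 70) where "s \<bullet> t \<equiv> s \<otimes>\<^bsub>B\<^esub> t"

lemma Zc_closed [simp, intro]: "z \<in> Zc \<Longrightarrow> z \<in> carrier A"
  using subringE(1)[OF Zc_subring] by blast

sublocale KA: scalar_ring A \<kappa>
proof
  show "a \<otimes> \<kappa> k = \<kappa> k \<otimes> a" if "a \<in> carrier A" for a k
    using Zc_central[OF kappa_Zc that] by (rule sym)
qed (simp_all add: k_add k_mult k_one Zc_closed[OF kappa_Zc])

lemma lam_zero [simp]: "lam \<zero> = \<zero>\<^bsub>B\<^esub>"
  using lam_add[of \<zero> \<zero>] by (simp add: B.add.l_cancel_one')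

lemma rho_zero [simp]: "rho \<zero> = \<zero>\<^bsub>B\<^esub>"
  using rho_add[of \<zero> \<zero>] by (simp add: B.add.l_cancel_one')

lemma act_zero_left [simp]: "a \<in> carrier A \<Longrightarrow> act \<zero>\<^bsub>B\<^esub> a = \<zero>"
  using act_lam[of \<zero> a] by simp

lemma act_zero_right [simp]: "b \<in> carrier B \<Longrightarrow> act b \<zero> = \<zero>"
  using act_add_right[of b \<zero> \<zero>] by (simp add: A.add.l_cancel_one')

lemma act_one [simp]: "a \<in> carrier A \<Longrightarrow> act \<one>\<^bsub>B\<^esub> a = a"
  using act_lam[of \<one> a] by simp

lemma pure_closed: "{lam a \<bullet> rho c | a c. a \<in> carrier A \<and> c \<in> carrier A} \<subseteq> carrier B"
  by auto

lemma B_induct [consumes 1, case_names pure plus]: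
  assumes "b \<in> carrier B"
    and pure: "\<And>a c. \<lbrakk>a \<in> carrier A; c \<in> carrier A\<rbrakk> \<Longrightarrow> P (lam a \<bullet> rho c)"
    and plus: "\<And>a b. \<lbrakk>a \<in> carrier B; b \<in> carrier B; P a; P b\<rbrakk> \<Longrightarrow> P (a \<oplus>\<^bsub>B\<^esub> b)"
  shows "P b"
  using pure_closed B_span[OF assms(1)]
proof (induction rule: B.add_span_induct)
  case zero
  then show ?case using pure[of \<zero> \<zero>] by simp
qed (auto intro: pure plus)

text \<open>Stated for every central element, not only for those of \<open>Zc\<close>, because the
  determination of the centre of \<open>A\<close> applies it before the two are known to
  agree.\<close>

lemma central_commutes:
  assumes z: "z \<in> carrier A" "\<And>a. a \<in> carrier A \<Longrightarrow> z \<otimes> a = a \<otimes> z" and b: "b \<in> carrier B"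
  shows "b \<bullet> lam z = lam z \<bullet> b"
  using b
proof (induction rule: B_induct)
  case (pure a c)
  have "lam a \<bullet> rho c \<bullet> lam z = lam (a \<otimes> z) \<bullet> rho c"
    using pure z by (simp add: B.m_assoc rho_lam lam_mult)
  also have "\<dots> = lam z \<bullet> (lam a \<bullet> rho c)"
    using pure z(1) by (simp add: B.m_assoc lam_mult z(2)[OF pure(1), symmetric])
  finally show ?case .
qed (simp add: B.l_distr B.r_distr z(1))

abbreviation \<kappa>B :: "'k \<Rightarrow> 'b" where "\<kappa>B k \<equiv> lam (\<kappa> k)"

sublocale KB: scalar_ring B \<kappa>B
proof
  show "s \<bullet> \<kappa>B k = \<kappa>B k \<bullet> s" if "s \<in> carrier B" for s k
    using that Zc_central[OF kappa_Zc] by (intro central_commutes) auto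
qed (simp_all add: lam_add lam_mult k_add k_mult)

lemma act_ev:
  assumes b: "b \<in> carrier B" and h: "h \<in> carrier A" and eq: "act b h = \<kappa> w \<otimes> h"
  shows "act (KB.ev b p) h = \<kappa> (poly p w) \<otimes> h"
proof (induction p)
  case (pCons c p)
  have "act b (\<kappa> (poly p w) \<otimes> h) = act b (act (\<kappa>B (poly p w)) h)"
    using h by (simp add: act_lam)
  also have "\<dots> = act (\<kappa>B (poly p w)) (act b h)"
    using h b by (simp add: KB.kappa_central flip: act_mult)
  also have "\<dots> = \<kappa> (poly p w * w) \<otimes> h"
    using h by (simp add: eq act_lam KA.kappa_kappa)
  finally show ?case
    using b h
    by (simp add: act_add_left act_mult act_lam pCons KA.kappa_add A.l_distr mult.commute)
qed (use h in simp)

lemma act_central: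
  assumes "z \<in> Zc" "a \<in> carrier A" "b \<in> carrier B"
  shows "act b (z \<otimes> a) = z \<otimes> act b a"
proof -
  have "act b (z \<otimes> a) = act (b \<bullet> lam z) a"
    using assms by (simp add: act_mult act_lam)
  also have "b \<bullet> lam z = lam z \<bullet> b"
    using assms Zc_central by (intro central_commutes) auto
  finally show ?thesis using assms by (simp add: act_mult act_lam)
qed

text \<open>When \<open>e\<close> maps \<open>H\<close> into \<open>Zc\<close>, the generator for
  \<open>u\<close>, \<open>v\<close> acts on \<open>H\<close> as the rank-one operator sending
  \<open>x\<close> to \<open>act e (v x) u\<close>. Writing the unit in this form is therefore a
  dual basis of \<open>H\<close>.\<close>

definition lam_span :: "'b \<Rightarrow> 'a set \<Rightarrow> 'b set" where
  "lam_span e H = add_span B {lam u \<bullet> e \<bullet> lam v | u v. u \<in> H \<and> v \<in> H}"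

text \<open>For a subalgebra \<open>H\<close>, such an \<open>e\<close> exhibits \<open>H\<close> as an Azumaya algebra; commutation with
  the centralizer of \<open>H\<close> replaces membership of \<open>e\<close> in the enveloping algebra of \<open>H\<close>.\<close>

definition azumaya_idem :: "'a set \<Rightarrow> 'b \<Rightarrow> bool" where
  "azumaya_idem H e \<longleftrightarrow> e \<in> carrier B \<and> H \<subseteq> carrier A \<and>
     (\<forall>h\<in>H. lam h \<bullet> e = rho h \<bullet> e) \<and>
     (\<forall>a\<in>carrier A. (\<forall>h\<in>H. a \<otimes> h = h \<otimes> a) \<longrightarrow>
        lam a \<bullet> e = e \<bullet> lam a \<and> rho a \<bullet> e = e \<bullet> rho a) \<and>
     (\<forall>h\<in>H. act e h \<in> Zc) \<and> act e \<one> = \<one> \<and> \<one>\<^bsub>B\<^esub> \<in> lam_span e H"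

lemma lam_span_gens:
  assumes "e \<in> carrier B" "H \<subseteq> carrier A"
  shows "{lam u \<bullet> e \<bullet> lam v | u v. u \<in> H \<and> v \<in> H} \<subseteq> carrier B"
  using assms by (auto simp: subset_iff)

lemma lam_span_plus:
  assumes "e \<in> carrier B" "H \<subseteq> carrier A" "a \<in> lam_span e H" "b \<in> lam_span e H"
  shows "a \<oplus>\<^bsub>B\<^esub> b \<in> lam_span e H"
  using assms lam_span_gens[OF assms(1,2)] unfolding lam_span_def by (intro B.add_span_plus)

lemma lam_span_zero: "\<zero>\<^bsub>B\<^esub> \<in> lam_span e H"
  unfolding lam_span_def by (rule add_span.zero)

lemma lam_span_mult:
  assumes e: "e \<in> carrier B" and H: "H \<subseteq> carrier A" and sub: "H' \<subseteq> H" and uv: "u \<in> H" "v \<in> H"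
    and mult: "\<And>h. h \<in> H' \<Longrightarrow> u \<otimes> h \<in> H" "\<And>h. h \<in> H' \<Longrightarrow> h \<otimes> v \<in> H"
    and b: "b \<in> lam_span e H'"
  shows "lam u \<bullet> b \<bullet> lam v \<in> lam_span e H"
  unfolding lam_span_def
proof (rule B.add_span_image[OF B.abelian_group_axioms _ _ b[unfolded lam_span_def],
      where f = "\<lambda>b. lam u \<bullet> b \<bullet> lam v"])
  have uvc: "u \<in> carrier A" "v \<in> carrier A" using uv H by auto
  then show "lam u \<bullet> \<zero>\<^bsub>B\<^esub> \<bullet> lam v = \<zero>\<^bsub>B\<^esub>" by simp
  show "lam u \<bullet> (a \<oplus>\<^bsub>B\<^esub> b) \<bullet> lam v
      = lam u \<bullet> a \<bullet> lam v \<oplus>\<^bsub>B\<^esub> lam u \<bullet> b \<bullet> lam v"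
    if "a \<in> carrier B" "b \<in> carrier B" for a b
    using uvc that by (simp add: B.l_distr B.r_distr)
  fix s assume "s \<in> {lam u \<bullet> e \<bullet> lam v | u v. u \<in> H' \<and> v \<in> H'}"
  then obtain u' v' where s: "s = lam u' \<bullet> e \<bullet> lam v'" "u' \<in> H'" "v' \<in> H'" by blast
  then have c: "u' \<in> carrier A" "v' \<in> carrier A" using H sub by auto
  have "lam u \<bullet> s \<bullet> lam v = lam (u \<otimes> u') \<bullet> e \<bullet> lam (v' \<otimes> v)"
    using c uvc e by (simp add: s(1) lam_mult B.m_assoc)
  then show "lam u \<bullet> s \<bullet> lam v \<in> add_span B {lam u \<bullet> e \<bullet> lam v | u v. u \<in> H \<and> v \<in> H}"
    using s mult by (intro B.add_span_incl lam_span_gens[OF e H]) auto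
qed (use lam_span_gens[OF e H] lam_span_gens[OF e, of H'] H sub in auto)

lemma azumaya_idem_trivial: "azumaya_idem Zc \<one>\<^bsub>B\<^esub>"
proof -
  have "\<one>\<^bsub>B\<^esub> \<in> lam_span \<one>\<^bsub>B\<^esub> Zc"
    unfolding lam_span_def
    by (rule B.add_span_incl)
      (use subringE(3)[OF Zc_subring] in \<open>auto intro!: exI[of _ \<one>]\<close>)
  then show ?thesis by (auto simp: azumaya_idem_def lam_Zc)
qed

lemma subring_products:
  assumes H1: "subring H1 A" and H2: "subring H2 A"
    and comm: "\<And>a b. \<lbrakk>a \<in> H1; b \<in> H2\<rbrakk> \<Longrightarrow> b \<otimes> a = a \<otimes> b"
  defines "H \<equiv> add_span A {a \<otimes> b | a b. a \<in> H1 \<and> b \<in> H2}"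
  shows "subring H A" "H1 \<subseteq> H" "H2 \<subseteq> H"
proof -
  note E1 = subringE[OF H1] and E2 = subringE[OF H2]
  let ?S = "{a \<otimes> b | a b. a \<in> H1 \<and> b \<in> H2}"
  have S: "?S \<subseteq> carrier A" using E1(1) E2(1) by auto
  have incl: "a \<otimes> b \<in> H" if "a \<in> H1" "b \<in> H2" for a b
    unfolding H_def using that by (intro A.add_span_incl[OF S]) auto
  show 1: "H1 \<subseteq> H" using incl[OF _ E2(3)] E1(1) by (metis A.r_one subsetD subsetI)
  show 2: "H2 \<subseteq> H" using incl[OF E1(3)] E2(1) by (metis A.l_one subsetD subsetI)
  show "subring H A"
    unfolding H_def
  proof (rule A.subring_add_span[OF S])
    show "\<one> \<in> add_span A ?S" using 1 E1(3) unfolding H_def by blast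
    fix s assume "s \<in> ?S"
    then obtain a b where s: "s = a \<otimes> b" "a \<in> H1" "b \<in> H2" by blast
    then have "\<ominus> s = (\<ominus> a) \<otimes> b" using E1(1) E2(1) by (auto simp: A.l_minus subsetD)
    then show "\<ominus> s \<in> add_span A ?S" using incl[of "\<ominus> a" b] s E1(5) unfolding H_def by auto
    fix t assume "t \<in> ?S"
    then obtain c d where t: "t = c \<otimes> d" "c \<in> H1" "d \<in> H2" by blast
    have cl: "a \<in> carrier A" "b \<in> carrier A" "c \<in> carrier A" "d \<in> carrier A"
      using s t E1(1) E2(1) by auto
    have "s \<otimes> t = a \<otimes> (b \<otimes> c) \<otimes> d" using cl s t by (simp add: A.m_assoc)
    also have "\<dots> = (a \<otimes> c) \<otimes> (b \<otimes> d)" using cl comm[OF t(2) s(3)] by (simp add: A.m_assoc)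
    finally show "s \<otimes> t \<in> add_span A ?S"
      using incl[of "a \<otimes> c" "b \<otimes> d"] s t E1(6) E2(6) unfolding H_def by auto
  qed
qed

text \<open>The internal form of the fact that tensor products of Azumaya algebras are Azumaya. Each
  of \<open>H1\<close>, \<open>H2\<close> lies in the centralizer of the other, so \<open>e2\<close>
  passes \<open>lam\<close> and \<open>rho\<close> of \<open>H1\<close>, and \<open>e1\<close> those
  of \<open>H2\<close>.\<close>

lemma azumaya_idem_products:
  assumes H1: "subring H1 A" and H2: "subring H2 A"
    and comm: "\<And>a b. \<lbrakk>a \<in> H1; b \<in> H2\<rbrakk> \<Longrightarrow> b \<otimes> a = a \<otimes> b"
    and e1: "azumaya_idem H1 e1" and e2: "azumaya_idem H2 e2"
  defines "H \<equiv> add_span A {a \<otimes> b | a b. a \<in> H1 \<and> b \<in> H2}"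
  shows "azumaya_idem H (e2 \<bullet> e1)"
proof -
  note sp = subring_products[OF H1 H2 comm, folded H_def]
  note E1 = subringE[OF H1] and E2 = subringE[OF H2] and E = subringE[OF sp(1)]
  note e1' = e1[unfolded azumaya_idem_def] and e2' = e2[unfolded azumaya_idem_def]
  have c [simp]: "e1 \<in> carrier B" "e2 \<in> carrier B" using e1' e2' by auto
  let ?e = "e2 \<bullet> e1"
  let ?S = "{a \<otimes> b | a b. a \<in> H1 \<and> b \<in> H2}"
  have S: "?S \<subseteq> carrier A" using E1(1) E2(1) by auto
  have c1: "a \<in> carrier A" if "a \<in> H1" for a using that E1(1) by auto
  have c2: "a \<in> carrier A" if "a \<in> H2" for a using that E2(1) by auto
  have swap1: "lam a \<bullet> e2 = e2 \<bullet> lam a" "rho a \<bullet> e2 = e2 \<bullet> rho a" if "a \<in> H1" for a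
    using e2' comm[OF that] c1[OF that] by metis+
  have swap2: "lam a \<bullet> e1 = e1 \<bullet> lam a" "rho a \<bullet> e1 = e1 \<bullet> rho a" if "a \<in> H2" for a
    using e1' comm[OF _ that] c2[OF that] by metis+
  have lr1: "lam a \<bullet> ?e = rho a \<bullet> ?e" if "a \<in> H1" for a
  proof -
    have "lam a \<bullet> ?e = e2 \<bullet> (lam a \<bullet> e1)"
      using c1[OF that] swap1[OF that] by (simp flip: B.m_assoc)
    also have "lam a \<bullet> e1 = rho a \<bullet> e1" using e1' that by auto
    also have "e2 \<bullet> (rho a \<bullet> e1) = rho a \<bullet> ?e"
      using c1[OF that] swap1[OF that] by (simp flip: B.m_assoc)
    finally show ?thesis .
  qed
  have lr2: "lam a \<bullet> ?e = rho a \<bullet> ?e" if "a \<in> H2" for a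
    using e2' c2[OF that] that by (simp flip: B.m_assoc)
  have lr: "lam h \<bullet> ?e = rho h \<bullet> ?e" if "h \<in> H" for h
    using S that[unfolded H_def]
  proof (induction rule: A.add_span_induct)
    case (incl s)
    then obtain a b where s: "s = a \<otimes> b" "a \<in> H1" "b \<in> H2" by blast
    note cl = c1[OF s(2)] c2[OF s(3)]
    have "lam s \<bullet> ?e = lam a \<bullet> (rho b \<bullet> ?e)"
      using cl lr2[OF s(3)] by (simp add: s lam_mult B.m_assoc)
    also have "\<dots> = rho b \<bullet> (lam a \<bullet> ?e)" using cl by (simp add: rho_lam flip: B.m_assoc)
    also have "\<dots> = rho s \<bullet> ?e" using cl lr1[OF s(2)] by (simp add: s rho_mult B.m_assoc)
    finally show ?case .
  qed (auto simp: lam_add rho_add B.l_distr)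
  have cen: "lam a \<bullet> ?e = ?e \<bullet> lam a \<and> rho a \<bullet> ?e = ?e \<bullet> rho a"
    if a: "a \<in> carrier A" "\<forall>h\<in>H. a \<otimes> h = h \<otimes> a" for a
  proof -
    have "\<forall>h\<in>H1. a \<otimes> h = h \<otimes> a" "\<forall>h\<in>H2. a \<otimes> h = h \<otimes> a" using a sp(2,3) by auto
    then have *: "lam a \<bullet> e1 = e1 \<bullet> lam a" "rho a \<bullet> e1 = e1 \<bullet> rho a"
      "lam a \<bullet> e2 = e2 \<bullet> lam a" "rho a \<bullet> e2 = e2 \<bullet> rho a"
      using e1' e2' a by auto
    have "f a \<bullet> ?e = ?e \<bullet> f a" if "f a \<in> carrier B"
      "f a \<bullet> e1 = e1 \<bullet> f a" "f a \<bullet> e2 = e2 \<bullet> f a" for f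
      using that by (metis B.m_assoc c)
    then show ?thesis using * a by auto
  qed
  \<comment> \<open>Since \<open>e1\<close> commutes with \<open>rho b\<close>, it acts on the left
    factor alone and turns it into a central scalar, through which \<open>e2\<close> then acts on
    \<open>b\<close>.\<close>
  have act1: "act ?e (a \<otimes> b) = act e1 a \<otimes> act e2 b" if "a \<in> H1" "b \<in> H2" for a b
  proof -
    note cl = c1[OF that(1)] c2[OF that(2)]
    have z: "act e1 a \<in> Zc" using e1' that by auto
    have "act e1 (a \<otimes> b) = act (e1 \<bullet> rho b) a" using cl by (simp add: act_mult act_rho)
    also have "\<dots> = act e1 a \<otimes> b" using cl by (simp add: act_mult act_rho flip: swap2[OF that(2)])
    finally show ?thesis using cl z by (simp add: act_mult act_central)
  qed
  have act: "act ?e h \<in> Zc" if "h \<in> H" for h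
    using S that[unfolded H_def]
  proof (induction rule: A.add_span_induct)
    case (incl s)
    then obtain a b where s: "s = a \<otimes> b" "a \<in> H1" "b \<in> H2" by blast
    then have "act e1 a \<in> Zc" "act e2 b \<in> Zc" using e1' e2' by auto
    then show ?case using act1[OF s(2,3)] s(1) subringE(6)[OF Zc_subring] by simp
  next
    case (plus a b)
    then show ?case using subringE(7)[OF Zc_subring] by (simp add: act_add_right)
  qed (use subringE(2)[OF Zc_subring] in simp)
  have act_1: "act ?e \<one> = \<one>" using e1' e2' by (simp add: act_mult)
  \<comment> \<open>Multiplying the expansion of the unit through \<open>e1\<close> by
    \<open>e2\<close> puts \<open>e2\<close> into the span of \<open>?e\<close>; this is then
    inserted into the expansion of the unit through \<open>e2\<close>.\<close>
  have span: "\<one>\<^bsub>B\<^esub> \<in> lam_span ?e H"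
  proof -
    have "e2 \<in> lam_span ?e H"
    proof -
      have *: "\<one>\<^bsub>B\<^esub> \<in> lam_span e1 H1" using e1' by auto
      have "e2 \<bullet> \<one>\<^bsub>B\<^esub> \<in> lam_span ?e H"
        unfolding lam_span_def
      proof (rule B.add_span_image[OF B.abelian_group_axioms _ _ *[unfolded lam_span_def],
            where f = "\<lambda>b. e2 \<bullet> b"])
        fix s assume "s \<in> {lam u \<bullet> e1 \<bullet> lam v |u v. u \<in> H1 \<and> v \<in> H1}"
        then obtain u v where s: "s = lam u \<bullet> e1 \<bullet> lam v" "u \<in> H1" "v \<in> H1" by blast
        have "e2 \<bullet> s = (e2 \<bullet> lam u) \<bullet> e1 \<bullet> lam v" using s c1 by (simp add: B.m_assoc)
        also have "\<dots> = lam u \<bullet> ?e \<bullet> lam v"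
          using s c1 by (simp add: B.m_assoc flip: swap1(1))
        finally have "e2 \<bullet> s \<in> {lam u \<bullet> ?e \<bullet> lam v |u v. u \<in> H \<and> v \<in> H}"
          using s sp(2) by blast
        then show "e2 \<bullet> s \<in> add_span B {lam u \<bullet> ?e \<bullet> lam v |u v. u \<in> H \<and> v \<in> H}"
          by (rule B.add_span_incl[rotated]) (use lam_span_gens[OF _ E(1), of ?e] in simp)
      qed (use lam_span_gens[OF _ E(1), of ?e] lam_span_gens[OF _ E1(1), of e1] in \<open>auto simp: B.r_distr\<close>)
      then show ?thesis by simp
    qed
    note e2s = this
    have *: "\<one>\<^bsub>B\<^esub> \<in> lam_span e2 H2" using e2' by auto
    have "id \<one>\<^bsub>B\<^esub> \<in> lam_span ?e H"
      unfolding lam_span_def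
    proof (rule B.add_span_image[OF B.abelian_group_axioms _ _ *[unfolded lam_span_def]])
      fix s assume "s \<in> {lam u \<bullet> e2 \<bullet> lam v |u v. u \<in> H2 \<and> v \<in> H2}"
      then obtain u v where s: "s = lam u \<bullet> e2 \<bullet> lam v" "u \<in> H2" "v \<in> H2" by blast
      have "lam u \<bullet> e2 \<bullet> lam v \<in> lam_span ?e H"
        by (rule lam_span_mult[OF _ E(1) subset_refl _ _ _ _ e2s]) (use s sp E(6) in auto)
      then show "id s \<in> add_span B {lam u \<bullet> ?e \<bullet> lam v |u v. u \<in> H \<and> v \<in> H}"
        using s by (simp add: lam_span_def)
    qed (use lam_span_gens[OF _ E(1), of ?e] lam_span_gens[OF _ E2(1), of e2] in auto)
    then show ?thesis by simp
  qed
  show ?thesis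
    unfolding azumaya_idem_def using lr cen act act_1 span E(1) by auto
qed

end

section \<open>The Azumaya property of a single pair\<close>

locale enveloping_pair = enveloping A B Zc \<kappa> lam rho act
  for A :: "('a, 'x) ring_scheme" (structure) and B :: "('b, 'y) ring_scheme"
    and Zc :: "'a set" and \<kappa> :: "'k::field \<Rightarrow> 'a" and lam rho act +
  fixes q :: 'k and l :: nat and x d ai :: 'a
  assumes root: "primitive_root_of_unity l q" and odd_l: "odd l" and l_gt_1: "l > 1"
    and char_l: "of_nat l \<noteq> (0::'k)"
    and x_cl: "x \<in> carrier A" and d_cl: "d \<in> carrier A"
    and dx_rel: "d \<otimes> x = \<kappa> q \<otimes> (x \<otimes> d) \<oplus> \<kappa> (q - 1)"
    and ai_closed [simp, intro]: "ai \<in> carrier A"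
    and al_ai': "(\<one> \<oplus> x \<otimes> d) \<otimes> ai = \<one>" and ai_al': "ai \<otimes> (\<one> \<oplus> x \<otimes> d) = \<one>"
    and x_pow_Zc: "x [^] l \<in> Zc" and d_pow_Zc: "d [^] l \<in> Zc" and ai_pow_Zc: "ai [^] l \<in> Zc"
begin

sublocale W: weyl_pair A \<kappa> q x d
  using primitive_root_of_unity_nonzero[OF root] x_cl d_cl dx_rel by unfold_locales auto

abbreviation "al \<equiv> W.al"

lemma al_ai [simp]: "al \<otimes> ai = \<one>" and ai_al [simp]: "ai \<otimes> al = \<one>"
  using al_ai' ai_al' by (simp_all add: W.al_def)

lemma q_pow_l: "q ^ l = 1"
  using root by (simp add: primitive_root_of_unity_def)

lemma inverse_q: "inverse q = q ^ (l - 1)"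
  using q_pow_l W.q_nonzero l_gt_1 by (simp add: field_simps flip: power_Suc)

lemma al_pow_Zc: "al [^] l \<in> Zc"
  using W.al_pow_root[OF root odd_l] subringE(3,6,7)[OF Zc_subring] x_pow_Zc d_pow_Zc by simp

lemma wt_Zc: "z \<in> Zc \<Longrightarrow> W.wt 1 z"
  using Zc_central by (intro W.wt_central) auto

lemma wt_ai: assumes "W.wt w h" "w \<noteq> 0" shows "ai \<otimes> h = \<kappa> (inverse w) \<otimes> (h \<otimes> ai)"
proof -
  have h: "h \<in> carrier A" using assms by (simp add: W.wt_def)
  have "h \<otimes> ai = ai \<otimes> (al \<otimes> h) \<otimes> ai" using h by (simp flip: A.m_assoc)
  also have "al \<otimes> h = \<kappa> w \<otimes> (h \<otimes> al)" using assms by (simp add: W.wt_def)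
  also have "ai \<otimes> (\<kappa> w \<otimes> (h \<otimes> al)) \<otimes> ai = \<kappa> w \<otimes> (ai \<otimes> h \<otimes> (al \<otimes> ai))"
    using h by (simp add: A.m_assoc KA.kappa_left_comm[of ai])
  also have "\<dots> = \<kappa> w \<otimes> (ai \<otimes> h)" using h by simp
  finally show ?thesis using assms(2) h by (simp add: KA.kappa_kappa)
qed

section \<open>Averaging over conjugation by \<open>al\<close>\<close>

text \<open>Acts on \<open>A\<close> as conjugation by \<open>al\<close>, so that elements of weight
  \<open>w\<close> are eigenvectors with eigenvalue \<open>w\<close>.\<close>

definition g :: 'b where "g = lam al \<bullet> rho ai"

lemma g_closed [simp, intro]: "g \<in> carrier B"
  by (simp add: g_def)

lemma lam_g: assumes "W.wt w h" "w \<noteq> 0" shows "lam h \<bullet> g = \<kappa>B (inverse w) \<bullet> (g \<bullet> lam h)"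
proof -
  have h: "h \<in> carrier A" using assms by (simp add: W.wt_def)
  have "lam h \<bullet> g = lam (h \<otimes> al) \<bullet> rho ai" using h by (simp add: g_def lam_mult B.m_assoc)
  also have "h \<otimes> al = \<kappa> (inverse w) \<otimes> (al \<otimes> h)" using W.wt_swap[OF assms] .
  finally show ?thesis using h by (simp add: g_def lam_mult B.m_assoc rho_lam)
qed

lemma rho_g: assumes "W.wt w h" "w \<noteq> 0" shows "rho h \<bullet> g = \<kappa>B (inverse w) \<bullet> (g \<bullet> rho h)"
proof -
  have h: "h \<in> carrier A" using assms by (simp add: W.wt_def)
  have "rho h \<bullet> g = lam al \<bullet> (rho h \<bullet> rho ai)"
    using h rho_lam[of al h] by (simp add: g_def flip: B.m_assoc)
  also have "rho h \<bullet> rho ai = rho (ai \<otimes> h)" using h by (simp add: rho_mult)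
  also have "ai \<otimes> h = (\<kappa> (inverse w)) \<otimes> (h \<otimes> ai)" using wt_ai[OF assms] .
  also have "rho (\<kappa> (inverse w) \<otimes> (h \<otimes> ai)) = \<kappa>B (inverse w) \<bullet> (rho ai \<bullet> rho h)"
    using h by (simp add: rho_mult KB.kappa_central lam_Zc[OF kappa_Zc, symmetric])
  finally show ?thesis using h by (simp add: g_def B.m_assoc KB.kappa_left_comm[of "lam al"])
qed

lemma lam_ev_g: assumes "W.wt w h" "w \<noteq> 0"
  shows "lam h \<bullet> KB.ev g p = KB.ev g (pcompose p [:0, inverse w:]) \<bullet> lam h"
  using lam_g[OF assms] assms by (intro KB.ev_intertwine) (auto simp: W.wt_closed)

text \<open>Left multiplication by \<open>al\<close> agrees with right multiplication on the range of \<open>p0\<close>, the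
  projection of \<open>A\<close> onto the centralizer of \<open>al\<close>.\<close>

definition p0 :: 'b where "p0 = KB.ev g (avg_poly l)"

lemma p0_closed [simp, intro]: "p0 \<in> carrier B"
  by (simp add: p0_def)

lemma g_pow: "g [^]\<^bsub>B\<^esub> m = lam (al [^] m) \<bullet> rho (ai [^] m)" for m :: nat
proof (induction m)
  case (Suc m)
  have "g [^]\<^bsub>B\<^esub> Suc m = lam (al [^] m) \<bullet> (rho (ai [^] m) \<bullet> lam al) \<bullet> rho ai"
    using Suc by (simp add: B.m_assoc) (simp add: g_def B.m_assoc)
  also have "\<dots> = lam (al [^] Suc m) \<bullet> rho (ai \<otimes> ai [^] m)"
    by (simp add: rho_lam lam_mult rho_mult B.m_assoc)
  also have "ai \<otimes> ai [^] m = ai [^] Suc m" by (simp only: A.nat_pow_Suc2 ai_closed)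
  finally show ?case .
qed simp

lemma al_pow_ai_pow: "al [^] m \<otimes> ai [^] m = \<one>" for m :: nat
proof (induction m)
  case (Suc m)
  have "al [^] Suc m \<otimes> ai [^] Suc m = al [^] m \<otimes> ((al \<otimes> ai) \<otimes> ai [^] m)"
    unfolding A.nat_pow_Suc2[OF ai_closed] by (simp add: A.m_assoc del: al_ai)
  then show ?case using Suc by simp
qed simp

text \<open>The power \<open>ai^l\<close> lies in \<open>Zc\<close>, so it can be moved from the
  right tensor factor to the left one, where it cancels \<open>al^l\<close>.\<close>

lemma g_pow_l: "g [^]\<^bsub>B\<^esub> l = \<one>\<^bsub>B\<^esub>"
proof -
  have "g [^]\<^bsub>B\<^esub> l = lam (al [^] l) \<bullet> lam (ai [^] l)"
    by (simp add: g_pow lam_Zc[OF ai_pow_Zc])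
  then show ?thesis by (simp add: al_pow_ai_pow flip: lam_mult)
qed

text \<open>The telescoped product \<open>(s - 1) avg(s)\<close> is a multiple of
  \<open>s^l - 1\<close>, which kills \<open>t\<close>. The factor \<open>t\<close> allows for
  \<open>s^l\<close> being the identity only on part of \<open>B\<close>: for \<open>S\<close> below
  this is known only on \<open>p0\<close>.\<close>

lemma ev_avg_fixed:
  assumes s: "s \<in> carrier B" and t: "t \<in> carrier B" and st: "s [^]\<^bsub>B\<^esub> l \<bullet> t = t"
  shows "s \<bullet> (KB.ev s (avg_poly l) \<bullet> t) = KB.ev s (avg_poly l) \<bullet> t"
proof -
  have "KB.ev s [:- 1, 1:] \<bullet> (KB.ev s (avg_poly l) \<bullet> t)
      = KB.ev s ([:- 1, 1:] * avg_poly l) \<bullet> t"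
    using s t by (simp only: KB.ev_mult B.m_assoc KB.ev_closed)
  also have "\<dots> = \<zero>\<^bsub>B\<^esub>"
    unfolding avg_poly_telescope using s t st
    by (simp add: KB.ev_smult KB.ev_minus KB.ev_monom B.m_assoc B.minus_eq B.l_distr B.l_minus B.r_neg)
  finally have "\<ominus>\<^bsub>B\<^esub> (KB.ev s (avg_poly l) \<bullet> t) \<oplus>\<^bsub>B\<^esub> s \<bullet> (KB.ev s (avg_poly l) \<bullet> t) = \<zero>\<^bsub>B\<^esub>"
    using s t by (simp add: KB.kappa_minus[of 1, simplified] B.l_distr B.l_minus)
  then show ?thesis
    using s t by (metis B.a_inv_closed B.add.m_comm B.m_closed B.minus_equality B.minus_minus KB.ev_closed)
qed

text \<open>Because \<open>lam al = rho al g\<close> and \<open>p0\<close> absorbs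
  \<open>g\<close>.\<close>

lemma lam_al_p0: "lam al \<bullet> p0 = rho al \<bullet> p0"
proof -
  have gp: "g \<bullet> p0 = p0"
    using ev_avg_fixed[of g "\<one>\<^bsub>B\<^esub>"] by (simp add: g_pow_l p0_def)
  have "lam al = lam al \<bullet> (rho ai \<bullet> rho al)" by (simp flip: rho_mult)
  also have "\<dots> = g \<bullet> rho al" by (simp add: g_def B.m_assoc)
  also have "\<dots> = rho al \<bullet> g" using rho_g[OF W.wt_al] by simp
  finally have "lam al \<bullet> p0 = rho al \<bullet> (g \<bullet> p0)" by (simp add: B.m_assoc)
  then show ?thesis by (simp add: gp)
qed

text \<open>\<open>Csp\<close> is \<open>Zc[al]\<close>, and \<open>Hsp\<close> is the subalgebra generated by \<open>Zc\<close>, \<open>x\<close> and \<open>d\<close>: every monomial in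
  \<open>x\<close> and \<open>d\<close> collapses to a power of one of them times a polynomial in \<open>al\<close>.\<close>

definition Csp :: "'a set" where
  "Csp = add_span A {r \<otimes> al [^] j | r j. r \<in> Zc \<and> j \<in> (UNIV :: nat set)}"

definition Hgen :: "'a set" where
  "Hgen = {r \<otimes> (z [^] a \<otimes> al [^] j) | r z a j. r \<in> Zc \<and> z \<in> {x, d} \<and> (a :: nat) \<in> UNIV \<and> (j :: nat) \<in> UNIV}"

definition Hsp :: "'a set" where "Hsp = add_span A Hgen"

lemma C_gens: "{r \<otimes> al [^] j | r j. r \<in> Zc \<and> j \<in> (UNIV :: nat set)} \<subseteq> carrier A"
  by auto

lemma H_gens: "Hgen \<subseteq> carrier A"
  by (auto simp: Hgen_def)

lemma Csp_plus: "\<lbrakk>a \<in> Csp; b \<in> Csp\<rbrakk> \<Longrightarrow> a \<oplus> b \<in> Csp"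
  unfolding Csp_def by (rule A.add_span_plus[OF C_gens])

lemma Hsp_closed: "c \<in> Hsp \<Longrightarrow> c \<in> carrier A"
  unfolding Hsp_def by (rule A.add_span_closed[OF H_gens])

lemma Hsp_zero: "\<zero> \<in> Hsp" and Hsp_plus: "\<lbrakk>a \<in> Hsp; b \<in> Hsp\<rbrakk> \<Longrightarrow> a \<oplus> b \<in> Hsp"
  unfolding Hsp_def by (auto intro: add_span.zero A.add_span_plus[OF H_gens])

lemma wt_xd: "z \<in> {x, d} \<Longrightarrow> \<exists>v. primitive_root_of_unity l v \<and> W.wt v z \<and> (\<exists>m. v = q ^ m)"
  using W.wt_x W.wt_d root primitive_root_of_unity_inverse[OF root] inverse_q
  by (metis empty_iff insert_iff power_one_right)

lemma wt_Hgen: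
  fixes a j :: nat
  assumes "r \<in> Zc" "W.wt v z"
  shows "W.wt (v ^ a) (r \<otimes> (z [^] a \<otimes> al [^] j))"
proof -
  have "W.wt (1 * (v ^ a * 1 ^ j)) (r \<otimes> (z [^] a \<otimes> al [^] j))"
    by (intro W.wt_mult W.wt_pow wt_Zc[OF assms(1)] assms(2) W.wt_al)
  then show ?thesis by simp
qed

text \<open>Weights are written as natural powers of \<open>q\<close>, using
  \<open>inverse q = q^(l-1)\<close>, so that statements about them can be proved by induction on
  the exponent.\<close>

lemma Hgen_wt: assumes "s \<in> Hgen" shows "\<exists>m. W.wt (q ^ m) s"
proof -
  from assms obtain r z a j where s: "s = r \<otimes> (z [^] (a::nat) \<otimes> al [^] (j::nat))" "r \<in> Zc" "z \<in> {x, d}"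
    unfolding Hgen_def by blast
  obtain m where "W.wt (q ^ m) z" using wt_xd[OF s(3)] by auto
  then show ?thesis using wt_Hgen[OF s(2)] s(1) by (metis power_mult)
qed

lemma lam_p0_Csp: "c \<in> Csp \<Longrightarrow> lam c \<bullet> p0 = rho c \<bullet> p0"
proof -
  have pow: "lam (al [^] j) \<bullet> p0 = rho (al [^] j) \<bullet> p0" for j :: nat
  proof (induction j)
    case (Suc j)
    have "lam (al [^] Suc j) \<bullet> p0 = lam (al [^] j) \<bullet> (rho al \<bullet> p0)"
      by (simp add: lam_mult B.m_assoc lam_al_p0)
    also have "\<dots> = rho al \<bullet> (lam (al [^] j) \<bullet> p0)" by (simp add: rho_lam flip: B.m_assoc)
    also have "\<dots> = rho (al [^] Suc j) \<bullet> p0" by (simp add: Suc rho_mult B.m_assoc)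
    finally show ?case .
  qed simp
  assume c: "c \<in> Csp"
  show ?thesis
    using C_gens c[unfolded Csp_def]
  proof (induction rule: A.add_span_induct)
    case (incl s)
    then obtain r j where s: "s = r \<otimes> al [^] (j::nat)" "r \<in> Zc" by blast
    have "lam s \<bullet> p0 = rho r \<bullet> (rho (al [^] j) \<bullet> p0)"
      using s pow[of j] by (simp add: lam_mult B.m_assoc lam_Zc)
    also have "\<dots> = rho s \<bullet> p0"
      using s by (simp add: rho_mult B.m_assoc Zc_central[OF s(2), of "al [^] j"])
    finally show ?case .
  qed (auto simp: lam_add rho_add B.l_distr)
qed

lemma act_g: assumes "W.wt w h" shows "act g h = \<kappa> w \<otimes> h"
  using assms by (simp add: W.wt_def g_def act_mult act_lam act_rho A.m_assoc flip: A.m_assoc[of al])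

lemma act_p0: assumes "W.wt w h" "w ^ l = 1" shows "act p0 h = (if w = 1 then h else \<zero>)"
  using act_ev[OF g_closed W.wt_closed[OF assms(1)] act_g[OF assms(1)], of "avg_poly l"] assms
  by (simp add: p0_def poly_avg_poly poly_avg_poly_1 char_l W.wt_closed)

text \<open>A generator has weight \<open>v^a\<close> with \<open>v\<close> primitive, so
  \<open>p0\<close> kills it unless \<open>l\<close> divides \<open>a\<close>. In the surviving case
  \<open>z^a\<close> is central and only the power of \<open>al\<close> remains.\<close>

lemma act_p0_Hsp: assumes "h \<in> Hsp" shows "act p0 h \<in> Csp"
  using H_gens assms[unfolded Hsp_def]
proof (induction rule: A.add_span_induct)
  case (incl s)
  then obtain r z a j where s: "s = r \<otimes> (z [^] (a::nat) \<otimes> al [^] (j::nat))" "r \<in> Zc" "z \<in> {x, d}"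
    unfolding Hgen_def by blast
  obtain v where v: "primitive_root_of_unity l v" "W.wt v z" using wt_xd[OF s(3)] by auto
  have "v ^ l = 1" using v(1) by (simp add: primitive_root_of_unity_def)
  then have "(v ^ a) ^ l = 1" by (metis mult.commute power_mult power_one)
  then have act: "act p0 s = (if l dvd a then s else \<zero>)"
    using act_p0[OF wt_Hgen[OF s(2) v(2)], of a j] s(1)
    by (simp add: primitive_root_of_unity_power_eq_1_iff[OF v(1)])
  show ?case
  proof (cases "l dvd a")
    case True
    then obtain b where a: "a = l * b" by blast
    have z: "z [^] l \<in> Zc" "z \<in> carrier A" using s(3) x_pow_Zc d_pow_Zc by auto
    have "z [^] (l * b) \<in> Zc"
      using z subringE(3,6)[OF Zc_subring] by (induction b) (auto simp: A.nat_pow_mult[symmetric])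
    then have "r \<otimes> z [^] a \<in> Zc" using s(2) subringE(6)[OF Zc_subring] by (simp add: a)
    moreover have "s = (r \<otimes> z [^] a) \<otimes> al [^] j" using s z by (simp add: A.m_assoc)
    ultimately show ?thesis
      unfolding Csp_def act if_P[OF True] by (intro A.add_span_incl[OF C_gens]) blast
  qed (simp add: act Csp_def add_span.zero)
next
  case (plus a b)
  then show ?case using Csp_plus[of "act p0 a" "act p0 b"] by (simp add: act_add_right)
qed (simp add: Csp_def add_span.zero)

text \<open>An element of weight 1 is fixed by \<open>p0\<close>, hence lies in
  \<open>Csp\<close>.\<close>

lemma lam_p0_wt_1: assumes "h \<in> Hsp" "W.wt 1 h" shows "lam h \<bullet> p0 = rho h \<bullet> p0"
  using act_p0_Hsp[OF assms(1)] act_p0[OF assms(2)] lam_p0_Csp by simp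

section \<open>The span \<open>Hsp\<close> is a subring\<close>

lemma Hgen_Hsp: "\<lbrakk>r \<in> Zc; z \<in> {x, d}\<rbrakk> \<Longrightarrow> r \<otimes> (z [^] (a::nat) \<otimes> al [^] (j::nat)) \<in> Hsp"
  unfolding Hsp_def by (rule A.add_span_incl[OF H_gens]) (auto simp: Hgen_def)

lemma Zc_Hsp: "r \<in> Zc \<Longrightarrow> r \<in> Hsp"
  using Hgen_Hsp[of r x 0 0] by simp

lemma x_Hsp: "x \<in> Hsp" and d_Hsp: "d \<in> Hsp" and al_Hsp: "al \<in> Hsp"
  using Hgen_Hsp[OF subringE(3)[OF Zc_subring], of x 1 0] Hgen_Hsp[OF subringE(3)[OF Zc_subring], of d 1 0]
    Hgen_Hsp[OF subringE(3)[OF Zc_subring], of x 0 1]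
  by simp_all

lemma Hsp_left_mult:
  assumes y: "y \<in> carrier A" and gen: "\<And>s. s \<in> Hgen \<Longrightarrow> y \<otimes> s \<in> Hsp" and h: "h \<in> Hsp"
  shows "y \<otimes> h \<in> Hsp"
  using A.add_span_image[OF A.abelian_group_axioms H_gens H_gens h[unfolded Hsp_def], of "\<lambda>h. y \<otimes> h"] y gen
  by (auto simp: Hsp_def A.r_distr)

lemma Zc_mult_Hsp: assumes r: "r \<in> Zc" and h: "h \<in> Hsp" shows "r \<otimes> h \<in> Hsp"
proof (rule Hsp_left_mult[OF _ _ h])
  fix s assume "s \<in> Hgen"
  then obtain t z a j where s: "s = t \<otimes> (z [^] (a::nat) \<otimes> al [^] (j::nat))" "t \<in> Zc" "z \<in> {x, d}"
    unfolding Hgen_def by blast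
  then have "r \<otimes> s = (r \<otimes> t) \<otimes> (z [^] a \<otimes> al [^] j)" using r by (auto simp: A.m_assoc)
  then show "r \<otimes> s \<in> Hsp" using Hgen_Hsp s subringE(6)[OF Zc_subring r s(2)] by simp
qed (use r in auto)

lemma kappa_mult_Hsp: "h \<in> Hsp \<Longrightarrow> \<kappa> c \<otimes> h \<in> Hsp"
  by (rule Zc_mult_Hsp[OF kappa_Zc])

lemma ev_mult_Hsp:
  assumes y: "y \<in> carrier A" and "\<And>h. h \<in> Hsp \<Longrightarrow> y \<otimes> h \<in> Hsp" and h: "h \<in> Hsp"
  shows "KA.ev y p \<otimes> h \<in> Hsp"
proof (induction p)
  case (pCons c p)
  have "KA.ev y (pCons c p) \<otimes> h = \<kappa> c \<otimes> h \<oplus> y \<otimes> (KA.ev y p \<otimes> h)"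
    using y Hsp_closed[OF h] by (simp add: A.l_distr A.m_assoc)
  then show ?case using assms(2)[OF pCons(2)] kappa_mult_Hsp[OF h] by (simp add: Hsp_plus)
qed (use Hsp_closed[OF h] Hsp_zero in simp)

lemma al_mult_Hsp: assumes h: "h \<in> Hsp" shows "al \<otimes> h \<in> Hsp"
proof (rule Hsp_left_mult[OF _ _ h])
  fix s assume "s \<in> Hgen"
  then obtain t z a j where s: "s = t \<otimes> (z [^] (a::nat) \<otimes> al [^] (j::nat))" "t \<in> Zc" "z \<in> {x, d}"
    unfolding Hgen_def by blast
  obtain v where v: "W.wt v z" using wt_xd[OF s(3)] by auto
  have "al \<otimes> s = \<kappa> (v ^ a) \<otimes> (s \<otimes> al)" using wt_Hgen[OF s(2) v, of a j] s by (simp add: W.wt_def)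
  also have "s \<otimes> al = t \<otimes> (z [^] a \<otimes> al [^] Suc j)" using s by (auto simp: A.m_assoc)
  finally show "al \<otimes> s \<in> Hsp" using Hgen_Hsp[OF s(2,3)] kappa_mult_Hsp by metis
qed simp

lemma xd_mult_Hsp:
  assumes y: "y \<in> {x, d}" and h: "h \<in> Hsp" shows "y \<otimes> h \<in> Hsp"
proof (rule Hsp_left_mult[OF _ _ h])
  show yc: "y \<in> carrier A" using y by auto
  fix s assume "s \<in> Hgen"
  then obtain t z a j where s: "s = t \<otimes> (z [^] (a::nat) \<otimes> al [^] (j::nat))" "t \<in> Zc" "z \<in> {x, d}"
    unfolding Hgen_def by blast
  have zc: "z \<in> carrier A" and tc: "t \<in> carrier A" using s by auto
  have ys: "y \<otimes> s = t \<otimes> (y \<otimes> (z [^] a \<otimes> al [^] j))"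
    using s yc zc by (simp add: A.m_assoc[symmetric] Zc_central[OF s(2) yc])
  have "y \<otimes> (z [^] a \<otimes> al [^] j) \<in> Hsp"
  proof (cases "y = z \<or> a = 0")
    case True
    then have "y \<otimes> (z [^] a \<otimes> al [^] j) = \<one> \<otimes> (y [^] Suc a \<otimes> al [^] j)"
      unfolding A.nat_pow_Suc2[OF yc] using yc zc by (auto simp: A.m_assoc)
    then show ?thesis using Hgen_Hsp[OF subringE(3)[OF Zc_subring] y] by metis
  next
    case False
    then obtain b where a: "a = Suc b" by (cases a) auto
    have "y \<otimes> (z [^] a \<otimes> al [^] j) = (y \<otimes> z) \<otimes> (z [^] b \<otimes> al [^] j)"
      unfolding a A.nat_pow_Suc2[OF zc] using yc zc by (simp add: A.m_assoc)
    also have "\<exists>p. y \<otimes> z = KA.ev al p"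
      using False y s(3) by (metis W.dx_eq W.xd_eq empty_iff insert_iff)
    then obtain p where "y \<otimes> z = KA.ev al p" ..
    also have "KA.ev al p \<otimes> (z [^] b \<otimes> al [^] j) \<in> Hsp"
      using Hgen_Hsp[OF subringE(3)[OF Zc_subring] s(3), of b j] zc
      by (intro ev_mult_Hsp al_mult_Hsp) auto
    finally show ?thesis .
  qed
  then show "y \<otimes> s \<in> Hsp" unfolding ys by (rule Zc_mult_Hsp[OF s(2)])
qed

lemma pow_mult_Hsp:
  assumes "y \<in> carrier A" "\<And>h. h \<in> Hsp \<Longrightarrow> y \<otimes> h \<in> Hsp" "h \<in> Hsp"
  shows "y [^] (m::nat) \<otimes> h \<in> Hsp"
  using assms(3)
proof (induction m arbitrary: h)
  case (Suc m)
  then show ?case using assms Hsp_closed[of h] by (simp add: A.m_assoc)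
qed (use Hsp_closed in simp)

lemma subring_Hsp: "subring Hsp A"
  unfolding Hsp_def
proof (rule A.subring_add_span[OF H_gens])
  fix s assume "s \<in> Hgen"
  then obtain t z a j where s: "s = t \<otimes> (z [^] (a::nat) \<otimes> al [^] (j::nat))" "t \<in> Zc" "z \<in> {x, d}"
    unfolding Hgen_def by blast
  have zc: "z \<in> carrier A" and tc: "t \<in> carrier A" using s by auto
  have "\<ominus> s = (\<ominus> t) \<otimes> (z [^] a \<otimes> al [^] j)" using s zc tc by (simp add: A.l_minus)
  then show "\<ominus> s \<in> add_span A Hgen"
    using Hgen_Hsp[OF subringE(5)[OF Zc_subring s(2)] s(3)] by (simp add: Hsp_def)
  fix s' assume "s' \<in> Hgen"
  then have s': "s' \<in> Hsp" unfolding Hsp_def by (rule A.add_span_incl[OF H_gens])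
  have "s \<otimes> s' = t \<otimes> (z [^] a \<otimes> (al [^] j \<otimes> s'))"
    using s zc Hsp_closed[OF s'] by (simp add: A.m_assoc)
  also have "\<dots> \<in> Hsp"
    using s' xd_mult_Hsp[OF s(3)] al_mult_Hsp zc by (intro Zc_mult_Hsp[OF s(2)] pow_mult_Hsp) auto
  finally show "s \<otimes> s' \<in> add_span A Hgen" by (simp add: Hsp_def)
qed (use Zc_Hsp[OF subringE(3)[OF Zc_subring]] in \<open>simp add: Hsp_def\<close>)

text \<open>The inverse equals \<open>ai^l al^(l-1)\<close>, a central element times a power of
  \<open>al\<close>.\<close>

lemma ai_Hsp: "ai \<in> Hsp"
proof -
  have l: "ai [^] l = ai [^] (l - 1) \<otimes> ai"
    using l_gt_1 by (metis A.nat_pow_Suc Suc_diff_1 less_trans zero_less_one)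
  have "ai [^] l \<otimes> al [^] (l - 1) = al [^] (l - 1) \<otimes> ai [^] l"
    by (rule Zc_central[OF ai_pow_Zc]) simp
  also have "\<dots> = ai" unfolding l by (simp add: al_pow_ai_pow flip: A.m_assoc)
  finally have "ai [^] l \<otimes> al [^] (l - 1) = ai" .
  moreover have "ai [^] l \<otimes> (x [^] (0::nat) \<otimes> al [^] (l - 1)) \<in> Hsp"
    by (rule Hgen_Hsp[OF ai_pow_Zc]) simp
  ultimately show ?thesis by simp
qed

lemma ev_al_Hsp: "KA.ev al p \<in> Hsp"
  using ev_mult_Hsp[OF W.al_closed al_mult_Hsp, of \<one>] Zc_Hsp[OF subringE(3)[OF Zc_subring]] by simp

lemma pow_Hsp: "h \<in> Hsp \<Longrightarrow> h [^] (m::nat) \<in> Hsp"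
  using subringE(3,6)[OF subring_Hsp] by (induction m) auto

text \<open>For invertible \<open>x\<close> the single pair \<open>x\<close>, \<open>x^-1\<close>
  would do. Instead the pair \<open>x\<close>, \<open>d\<close> is combined with
  \<open>d^(l-1)\<close>, \<open>x^(l-1)\<close>, which has the same weights because
  \<open>q^l = 1\<close>; the Bezout identity adjusts the two products so that they sum to
  1.\<close>

lemma pair_partition_of_unity:
  obtains w1 w2 y1 y2 where "w1 \<in> Hsp" "w2 \<in> Hsp" "y1 \<in> Hsp" "y2 \<in> Hsp"
    "W.wt q w1" "W.wt q w2" "W.wt (inverse q) y1" "W.wt (inverse q) y2"
    "w1 \<otimes> y1 \<oplus> w2 \<otimes> y2 = \<one>"
proof -
  obtain U c where Uc: "U * [:- 1, 1:] + Polynomial.smult c (\<Prod>k<l - 1. [:- 1, q ^ Suc k:]) = 1"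
    using bezout_roots_of_unity[OF root] by blast
  \<comment> \<open>The variable of \<open>U\<close> is rescaled by \<open>q\<close> in advance,
    because moving the factor to the left of \<open>x\<close> scales it back:
    \<open>x ?u = U(al) x\<close>.\<close>
  let ?u = "KA.ev al (pcompose U [:0, q:])"
  let ?w1 = "x \<otimes> ?u" and ?w2 = "\<kappa> c \<otimes> d [^] (l - 1)"
  have "?w1 \<otimes> d = KA.ev al U \<otimes> (x \<otimes> d)"
    using W.wt_ev_swap[OF W.wt_x W.q_nonzero, of "pcompose U [:0, q:]"] W.q_nonzero
    by (simp add: pcompose_scale pcompose_idR A.m_assoc)
  also have "\<dots> = KA.ev al (U * [:- 1, 1:])"
    unfolding W.xd_eq KA.ev_mult[OF W.al_closed] ..
  finally have 1: "?w1 \<otimes> d = KA.ev al (U * [:- 1, 1:])" .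
  have "?w2 \<otimes> x [^] (l - 1) = \<kappa> c \<otimes> (d [^] (l - 1) \<otimes> x [^] (l - 1))"
    by (simp add: A.m_assoc)
  also have "\<dots> = KA.ev al (Polynomial.smult c (\<Prod>k<l - 1. [:- 1, q ^ Suc k:]))"
    unfolding W.d_pow_x_pow KA.ev_smult[OF W.al_closed] ..
  finally have "?w1 \<otimes> d \<oplus> ?w2 \<otimes> x [^] (l - 1) = \<one>"
    using arg_cong[OF Uc, of "KA.ev al"] unfolding 1 KA.ev_add[OF W.al_closed] by simp
  moreover have "?w1 \<in> Hsp" "?w2 \<in> Hsp" "d \<in> Hsp" "x [^] (l - 1) \<in> Hsp"
    using subringE(6)[OF subring_Hsp] x_Hsp d_Hsp ev_al_Hsp pow_Hsp kappa_mult_Hsp by auto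
  moreover have "W.wt q ?w1" using W.wt_mult[OF W.wt_x W.wt_ev] by simp
  moreover have "W.wt q ?w2"
    using W.wt_mult[OF W.wt_kappa W.wt_pow[OF W.wt_d, of "l - 1"], of c] inverse_q
    by (metis inverse_inverse_eq mult_1 power_inverse)
  moreover have "W.wt (inverse q) (x [^] (l - 1))"
    using W.wt_pow[OF W.wt_x, of "l - 1"] inverse_q by simp
  ultimately show ?thesis using that W.wt_d by blast
qed

text \<open>In the proof, \<open>S\<close> acts on the centralizer of \<open>al\<close> as the automorphism shifting \<open>al\<close> by \<open>inverse q\<close>,
  so averaging its powers projects onto the centre.\<close>

lemma azumaya_idem_pair: "\<exists>e. azumaya_idem Hsp e"
proof -
  obtain w1 w2 y1 y2 where H: "w1 \<in> Hsp" "w2 \<in> Hsp" "y1 \<in> Hsp" "y2 \<in> Hsp"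
    and wt: "W.wt q w1" "W.wt q w2" "W.wt (inverse q) y1" "W.wt (inverse q) y2"
    and one: "w1 \<otimes> y1 \<oplus> w2 \<otimes> y2 = \<one>"
    by (rule pair_partition_of_unity)
  note cl [simp] = H[THEN Hsp_closed]
  define S where "S = lam w1 \<bullet> rho y1 \<oplus>\<^bsub>B\<^esub> lam w2 \<bullet> rho y2"
  have S [simp]: "S \<in> carrier B" by (simp add: S_def)
  define P :: "'k poly" where "P = avg_poly l"
  define e where "e = KB.ev S P \<bullet> p0"
  have e [simp]: "e \<in> carrier B" by (simp add: e_def)
  \<comment> \<open>The weights of \<open>w\<close> and \<open>y\<close> are inverse to each other,
    so the two scalars cancel. It follows that \<open>S\<close> commutes with the polynomial
    \<open>p0\<close> in \<open>g\<close>.\<close>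
  have Sg: "S \<bullet> g = g \<bullet> S"
  proof -
    have "(lam w \<bullet> rho y) \<bullet> g = g \<bullet> (lam w \<bullet> rho y)"
      if "W.wt q w" "W.wt (inverse q) y" for w y
    proof -
      note c [simp] = that[THEN W.wt_closed]
      have "(lam w \<bullet> rho y) \<bullet> g = lam w \<bullet> (\<kappa>B q \<bullet> (g \<bullet> rho y))"
        using rho_g[OF that(2)] W.q_nonzero by (simp add: B.m_assoc)
      also have "\<dots> = \<kappa>B q \<bullet> ((lam w \<bullet> g) \<bullet> rho y)"
        by (simp add: KB.kappa_left_comm[of "lam w"] B.m_assoc)
      also have "\<dots> = g \<bullet> (lam w \<bullet> rho y)"
        using lam_g[OF that(1)] W.q_nonzero by (simp add: B.m_assoc KB.kappa_inverse)
      finally show ?thesis .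
    qed
    then show ?thesis using wt by (simp add: S_def B.l_distr B.r_distr)
  qed
  have p0_ev_S: "p0 \<bullet> KB.ev S p = KB.ev S p \<bullet> p0" for p
    by (rule KB.ev_comm) (use KB.ev_comm[OF S g_closed Sg] in \<open>simp_all add: p0_def\<close>)
  have S_pow: "S [^]\<^bsub>B\<^esub> Suc m \<bullet> t = S \<bullet> (S [^]\<^bsub>B\<^esub> m \<bullet> t)" if "t \<in> carrier B" for m :: nat and t
    unfolding B.nat_pow_Suc2[OF S] using that by (simp add: B.m_assoc)
  \<comment> \<open>On \<open>p0\<close>, replacing \<open>lam h\<close> by \<open>rho h\<close>
    costs one factor \<open>S\<close> for each factor \<open>q\<close> in the weight. For the
    induction, \<open>1 = w1 y1 + w2 y2\<close> is inserted before \<open>h\<close>; the elements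
    \<open>y1 h\<close> and \<open>y2 h\<close> have weight \<open>q^m\<close>, and collecting
    \<open>lam w\<close> and \<open>rho y\<close> produces one more \<open>S\<close>.\<close>
  have shift: "lam h \<bullet> p0 = rho h \<bullet> (S [^]\<^bsub>B\<^esub> m \<bullet> p0)"
    if "h \<in> Hsp" "W.wt (q ^ m) h" for m h
    using that
  proof (induction m arbitrary: h)
    case 0
    then show ?case using lam_p0_wt_1 by simp
  next
    case (Suc m)
    note h [simp] = Hsp_closed[OF Suc.prems(1)]
    let ?t = "S [^]\<^bsub>B\<^esub> m \<bullet> p0"
    have yh: "rho (y \<otimes> h) \<bullet> ?t = lam (y \<otimes> h) \<bullet> p0" if "y \<in> Hsp" "W.wt (inverse q) y" for y
    proof -
      have "inverse q * q ^ Suc m = q ^ m" using W.q_nonzero by simp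
      then have "W.wt (q ^ m) (y \<otimes> h)"
        using W.wt_mult[OF that(2) Suc.prems(2)] by metis
      then show ?thesis using Suc.IH subringE(6)[OF subring_Hsp that(1) Suc.prems(1)] by simp
    qed
    have *: "rho h \<bullet> (lam w \<bullet> rho y \<bullet> ?t) = lam w \<bullet> (rho (y \<otimes> h) \<bullet> ?t)"
      if [simp]: "w \<in> carrier A" "y \<in> carrier A" for w y
      using rho_lam[of w h] by (simp add: rho_mult flip: B.m_assoc)
    have "rho h \<bullet> (S [^]\<^bsub>B\<^esub> Suc m \<bullet> p0)
        = rho h \<bullet> (lam w1 \<bullet> rho y1 \<bullet> ?t) \<oplus>\<^bsub>B\<^esub> rho h \<bullet> (lam w2 \<bullet> rho y2 \<bullet> ?t)"
      unfolding S_pow[OF p0_closed] by (simp add: S_def B.l_distr B.r_distr)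
    also have "\<dots> = lam w1 \<bullet> (lam (y1 \<otimes> h) \<bullet> p0) \<oplus>\<^bsub>B\<^esub> lam w2 \<bullet> (lam (y2 \<otimes> h) \<bullet> p0)"
      using H wt by (simp add: * yh)
    also have "\<dots> = lam ((w1 \<otimes> y1 \<oplus> w2 \<otimes> y2) \<otimes> h) \<bullet> p0"
      by (simp add: lam_mult lam_add B.l_distr B.m_assoc)
    finally show ?case by (simp add: one)
  qed
  \<comment> \<open>The unit has weight 1, which is also \<open>q^l\<close>, so \<open>shift\<close>
    applies to it with exponent \<open>l\<close>.\<close>
  have Sl: "S [^]\<^bsub>B\<^esub> l \<bullet> p0 = p0"
    using shift[of \<one> l] Zc_Hsp[OF subringE(3)[OF Zc_subring]] W.wt_one by (simp add: q_pow_l)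
  have Se: "S \<bullet> e = e"
    unfolding e_def P_def by (rule ev_avg_fixed[OF S p0_closed Sl])
  have Sme: "S [^]\<^bsub>B\<^esub> m \<bullet> e = e" for m :: nat
    by (induction m) (simp_all add: B.m_assoc Se)
  \<comment> \<open>The average over \<open>S\<close> contained in \<open>e\<close> absorbs the
    power of \<open>S\<close> that \<open>shift\<close> leaves behind.\<close>
  have lr_hom: "lam h \<bullet> e = rho h \<bullet> e" if "h \<in> Hsp" "W.wt (q ^ m) h" for m h
  proof -
    note h [simp] = Hsp_closed[OF that(1)]
    have "lam h \<bullet> e = (lam h \<bullet> p0) \<bullet> KB.ev S P"
      by (simp add: e_def B.m_assoc p0_ev_S)
    also have "\<dots> = rho h \<bullet> (S [^]\<^bsub>B\<^esub> m \<bullet> e)"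
      unfolding shift[OF that] by (simp add: e_def B.m_assoc p0_ev_S)
    finally show ?thesis by (simp add: Sme)
  qed
  have lr: "\<forall>h\<in>Hsp. lam h \<bullet> e = rho h \<bullet> e"
  proof
    fix h assume h: "h \<in> Hsp"
    show "lam h \<bullet> e = rho h \<bullet> e"
      using H_gens h[unfolded Hsp_def]
    proof (induction rule: A.add_span_induct)
      case (incl s)
      obtain m where "W.wt (q ^ m) s" using Hgen_wt[OF incl] ..
      then show ?case using lr_hom A.add_span_incl[OF H_gens incl] by (simp add: Hsp_def)
    qed (auto simp: lam_add rho_add B.l_distr)
  qed
  have cen: "lam a \<bullet> e = e \<bullet> lam a \<and> rho a \<bullet> e = e \<bullet> rho a"
    if a [simp]: "a \<in> carrier A" and ah: "\<forall>h\<in>Hsp. a \<otimes> h = h \<otimes> a" for a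
  proof -
    \<comment> \<open>The element \<open>e\<close> is built from polynomials in \<open>g\<close> and
      \<open>S\<close>, and these consist of images of elements of \<open>Hsp\<close>; for
      \<open>g\<close> this uses that \<open>ai\<close> lies in \<open>Hsp\<close>.\<close>
    have comm: "f \<bullet> e = e \<bullet> f"
      if f [simp]: "f \<in> carrier B"
        and fl: "\<And>h. h \<in> Hsp \<Longrightarrow> f \<bullet> lam h = lam h \<bullet> f"
        and fr: "\<And>h. h \<in> Hsp \<Longrightarrow> f \<bullet> rho h = rho h \<bullet> f" for f
    proof -
      have m: "f \<bullet> (s \<bullet> t) = (s \<bullet> t) \<bullet> f"
        if "s \<in> carrier B" "t \<in> carrier B" "f \<bullet> s = s \<bullet> f" "f \<bullet> t = t \<bullet> f" for s t
        using that by (metis B.m_assoc f)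
      have fg: "f \<bullet> g = g \<bullet> f"
        unfolding g_def using al_Hsp ai_Hsp by (intro m fl fr) auto
      have fS: "f \<bullet> S = S \<bullet> f"
        using H m[OF _ _ fl fr] by (simp add: S_def B.l_distr B.r_distr)
      show ?thesis
        unfolding e_def p0_def using KB.ev_comm[OF f S fS] KB.ev_comm[OF f g_closed fg] by (intro m) auto
    qed
    have "lam a \<bullet> lam h = lam h \<bullet> lam a" "lam a \<bullet> rho h = rho h \<bullet> lam a"
      "rho a \<bullet> lam h = lam h \<bullet> rho a" "rho a \<bullet> rho h = rho h \<bullet> rho a"
      if "h \<in> Hsp" for h
      using ah that Hsp_closed[OF that] a by (metis lam_mult rho_mult rho_lam)+
    then show ?thesis using comm by auto
  qed
  \<comment> \<open>On a central multiple of \<open>al^j\<close> the element \<open>S\<close> acts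
    as the scalar \<open>inverse q ^ j\<close>. Averaging keeps only the exponents divisible by
    \<open>l\<close>, for which \<open>al^j\<close> is central.\<close>
  have act_ev_S: "act (KB.ev S P) c \<in> Zc" if "c \<in> Csp" for c
    using C_gens that[unfolded Csp_def]
  proof (induction rule: A.add_span_induct)
    case (incl s)
    then obtain r j where s: "s = r \<otimes> al [^] (j::nat)" "r \<in> Zc" by blast
    have sc [simp]: "s \<in> carrier A" using s by auto
    have sw: "w \<otimes> s = \<kappa> (inverse q ^ j) \<otimes> (s \<otimes> w)" if "W.wt q w" for w
    proof -
      note w [simp] = W.wt_closed[OF that]
      have "w \<otimes> s = r \<otimes> (w \<otimes> KA.ev al (Polynomial.monom 1 j))"
        using s Zc_central[OF s(2) w] by (simp add: KA.ev_monom flip: A.m_assoc)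
      also have "w \<otimes> KA.ev al (Polynomial.monom 1 j) = KA.ev al (Polynomial.monom (inverse q ^ j) j) \<otimes> w"
        unfolding W.wt_ev_swap[OF that W.q_nonzero]
        by (rule arg_cong[where f = "\<lambda>p. KA.ev al p \<otimes> w"])
          (rule poly_eqI, simp add: coeff_pcompose_linear)
      finally show ?thesis
        using s by (simp add: KA.ev_monom KA.kappa_left_comm[of r] A.m_assoc)
    qed
    have "act S s = w1 \<otimes> s \<otimes> y1 \<oplus> w2 \<otimes> s \<otimes> y2"
      by (simp add: S_def act_add_left act_mult act_lam act_rho A.m_assoc)
    also have "\<dots> = \<kappa> (inverse q ^ j) \<otimes> (s \<otimes> (w1 \<otimes> y1 \<oplus> w2 \<otimes> y2))"
      using wt by (simp add: sw A.m_assoc A.r_distr)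
    finally have "act S s = \<kappa> (inverse q ^ j) \<otimes> s" by (simp add: one)
    from act_ev[OF S sc this] have act: "act (KB.ev S P) s = \<kappa> (poly P (inverse q ^ j)) \<otimes> s" .
    note iq = primitive_root_of_unity_inverse[OF root]
    show ?case
    proof (cases "l dvd j")
      case True
      then obtain b where j: "j = l * b" by blast
      have "al [^] (l * b) \<in> Zc"
        using al_pow_Zc subringE(3,6)[OF Zc_subring] by (induction b) (auto simp: A.nat_pow_mult[symmetric])
      then show ?thesis using act s(2) subringE(6)[OF Zc_subring] kappa_Zc by (simp add: s(1) j)
    next
      case False
      moreover have "(inverse q ^ j) ^ l = 1"
        using iq by (metis mult.commute power_mult power_one primitive_root_of_unity_def)
      ultimately show ?thesis
        using act subringE(2)[OF Zc_subring] primitive_root_of_unity_power_eq_1_iff[OF iq, of j]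
        by (simp add: P_def poly_avg_poly)
    qed
  next
    case (plus a b)
    then show ?case using subringE(7)[OF Zc_subring] by (simp add: act_add_right)
  qed (use subringE(2)[OF Zc_subring] in simp)
  have act_e: "\<forall>h\<in>Hsp. act e h \<in> Zc"
    using act_ev_S act_p0_Hsp Hsp_closed by (simp add: e_def act_mult)
  have act_1: "act e \<one> = \<one>"
  proof -
    have "act S \<one> = \<kappa> 1 \<otimes> \<one>"
      using one by (simp add: S_def act_add_left act_mult act_lam act_rho)
    then have "act (KB.ev S P) \<one> = \<one>"
      using act_ev[OF S A.one_closed, of 1 P]
      by (simp add: P_def poly_avg_poly_1 char_l)
    then show ?thesis using act_p0[OF W.wt_one] by (simp add: e_def act_mult)
  qed
  note HA = subringE(1)[OF subring_Hsp]
  \<comment> \<open>Passing \<open>lam (al^j)\<close> through \<open>S\<close> rescales it by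
    \<open>q^j\<close>. Hence \<open>lam (al^j) e lam (ai^j)\<close> equals the average polynomial
    at \<open>q^j S\<close>, times \<open>p0\<close>, and these rescaled polynomials sum to
    1.\<close>
  have p0_span: "p0 \<in> lam_span e Hsp"
  proof -
    let ?M = "{s \<in> carrier B. s \<bullet> p0 \<in> lam_span e Hsp}"
    have "KB.ev S (\<Sum>j<l. pcompose P [:0, q ^ j:]) \<in> ?M"
    proof (rule KB.ev_sum_closed[OF S])
      fix j
      have "lam al \<bullet> S = \<kappa>B q \<bullet> (S \<bullet> lam al)"
      proof -
        have "lam al \<bullet> (lam w \<bullet> rho y) = \<kappa>B q \<bullet> (lam w \<bullet> rho y \<bullet> lam al)"
          if "W.wt q w" and [simp]: "y \<in> carrier A" for w y
        proof -
          note w [simp] = W.wt_closed[OF that(1)]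
          have "lam al \<bullet> (lam w \<bullet> rho y) = lam (al \<otimes> w) \<bullet> rho y"
            by (simp add: lam_mult B.m_assoc)
          also have "al \<otimes> w = \<kappa> q \<otimes> (w \<otimes> al)" using that(1) by (simp add: W.wt_def)
          finally show ?thesis by (simp add: lam_mult B.m_assoc rho_lam)
        qed
        then show ?thesis using wt by (simp add: S_def B.l_distr B.r_distr)
      qed
      then have *: "lam al \<bullet> KB.ev S p = KB.ev S (pcompose p [:0, q:]) \<bullet> lam al" for p
        by (intro KB.ev_intertwine) auto
      have aj: "lam (al [^] j) \<bullet> KB.ev S P = KB.ev S (pcompose P [:0, q ^ j:]) \<bullet> lam (al [^] j)"
      proof (induction j)
        case (Suc j)
        have "lam (al [^] Suc j) \<bullet> KB.ev S P = lam al \<bullet> (lam (al [^] j) \<bullet> KB.ev S P)"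
          unfolding A.nat_pow_Suc2[OF W.al_closed] by (simp add: lam_mult B.m_assoc)
        also have "\<dots> = (lam al \<bullet> KB.ev S (pcompose P [:0, q ^ j:])) \<bullet> lam (al [^] j)"
          by (simp add: Suc B.m_assoc)
        also have "\<dots> = KB.ev S (pcompose P [:0, q ^ Suc j:]) \<bullet> lam (al [^] Suc j)"
          unfolding A.nat_pow_Suc2[OF W.al_closed] *
          by (simp add: lam_mult B.m_assoc pcompose_scale mult.commute)
        finally show ?case .
      qed (simp add: pcompose_idR)
      have "lam (al [^] j) \<bullet> p0 = p0 \<bullet> lam (al [^] j)"
        using lam_ev_g[OF W.wt_pow[OF W.wt_al, of j]] by (simp add: p0_def pcompose_idR)
      then have "KB.ev S (pcompose P [:0, q ^ j:]) \<bullet> p0 \<bullet> lam (al [^] j)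
          = lam (al [^] j) \<bullet> e"
        using aj by (simp add: e_def B.m_assoc flip: B.m_assoc[of "lam (al [^] j)"])
      then have "KB.ev S (pcompose P [:0, q ^ j:]) \<bullet> p0 \<bullet> lam (al [^] j) \<bullet> lam (ai [^] j)
          = lam (al [^] j) \<bullet> e \<bullet> lam (ai [^] j)" by simp
      then have "KB.ev S (pcompose P [:0, q ^ j:]) \<bullet> p0
          = lam (al [^] j) \<bullet> e \<bullet> lam (ai [^] j)"
        by (simp add: B.m_assoc al_pow_ai_pow flip: lam_mult)
      moreover have "lam (al [^] j) \<bullet> e \<bullet> lam (ai [^] j) \<in> lam_span e Hsp"
        unfolding lam_span_def using pow_Hsp al_Hsp ai_Hsp
        by (intro B.add_span_incl lam_span_gens[OF e HA]) blast
      ultimately show "KB.ev S (pcompose P [:0, q ^ j:]) \<in> ?M" by simp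
    qed (auto simp: lam_span_zero B.l_distr intro!: lam_span_plus[OF e HA])
    then show ?thesis unfolding P_def sum_avg_poly[OF root char_l] by simp
  qed
  \<comment> \<open>The same argument for \<open>g\<close>, starting from \<open>p0\<close>:
    sandwiching between the \<open>lam w\<close> and \<open>lam y\<close> and adding the two terms
    rescales \<open>g\<close> by \<open>inverse q\<close>, since \<open>w1 y1 + w2 y2 = 1\<close>.
    The sum over all rescalings is the unit.\<close>
  have span: "\<one>\<^bsub>B\<^esub> \<in> lam_span e Hsp"
  proof -
    let ?iq = "inverse q"
    have "KB.ev g (\<Sum>c<l. pcompose P [:0, ?iq ^ c:]) \<in> lam_span e Hsp"
    proof (rule KB.ev_sum_closed[OF g_closed])
      fix c
      show "KB.ev g (pcompose P [:0, ?iq ^ c:]) \<in> lam_span e Hsp"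
      proof (induction c)
        case 0
        then show ?case using p0_span by (simp add: pcompose_idR p0_def P_def)
      next
        case (Suc c)
        let ?p = "pcompose P [:0, ?iq ^ c:]"
        have wy: "lam w \<bullet> KB.ev g ?p \<bullet> lam y = KB.ev g (pcompose P [:0, ?iq ^ Suc c:]) \<bullet> lam (w \<otimes> y)"
          if "W.wt q w" and [simp]: "y \<in> carrier A" for w y
          using lam_ev_g[OF that(1) W.q_nonzero, of ?p] W.wt_closed[OF that(1)]
          by (simp add: pcompose_scale mult.commute lam_mult B.m_assoc)
        have "lam w1 \<bullet> KB.ev g ?p \<bullet> lam y1 \<oplus>\<^bsub>B\<^esub> lam w2 \<bullet> KB.ev g ?p \<bullet> lam y2
            = KB.ev g (pcompose P [:0, ?iq ^ Suc c:]) \<bullet> lam (w1 \<otimes> y1 \<oplus> w2 \<otimes> y2)"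
          using wt by (simp add: wy lam_add B.r_distr)
        moreover have "lam w1 \<bullet> KB.ev g ?p \<bullet> lam y1 \<oplus>\<^bsub>B\<^esub> lam w2 \<bullet> KB.ev g ?p \<bullet> lam y2 \<in> lam_span e Hsp"
          using H subringE(6)[OF subring_Hsp] Suc
          by (intro lam_span_plus[OF e HA] lam_span_mult[OF e HA subset_refl]) auto
        ultimately show ?case by (simp add: one)
      qed
    qed (auto simp: lam_span_zero intro!: lam_span_plus[OF e HA])
    then show ?thesis
      unfolding P_def sum_avg_poly[OF primitive_root_of_unity_inverse[OF root] char_l] by simp
  qed
  have "azumaya_idem Hsp e"
    unfolding azumaya_idem_def using HA lr cen act_e act_1 span by auto
  then show ?thesis ..
qed

end

section \<open>Centralizers and central powers\<close>

lemma (in ring) subring_centralizer: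
  assumes "S \<subseteq> carrier R"
  shows "subring {h \<in> carrier R. \<forall>a\<in>S. a \<otimes> h = h \<otimes> a} R"
proof (rule subringI)
  fix g h assume "g \<in> {h \<in> carrier R. \<forall>a\<in>S. a \<otimes> h = h \<otimes> a}" "h \<in> {h \<in> carrier R. \<forall>a\<in>S. a \<otimes> h = h \<otimes> a}"
  then have gh: "g \<in> carrier R" "h \<in> carrier R" "\<And>a. a \<in> S \<Longrightarrow> a \<otimes> g = g \<otimes> a" "\<And>a. a \<in> S \<Longrightarrow> a \<otimes> h = h \<otimes> a"
    by auto
  have "a \<otimes> (g \<otimes> h) = (g \<otimes> h) \<otimes> a" if "a \<in> S" for a
  proof -
    have a: "a \<in> carrier R" using that assms by auto
    have "a \<otimes> (g \<otimes> h) = (g \<otimes> a) \<otimes> h" using a gh(1,2) gh(3)[OF that] by (simp flip: m_assoc)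
    also have "\<dots> = g \<otimes> (h \<otimes> a)" using a gh(1,2) gh(4)[OF that] by (simp add: m_assoc)
    finally show ?thesis using a gh(1,2) by (simp add: m_assoc)
  qed
  then show "g \<otimes> h \<in> {h \<in> carrier R. \<forall>a\<in>S. a \<otimes> h = h \<otimes> a}" using gh(1,2) by simp
qed (use assms in \<open>auto simp: l_minus r_minus l_distr r_distr subset_iff\<close>)

text \<open>In \<open>d x^l = (q al - 1) x^(l-1) = x^(l-1) (q^l al - 1)\<close> the last factor is
  \<open>al - 1 = x d\<close>; the other identity is symmetric.\<close>

lemma (in weyl_pair) pow_commute:
  assumes l: "q ^ l = 1" "l > 0"
  shows "d \<otimes> x [^] l = x [^] l \<otimes> d" "x \<otimes> d [^] l = d [^] l \<otimes> x"
proof -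
  obtain m where m: "l = Suc m" using l(2) by (cases l) auto
  have iq: "inverse q ^ m = q" using l(1) q_nonzero by (simp add: m power_inverse field_simps)
  have "d \<otimes> x [^] Suc m = ev al [:- 1, q:] \<otimes> x [^] m"
    unfolding dx_eq[symmetric] nat_pow_Suc2[OF x_closed] by (simp add: m_assoc)
  also have "\<dots> = x [^] m \<otimes> ev al [:- 1, 1:]"
    using wt_ev_swap'[OF wt_pow[OF wt_x, of m], of "[:- 1, q:]"] q_nonzero l(1)
    by (simp add: pcompose_pCons m mult.commute del: ev_pCons)
  finally show "d \<otimes> x [^] l = x [^] l \<otimes> d" by (simp add: m m_assoc flip: xd_eq del: ev_pCons)
  have "x \<otimes> d [^] Suc m = ev al [:- 1, 1:] \<otimes> d [^] m"
    unfolding xd_eq[symmetric] nat_pow_Suc2[OF d_closed] by (simp add: m_assoc)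
  also have "\<dots> = d [^] m \<otimes> ev al [:- 1, q:]"
    using wt_ev_swap'[OF wt_pow[OF wt_d, of m], of "[:- 1, 1:]"] q_nonzero
    by (simp add: pcompose_pCons iq del: ev_pCons)
  finally show "x \<otimes> d [^] l = d [^] l \<otimes> x" by (simp add: m m_assoc flip: dx_eq del: ev_pCons)
qed

text \<open>Taking \<open>T\<close> to be a centralizer reduces commutation with all of
  \<open>Hsp\<close> to commutation with \<open>Zc\<close>, \<open>x\<close> and
  \<open>d\<close>.\<close>

lemma (in enveloping_pair) Hsp_minimal:
  assumes T: "subring T A" "Zc \<subseteq> T" "x \<in> T" "d \<in> T"
  shows "Hsp \<subseteq> T"
proof
  note E = subringE[OF T(1)]
  have pow: "z [^] (m::nat) \<in> T" if "z \<in> T" for z m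
    using that E(3,6) by (induction m) auto
  have al: "al \<in> T" unfolding W.al_def using T E by auto
  fix h assume "h \<in> Hsp"
  then have "h \<in> add_span A Hgen" by (simp add: Hsp_def)
  with H_gens show "h \<in> T"
  proof (induction rule: A.add_span_induct)
    case (incl s)
    then obtain r z a j where s: "s = r \<otimes> (z [^] (a::nat) \<otimes> al [^] (j::nat))" "r \<in> Zc" "z \<in> {x, d}"
      unfolding Hgen_def by blast
    then show ?case using T by (auto intro!: E(6) pow al)
  qed (use E in auto)
qed

section \<open>Several pairs of generators\<close>

text \<open>Used twice: in \<open>Dq\<close> itself, to see that the \<open>l\<close>-th powers are
  central, and in the localized algebra.\<close>

locale weyl_system = scalar_ring A \<kappa> for A (structure) and \<kappa> :: "'k::field \<Rightarrow> 'a" +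
  fixes q :: 'k and n :: nat and gx gd :: "nat \<Rightarrow> 'a"
  assumes q_nz: "q \<noteq> 0"
    and X_closed [simp, intro]: "i < n \<Longrightarrow> gx i \<in> carrier A"
    and D_closed [simp, intro]: "i < n \<Longrightarrow> gd i \<in> carrier A"
    and XX: "\<lbrakk>i < n; j < n; i \<noteq> j\<rbrakk> \<Longrightarrow> gx i \<otimes> gx j = \<kappa> (qsgn q i j) \<otimes> (gx j \<otimes> gx i)"
    and DD: "\<lbrakk>i < n; j < n; i \<noteq> j\<rbrakk> \<Longrightarrow> gd i \<otimes> gd j = \<kappa> (qsgn q i j) \<otimes> (gd j \<otimes> gd i)"
    and DX: "\<lbrakk>i < n; j < n; i \<noteq> j\<rbrakk> \<Longrightarrow> gd i \<otimes> gx j = \<kappa> (inverse (qsgn q i j)) \<otimes> (gx j \<otimes> gd i)"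
    and DXi: "i < n \<Longrightarrow> gd i \<otimes> gx i = \<kappa> q \<otimes> (gx i \<otimes> gd i) \<oplus> \<kappa> (q - 1)"
begin

definition al :: "nat \<Rightarrow> 'a" where "al i = \<one> \<oplus> gx i \<otimes> gd i"

lemma al_closed [simp, intro]: "i < n \<Longrightarrow> al i \<in> carrier A"
  by (simp add: al_def)

lemma weyl_pair_XD: "i < n \<Longrightarrow> weyl_pair A \<kappa> q (gx i) (gd i)"
  using q_nz DXi by unfold_locales auto

lemma weyl_al: "i < n \<Longrightarrow> weyl_pair.al A (gx i) (gd i) = al i"
  unfolding weyl_pair.al_def[OF weyl_pair_XD] al_def ..

lemma al_X: "i < n \<Longrightarrow> al i \<otimes> gx i = \<kappa> q \<otimes> (gx i \<otimes> al i)"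
  using weyl_pair.al_x[OF weyl_pair_XD] by (simp add: weyl_al)

lemma al_D: "i < n \<Longrightarrow> al i \<otimes> gd i = \<kappa> (inverse q) \<otimes> (gd i \<otimes> al i)"
  using weyl_pair.al_d[OF weyl_pair_XD] by (simp add: weyl_al)

text \<open>Commutation factors multiply along products. Together with the rule for inverses this
  reduces the commutation of composite elements to bookkeeping of scalars.\<close>

lemma scaled_mult:
  assumes c: "a \<in> carrier A" "b \<in> carrier A" "y \<in> carrier A"
    and ay: "a \<otimes> y = \<kappa> v \<otimes> (y \<otimes> a)" and b: "b \<otimes> y = \<kappa> w \<otimes> (y \<otimes> b)"
  shows "(a \<otimes> b) \<otimes> y = \<kappa> (v * w) \<otimes> (y \<otimes> (a \<otimes> b))"
proof -
  have "(a \<otimes> b) \<otimes> y = \<kappa> w \<otimes> ((a \<otimes> y) \<otimes> b)"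
    using c b by (simp add: m_assoc kappa_left_comm[of a])
  also have "\<dots> = \<kappa> w \<otimes> (\<kappa> v \<otimes> (y \<otimes> (a \<otimes> b)))" using c by (simp add: ay m_assoc)
  finally show ?thesis using c by (simp add: kappa_kappa mult.commute)
qed

lemma scaled_inverse:
  assumes c: "a \<in> carrier A" "b \<in> carrier A" "y \<in> carrier A" and ab: "a \<otimes> b = \<one>" "b \<otimes> a = \<one>"
    and ay: "a \<otimes> y = \<kappa> v \<otimes> (y \<otimes> a)" and v: "v \<noteq> 0"
  shows "b \<otimes> y = \<kappa> (inverse v) \<otimes> (y \<otimes> b)"
proof -
  have "y \<otimes> b = b \<otimes> (a \<otimes> y) \<otimes> b" using c ab by (simp flip: m_assoc)
  also have "\<dots> = \<kappa> v \<otimes> (b \<otimes> y \<otimes> (a \<otimes> b))"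
    using c by (simp add: ay m_assoc kappa_left_comm[of b])
  finally show ?thesis using c v by (simp add: ab kappa_kappa)
qed

text \<open>Passing a generator of another pair, \<open>gx i\<close> and \<open>gd i\<close>
  contribute mutually inverse factors.\<close>

lemma al_X_other:
  assumes ij: "i < n" "j < n" "i \<noteq> j" shows "al i \<otimes> gx j = gx j \<otimes> al i" "al i \<otimes> gd j = gd j \<otimes> al i"
proof -
  have q: "qsgn q i j \<noteq> 0" and s: "inverse (qsgn q j i) = qsgn q i j"
    using q_nz ij by (auto simp: qsgn_def)
  have XDj: "gx i \<otimes> gd j = \<kappa> (inverse (qsgn q i j)) \<otimes> (gd j \<otimes> gx i)"
    using DX[of j i] ij q by (simp add: s kappa_kappa)
  have "(gx i \<otimes> gd i) \<otimes> gx j = gx j \<otimes> (gx i \<otimes> gd i)"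
    using scaled_mult[OF _ _ _ XX[OF ij] DX[OF ij]] ij q by simp
  moreover have "(gx i \<otimes> gd i) \<otimes> gd j = gd j \<otimes> (gx i \<otimes> gd i)"
    using scaled_mult[OF _ _ _ XDj DD[OF ij]] ij q by simp
  ultimately show "al i \<otimes> gx j = gx j \<otimes> al i" "al i \<otimes> gd j = gd j \<otimes> al i"
    using ij by (simp_all add: al_def l_distr r_distr)
qed

lemma al_al: assumes "i < n" "j < n" shows "al i \<otimes> al j = al j \<otimes> al i"
proof (cases "i = j")
  case False
  have "(gx j \<otimes> gd j) \<otimes> al i = al i \<otimes> (gx j \<otimes> gd j)"
    using scaled_mult[of "gx j" "gd j" "al i" 1 1] al_X_other[of i j] assms False by simp
  then show ?thesis using assms by (simp add: al_def[of j] l_distr r_distr)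
qed simp

lemma scaled_pow:
  fixes m :: nat
  assumes c: "a \<in> carrier A" "y \<in> carrier A" and ay: "a \<otimes> y = \<kappa> v \<otimes> (y \<otimes> a)"
  shows "a \<otimes> y [^] m = \<kappa> (v ^ m) \<otimes> (y [^] m \<otimes> a)"
proof (induction m)
  case (Suc m)
  have "a \<otimes> y [^] Suc m = (a \<otimes> y [^] m) \<otimes> y" using c by (simp add: m_assoc)
  also have "\<dots> = \<kappa> (v ^ m) \<otimes> (y [^] m \<otimes> (a \<otimes> y))" using c by (simp add: Suc m_assoc)
  also have "\<dots> = \<kappa> (v ^ m) \<otimes> (\<kappa> v \<otimes> (y [^] m \<otimes> (y \<otimes> a)))"
    using c by (simp add: ay kappa_left_comm[of "y [^] m"])
  finally show ?case using c by (simp add: kappa_kappa m_assoc mult.commute)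
qed (use c in simp)

text \<open>For different pairs the commutation factor is raised to the power \<open>l\<close> and
  becomes 1; within one pair this is \<open>pow_commute\<close>.\<close>

lemma pow_central:
  assumes l: "q ^ l = 1" "l > 0" and ij: "i < n" "j < n"
  shows "gx j \<otimes> gx i [^] l = gx i [^] l \<otimes> gx j" "gd j \<otimes> gx i [^] l = gx i [^] l \<otimes> gd j"
    "gx j \<otimes> gd i [^] l = gd i [^] l \<otimes> gx j" "gd j \<otimes> gd i [^] l = gd i [^] l \<otimes> gd j"
proof -
  have ql: "qsgn q a b ^ l = 1" for a b using l by (simp add: qsgn_def power_inverse)
  have pow1: "a \<otimes> a [^] l = a [^] l \<otimes> a" if "a \<in> carrier A" for a
    using that nat_pow_Suc2[OF that, of l] by simp
  have *: "gx j \<otimes> gx i [^] l = gx i [^] l \<otimes> gx j \<and> gd j \<otimes> gx i [^] l = gx i [^] l \<otimes> gd j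
    \<and> gx j \<otimes> gd i [^] l = gd i [^] l \<otimes> gx j \<and> gd j \<otimes> gd i [^] l = gd i [^] l \<otimes> gd j"
  proof (cases "i = j")
    case True
    then show ?thesis
      using weyl_pair.pow_commute[OF weyl_pair_XD[OF ij(1)] l] pow1 ij by simp
  next
    case False
    have s: "inverse (qsgn q i j) = qsgn q j i" "qsgn q i j \<noteq> 0" using False q_nz by (auto simp: qsgn_def)
    have XD: "gx j \<otimes> gd i = \<kappa> (qsgn q i j) \<otimes> (gd i \<otimes> gx j)"
      using DX[of i j] ij False s(2) by (simp add: kappa_kappa)
    show ?thesis
      using scaled_pow[of "gx j" "gx i" "qsgn q j i" l] scaled_pow[of "gd j" "gx i" "inverse (qsgn q j i)" l]
        scaled_pow[of "gx j" "gd i" "qsgn q i j" l] scaled_pow[of "gd j" "gd i" "qsgn q j i" l]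
        XX[of j i] DX[of j i] XD DD[of j i] ij False ql by (simp add: power_inverse)
  qed
  then show "gx j \<otimes> gx i [^] l = gx i [^] l \<otimes> gx j" "gd j \<otimes> gx i [^] l = gx i [^] l \<otimes> gd j"
    "gx j \<otimes> gd i [^] l = gd i [^] l \<otimes> gx j" "gd j \<otimes> gd i [^] l = gd i [^] l \<otimes> gd j" by simp_all
qed

end

locale enveloping_system = enveloping A B Zc \<kappa> lam rho act + weyl_system A \<kappa> q n gx gd
  for A :: "('a, 'x) ring_scheme" (structure) and B :: "('b, 'y) ring_scheme"
    and Zc :: "'a set" and \<kappa> :: "'k::field \<Rightarrow> 'a" and lam rho act
    and q :: 'k and n :: nat and gx gd :: "nat \<Rightarrow> 'a" +
  fixes l :: nat and AI :: "nat \<Rightarrow> 'a"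
  assumes root: "primitive_root_of_unity l q" and odd_l: "odd l" and l_gt_1: "l > 1"
    and char_l: "of_nat l \<noteq> (0::'k)"
    and AI_closed [simp, intro]: "i < n \<Longrightarrow> AI i \<in> carrier A"
    and AI: "i < n \<Longrightarrow> (\<one> \<oplus> gx i \<otimes> gd i) \<otimes> AI i = \<one>" "i < n \<Longrightarrow> AI i \<otimes> (\<one> \<oplus> gx i \<otimes> gd i) = \<one>"
    and X_pow: "i < n \<Longrightarrow> gx i [^] l \<in> Zc" and D_pow: "i < n \<Longrightarrow> gd i [^] l \<in> Zc"
    and AI_pow: "i < n \<Longrightarrow> AI i [^] l \<in> Zc"
    and generated: "\<lbrakk>subring T A; Zc \<subseteq> T; \<And>i. i < n \<Longrightarrow> gx i \<in> T \<and> gd i \<in> T\<rbrakk> \<Longrightarrow> carrier A \<subseteq> T"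
begin

lemma al_AI: "i < n \<Longrightarrow> al i \<otimes> AI i = \<one>" "i < n \<Longrightarrow> AI i \<otimes> al i = \<one>"
  using AI by (auto simp: al_def)

lemma AI_other:
  assumes ij: "i < n" "j < n" "i \<noteq> j" shows "AI i \<otimes> gx j = gx j \<otimes> AI i" "AI i \<otimes> gd j = gd j \<otimes> AI i"
  using scaled_inverse[of "al i" "AI i" "gx j" 1] scaled_inverse[of "al i" "AI i" "gd j" 1]
    al_X_other[OF ij] al_AI ij by simp_all

primrec bet :: "nat \<Rightarrow> 'a" where "bet 0 = \<one>" | "bet (Suc j) = bet j \<otimes> al j"
primrec binv :: "nat \<Rightarrow> 'a" where "binv 0 = \<one>" | "binv (Suc j) = binv j \<otimes> AI j"

lemma bet_closed [simp]: "j \<le> n \<Longrightarrow> bet j \<in> carrier A" and binv_closed [simp]: "j \<le> n \<Longrightarrow> binv j \<in> carrier A"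
  by (induction j) auto

text \<open>Only \<open>al\<close> and \<open>AI\<close> of indices below \<open>j\<close> occur,
  and these commute with the generators of all other pairs.\<close>

lemma bet_above:
  assumes "i < n" "j \<le> i" shows "bet j \<otimes> gx i = gx i \<otimes> bet j" "bet j \<otimes> gd i = gd i \<otimes> bet j"
    "binv j \<otimes> gx i = gx i \<otimes> binv j" "binv j \<otimes> gd i = gd i \<otimes> binv j"
  using assms(2)
proof (induction j)
  case (Suc j)
  {
    case 1 then show ?case using Suc(1) scaled_mult[of "bet j" "al j" "gx i" 1 1] al_X_other[of j i] assms by simp
  next
    case 2 then show ?case using Suc(2) scaled_mult[of "bet j" "al j" "gd i" 1 1] al_X_other[of j i] assms by simp
  next
    case 3 then show ?case using Suc(3) scaled_mult[of "binv j" "AI j" "gx i" 1 1] AI_other[of j i] assms by simp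
  next
    case 4 then show ?case using Suc(4) scaled_mult[of "binv j" "AI j" "gd i" 1 1] AI_other[of j i] assms by simp
  }
qed (use assms in auto)

lemma AI_self:
  assumes "i < n" shows "AI i \<otimes> gx i = \<kappa> (inverse q) \<otimes> (gx i \<otimes> AI i)" "AI i \<otimes> gd i = \<kappa> q \<otimes> (gd i \<otimes> AI i)"
  using scaled_inverse[of "al i" "AI i" "gx i" q] scaled_inverse[of "al i" "AI i" "gd i" "inverse q"]
    al_X al_D al_AI assms q_nz by simp_all

text \<open>Exactly one factor, that of index \<open>i\<close>, fails to commute with the pair
  \<open>i\<close>. The scalar enters in the inductive step \<open>j = i\<close> and is merely
  carried along afterwards.\<close>

lemma bet_below:
  assumes "i < j" "j \<le> n"
  shows "bet j \<otimes> gx i = \<kappa> q \<otimes> (gx i \<otimes> bet j)" "bet j \<otimes> gd i = \<kappa> (inverse q) \<otimes> (gd i \<otimes> bet j)"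
    "binv j \<otimes> gx i = \<kappa> (inverse q) \<otimes> (gx i \<otimes> binv j)" "binv j \<otimes> gd i = \<kappa> q \<otimes> (gd i \<otimes> binv j)"
  using assms
proof (induction j)
  case (Suc j)
  {
    case 1 then have *: "j \<noteq> i \<Longrightarrow> i < j" by auto
    from 1 show ?case
      using Suc(1)[OF *] scaled_mult[of "bet j" "al j" "gx i" q 1] scaled_mult[of "bet j" "al j" "gx i" 1 q]
        al_X_other[of j i] al_X[of i] bet_above[of i j] by (cases "j = i") simp_all
  next
    case 2 then have *: "j \<noteq> i \<Longrightarrow> i < j" by auto
    from 2 show ?case
      using Suc(2)[OF *] scaled_mult[of "bet j" "al j" "gd i" "inverse q" 1] scaled_mult[of "bet j" "al j" "gd i" 1 "inverse q"]
        al_X_other[of j i] al_D[of i] bet_above[of i j] by (cases "j = i") simp_all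
  next
    case 3 then have *: "j \<noteq> i \<Longrightarrow> i < j" by auto
    from 3 show ?case
      using Suc(3)[OF *] scaled_mult[of "binv j" "AI j" "gx i" "inverse q" 1] scaled_mult[of "binv j" "AI j" "gx i" 1 "inverse q"]
        AI_other[of j i] AI_self[of i] bet_above[of i j] by (cases "j = i") simp_all
  next
    case 4 then have *: "j \<noteq> i \<Longrightarrow> i < j" by auto
    from 4 show ?case
      using Suc(4)[OF *] scaled_mult[of "binv j" "AI j" "gd i" q 1] scaled_mult[of "binv j" "AI j" "gd i" 1 q]
        AI_other[of j i] AI_self[of i] bet_above[of i j] by (cases "j = i") simp_all
  }
qed auto

lemma AI_bet: assumes "i < n" "j \<le> i" shows "AI i \<otimes> bet j = bet j \<otimes> AI i" "al i \<otimes> binv j = binv j \<otimes> al i"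
proof -
  have comm: "al i \<otimes> y = y \<otimes> al i" if "y \<in> carrier A" "y \<otimes> gx i = gx i \<otimes> y" "y \<otimes> gd i = gd i \<otimes> y" for y
    using scaled_mult[of "gx i" "gd i" y 1 1] that assms by (simp add: al_def A.l_distr A.r_distr)
  show "al i \<otimes> binv j = binv j \<otimes> al i"
    using comm[of "binv j"] bet_above[OF assms] assms by simp
  have "al i \<otimes> bet j = bet j \<otimes> al i"
    using comm[of "bet j"] bet_above[OF assms] assms by simp
  then show "AI i \<otimes> bet j = bet j \<otimes> AI i"
    using scaled_inverse[of "al i" "AI i" "bet j" 1] al_AI assms by simp
qed

lemma bet_binv: assumes "j \<le> n" shows "bet j \<otimes> binv j = \<one>" "binv j \<otimes> bet j = \<one>"
  using assms
proof (induction j)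
  case (Suc j)
  {
    case 1
    have "bet (Suc j) \<otimes> binv (Suc j) = bet j \<otimes> (al j \<otimes> binv j) \<otimes> AI j" using 1 by (simp add: A.m_assoc)
    also have "\<dots> = (bet j \<otimes> binv j) \<otimes> (al j \<otimes> AI j)" using 1 by (simp add: AI_bet A.m_assoc)
    finally show ?case using Suc(1) 1 by (simp add: al_AI)
  next
    case 2
    have "binv (Suc j) \<otimes> bet (Suc j) = binv j \<otimes> (AI j \<otimes> bet j) \<otimes> al j" using 2 by (simp add: A.m_assoc)
    also have "\<dots> = (binv j \<otimes> bet j) \<otimes> (AI j \<otimes> al j)" using 2 by (simp add: AI_bet A.m_assoc)
    finally show ?case using Suc(2) 2 by (simp add: al_AI)
  }
qed auto

lemma pow_mult_commuting:
  fixes m :: nat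
  assumes c: "a \<in> carrier A" "b \<in> carrier A" and ab: "b \<otimes> a = a \<otimes> b"
  shows "(a \<otimes> b) [^] m = a [^] m \<otimes> b [^] m"
  using A.pow_mult_distrib[OF ab[symmetric] c] .

lemma al_pow_Zc: "i < n \<Longrightarrow> al i [^] l \<in> Zc"
  using weyl_pair.al_pow_root[OF weyl_pair_XD root odd_l, of i] subringE(3,6,7)[OF Zc_subring] X_pow D_pow
  by (simp add: weyl_al)

lemma bet_pow_Zc: "j \<le> n \<Longrightarrow> bet j [^] l \<in> Zc" "j \<le> n \<Longrightarrow> binv j [^] l \<in> Zc"
proof (induction j)
  case (Suc j)
  have "al j \<otimes> bet j = bet j \<otimes> al j" if "j < n"
  proof -
    have "(gx j \<otimes> gd j) \<otimes> bet j = bet j \<otimes> (gx j \<otimes> gd j)"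
      using scaled_mult[of "gx j" "gd j" "bet j" 1 1] bet_above[of j j] that by simp
    then show ?thesis using that by (simp add: al_def A.l_distr A.r_distr)
  qed
  moreover have "AI j \<otimes> binv j = binv j \<otimes> AI j" if "j < n"
    using scaled_inverse[of "al j" "AI j" "binv j" 1] AI_bet(2)[of j j] al_AI that by simp
  ultimately show "Suc j \<le> n \<Longrightarrow> bet (Suc j) [^] l \<in> Zc" "Suc j \<le> n \<Longrightarrow> binv (Suc j) [^] l \<in> Zc"
    using Suc al_pow_Zc[of j] AI_pow[of j] subringE(6)[OF Zc_subring]
    by (simp_all add: pow_mult_commuting)
qed (use subringE(3)[OF Zc_subring] in auto)

text \<open>For \<open>i < j\<close>, commuting \<open>gx j\<close> (or \<open>gd j\<close>) past \<open>gx i\<close> and \<open>gd i\<close> produces the same scalars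
  as commuting the inverse of \<open>al i\<close> (or \<open>al i\<close>). The factors \<open>bet j\<close> and \<open>binv j\<close> cancel these
  scalars, so that twisted generators of different pairs commute.\<close>

definition xt :: "nat \<Rightarrow> 'a" where "xt j = gx j \<otimes> bet j"
definition dt :: "nat \<Rightarrow> 'a" where "dt j = gd j \<otimes> binv j"

lemma xt_closed [simp]: "j < n \<Longrightarrow> xt j \<in> carrier A" and dt_closed [simp]: "j < n \<Longrightarrow> dt j \<in> carrier A"
  by (simp_all add: xt_def dt_def)

text \<open>The twisting factors commute with the generators of their own pair and cancel. So a
  twisted pair satisfies the same relation and has the same \<open>al\<close>, with the same inverse
  \<open>AI j\<close>.\<close>

lemma xt_dt: assumes "j < n" shows "xt j \<otimes> dt j = gx j \<otimes> gd j" "dt j \<otimes> xt j = gd j \<otimes> gx j"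
proof -
  have "xt j \<otimes> dt j = gx j \<otimes> (bet j \<otimes> gd j) \<otimes> binv j" using assms by (simp add: xt_def dt_def A.m_assoc)
  also have "\<dots> = (gx j \<otimes> gd j) \<otimes> (bet j \<otimes> binv j)" using assms by (simp add: bet_above A.m_assoc)
  finally show "xt j \<otimes> dt j = gx j \<otimes> gd j" using assms by (simp add: bet_binv)
  have "dt j \<otimes> xt j = gd j \<otimes> (binv j \<otimes> gx j) \<otimes> bet j" using assms by (simp add: xt_def dt_def A.m_assoc)
  also have "\<dots> = (gd j \<otimes> gx j) \<otimes> (binv j \<otimes> bet j)" using assms by (simp add: bet_above A.m_assoc)
  finally show "dt j \<otimes> xt j = gd j \<otimes> gx j" using assms by (simp add: bet_binv)
qed

lemma pair: assumes j: "j < n" shows "enveloping_pair A B Zc \<kappa> lam rho act q l (xt j) (dt j) (AI j)"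
proof unfold_locales
  show "xt j [^] l \<in> Zc"
    using pow_mult_commuting[of "gx j" "bet j" l] bet_above(1)[of j j] X_pow bet_pow_Zc(1)[of j]
      subringE(6)[OF Zc_subring] j by (simp add: xt_def)
  show "dt j [^] l \<in> Zc"
    using pow_mult_commuting[of "gd j" "binv j" l] bet_above(4)[of j j] D_pow bet_pow_Zc(2)[of j]
      subringE(6)[OF Zc_subring] j by (simp add: dt_def)
qed (use j root odd_l l_gt_1 char_l xt_dt[OF j] DXi AI AI_pow in auto)

text \<open>Stated against untwisted generators of smaller index: in the induction
  \<open>xt m\<close> and \<open>dt m\<close> split as these generators times \<open>bet m\<close>
  and \<open>binv m\<close>, which already lie in the subalgebra constructed before.\<close>

lemma twisted_commutes:
  assumes ij: "i < j" "j < n"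
  shows "xt j \<otimes> gx i = gx i \<otimes> xt j" "xt j \<otimes> gd i = gd i \<otimes> xt j"
    "dt j \<otimes> gx i = gx i \<otimes> dt j" "dt j \<otimes> gd i = gd i \<otimes> dt j"
proof -
  have q: "q \<noteq> 0" by (rule q_nz)
  have s: "qsgn q j i = inverse q" "qsgn q i j = q" using ij by (auto simp: qsgn_def)
  have XD: "gx j \<otimes> gd i = \<kappa> q \<otimes> (gd i \<otimes> gx j)"
    using DX[of i j] ij q by (simp add: s KA.kappa_kappa)
  note b = bet_below[of i j]
  show "xt j \<otimes> gx i = gx i \<otimes> xt j"
    using scaled_mult[of "gx j" "bet j" "gx i" "inverse q" q] XX[of j i] b(1) ij q by (simp add: xt_def s)
  show "xt j \<otimes> gd i = gd i \<otimes> xt j"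
    using scaled_mult[of "gx j" "bet j" "gd i" q "inverse q"] XD b(2) ij q by (simp add: xt_def)
  show "dt j \<otimes> gx i = gx i \<otimes> dt j"
    using scaled_mult[of "gd j" "binv j" "gx i" q "inverse q"] DX[of j i] b(3) ij q by (simp add: dt_def s)
  show "dt j \<otimes> gd i = gd i \<otimes> dt j"
    using scaled_mult[of "gd j" "binv j" "gd i" "inverse q" q] DD[of j i] b(4) ij q by (simp add: dt_def s)
qed

text \<open>The subalgebra \<open>H\<close> belongs to the pairs of index below \<open>m\<close>.
  The last conjunct, commutation with all later twisted generators, supplies the commutation needed
  to adjoin the next pair as a commuting factor.\<close>

lemma azumaya_idem_initial:
  assumes "m \<le> n"
  shows "\<exists>H e. subring H A \<and> Zc \<subseteq> H \<and> azumaya_idem H e \<and> (\<forall>i<m. gx i \<in> H \<and> gd i \<in> H \<and> AI i \<in> H)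
    \<and> (\<forall>h\<in>H. \<forall>j. m \<le> j \<and> j < n \<longrightarrow> xt j \<otimes> h = h \<otimes> xt j \<and> dt j \<otimes> h = h \<otimes> dt j)"
  using assms
proof (induction m)
  case 0
  have "xt j \<otimes> h = h \<otimes> xt j \<and> dt j \<otimes> h = h \<otimes> dt j" if "h \<in> Zc" "j < n" for h j
    using Zc_central[OF that(1)] that(2) by simp
  then show ?case using azumaya_idem_trivial Zc_subring by auto
next
  case (Suc m)
  then have m: "m < n" by simp
  from Suc obtain H e where H: "subring H A" "Zc \<subseteq> H" "azumaya_idem H e"
    and XH: "\<And>i. i < m \<Longrightarrow> gx i \<in> H \<and> gd i \<in> H \<and> AI i \<in> H"
    and comm: "\<And>h j. \<lbrakk>h \<in> H; m \<le> j; j < n\<rbrakk> \<Longrightarrow> xt j \<otimes> h = h \<otimes> xt j \<and> dt j \<otimes> h = h \<otimes> dt j"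
    by auto
  interpret P: enveloping_pair A B Zc \<kappa> lam rho act q l "xt m" "dt m" "AI m"
    by (rule pair[OF m])
  obtain e' where e': "azumaya_idem P.Hsp e'" using P.azumaya_idem_pair ..
  have Hc: "H \<subseteq> carrier A" using subringE(1)[OF H(1)] .
  have HP: "b \<otimes> a = a \<otimes> b" if "a \<in> H" "b \<in> P.Hsp" for a b
  proof -
    have "P.Hsp \<subseteq> {b \<in> carrier A. \<forall>a\<in>H. a \<otimes> b = b \<otimes> a}"
    proof (rule P.Hsp_minimal[OF A.subring_centralizer[OF Hc]])
      show "Zc \<subseteq> {b \<in> carrier A. \<forall>a\<in>H. a \<otimes> b = b \<otimes> a}"
      proof (intro subsetI CollectI conjI ballI)
        fix z a assume "z \<in> Zc" "a \<in> H"
        then show "a \<otimes> z = z \<otimes> a" using Hc by (intro Zc_central[symmetric]) auto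
      qed auto
      show "xt m \<in> {b \<in> carrier A. \<forall>a\<in>H. a \<otimes> b = b \<otimes> a}" "dt m \<in> {b \<in> carrier A. \<forall>a\<in>H. a \<otimes> b = b \<otimes> a}"
        using comm[of _ m, THEN conjunct1, symmetric] comm[of _ m, THEN conjunct2, symmetric] m
        by simp_all
    qed
    then show ?thesis using that by auto
  qed
  define H' where "H' = add_span A {a \<otimes> b | a b. a \<in> H \<and> b \<in> P.Hsp}"
  note H' = subring_products[OF H(1) P.subring_Hsp HP, folded H'_def]
  note az = azumaya_idem_products[OF H(1) P.subring_Hsp HP H(3) e', folded H'_def]
  note E = subringE[OF H'(1)]
  have bet_H: "bet j \<in> H" "binv j \<in> H" if "j \<le> m" for j
  proof -
    have "al i \<in> H" if "i < m" for i using XH[OF that] subringE(3,6,7)[OF H(1)] by (simp add: al_def)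
    then show "bet j \<in> H" "binv j \<in> H"
      using that XH subringE(3,6)[OF H(1)] by (induction j) auto
  qed
  \<comment> \<open>Untwisting happens inside the enlarged subalgebra, since \<open>bet m\<close>
    and \<open>binv m\<close> already lie in \<open>H\<close>; this recovers the original
    generators.\<close>
  have "gx m = xt m \<otimes> binv m" "gd m = dt m \<otimes> bet m"
    using m by (simp_all add: xt_def dt_def A.m_assoc bet_binv)
  then have "gx m \<in> H'" "gd m \<in> H'"
    using subsetD[OF H'(2)] subsetD[OF H'(3)] P.x_Hsp P.d_Hsp bet_H[OF order_refl] E(6) by simp_all
  moreover have "AI m \<in> H'" using P.ai_Hsp H'(3) by auto
  ultimately have XH': "\<forall>i<Suc m. gx i \<in> H' \<and> gd i \<in> H' \<and> AI i \<in> H'"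
    using XH H'(2) by (auto simp: less_Suc_eq)
  have "xt j \<otimes> h = h \<otimes> xt j \<and> dt j \<otimes> h = h \<otimes> dt j" if h: "h \<in> H'" and j: "Suc m \<le> j" "j < n" for h j
  proof -
    \<comment> \<open>The centralizer of the later twisted pair contains \<open>H\<close> by
      induction, and \<open>gx m\<close>, \<open>gd m\<close> by \<open>twisted_commutes\<close>.
      Hence it contains \<open>xt m\<close> and \<open>dt m\<close>, then \<open>P.Hsp\<close>, and
      finally all sums of products.\<close>
    let ?C = "{h \<in> carrier A. \<forall>a\<in>{xt j, dt j}. a \<otimes> h = h \<otimes> a}"
    have C: "subring ?C A" using j by (intro A.subring_centralizer) auto
    note EC = subringE[OF C]
    have HC: "H \<subseteq> ?C" using comm[of _ j] j Hc by auto
    have XC: "gx i \<in> ?C" "gd i \<in> ?C" if "i \<le> m" for i using twisted_commutes[of i j] that j by auto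
    have "gx m \<otimes> bet m \<in> ?C" by (rule EC(6)[OF XC(1) subsetD[OF HC bet_H(1)]]) simp_all
    moreover have "gd m \<otimes> binv m \<in> ?C" by (rule EC(6)[OF XC(2) subsetD[OF HC bet_H(2)]]) simp_all
    ultimately have "xt m \<in> ?C" "dt m \<in> ?C" by (simp_all only: xt_def dt_def)
    then have PC: "P.Hsp \<subseteq> ?C" using HC H(2) by (intro P.Hsp_minimal[OF C]) auto
    have "h \<in> ?C"
    proof -
      have "{a \<otimes> b | a b. a \<in> H \<and> b \<in> P.Hsp} \<subseteq> ?C" using HC PC EC(6) by blast
      then show ?thesis
        using EC(1) EC(2,7) h unfolding H'_def
        by (intro A.add_span_induct[of "{a \<otimes> b | a b. a \<in> H \<and> b \<in> P.Hsp}" h "\<lambda>h. h \<in> ?C"]) blast+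
    qed
    then show ?thesis by auto
  qed
  then show ?case using H'(1,2) H(2) az XH' by (intro exI[of _ H'] exI[of _ "e' \<bullet> e"]) auto
qed

theorem azumaya_idem_carrier: "\<exists>e. azumaya_idem (carrier A) e"
proof -
  obtain H e where H: "subring H A" "Zc \<subseteq> H" "azumaya_idem H e" "\<forall>i<n. gx i \<in> H \<and> gd i \<in> H \<and> AI i \<in> H"
    using azumaya_idem_initial[of n] by auto
  then have "H = carrier A" using generated[of H] subringE(1)[OF H(1)] by auto
  then show ?thesis using H(3) by auto
qed

end

section \<open>Localization at central multiplicative sets\<close>

text \<open>The ring need not be commutative: the locale covers the localization of the
  \<open>l\<close>-centre as well as that of \<open>Dq\<close>, which serves as a target for maps
  out of the tensor product.\<close>

locale central_localization = ring R for R (structure) and S +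
  assumes S_subset: "S \<subseteq> carrier R" and S_one: "\<one> \<in> S"
    and S_mult: "\<lbrakk>s \<in> S; t \<in> S\<rbrakk> \<Longrightarrow> s \<otimes> t \<in> S"
    and S_central: "\<lbrakk>s \<in> S; a \<in> carrier R\<rbrakk> \<Longrightarrow> a \<otimes> s = s \<otimes> a"
begin

abbreviation "L \<equiv> localization R S"
abbreviation "fr \<equiv> loc_frac R S"

lemma S_closed [simp]: "s \<in> S \<Longrightarrow> s \<in> carrier R"
  using S_subset by auto

lemma S_lcomm: "\<lbrakk>s \<in> S; a \<in> carrier R; b \<in> carrier R\<rbrakk> \<Longrightarrow> a \<otimes> (s \<otimes> b) = s \<otimes> (a \<otimes> b)"
  by (metis S_central S_closed m_assoc)

lemma frac_mem:
  "(b, t) \<in> fr a s \<longleftrightarrow> b \<in> carrier R \<and> t \<in> S \<and> (\<exists>u\<in>S. u \<otimes> (t \<otimes> a) = u \<otimes> (s \<otimes> b))"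
  by (auto simp: loc_frac_def)

lemma frac_eqI:
  assumes "a \<in> carrier R" "b \<in> carrier R" "s \<in> S" "t \<in> S"
    and u: "u \<in> S" "u \<otimes> (t \<otimes> a) = u \<otimes> (s \<otimes> b)"
  shows "fr a s = fr b t"
proof -
  have *: "fr a s \<subseteq> fr b t"
    if ab: "a \<in> carrier R" "b \<in> carrier R" "s \<in> S" "t \<in> S" and u: "u \<in> S" "u \<otimes> (t \<otimes> a) = u \<otimes> (s \<otimes> b)"
    for a b s t u
  proof (rule subrelI)
    fix c r assume "(c, r) \<in> fr a s"
    then obtain v where c: "c \<in> carrier R" "r \<in> S" "v \<in> S" and eq: "v \<otimes> (r \<otimes> a) = v \<otimes> (s \<otimes> c)"
      by (auto simp: frac_mem)
    note cl = ab c u(1)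
    \<comment> \<open>Transitivity of equality of fractions: \<open>u\<close> and \<open>v\<close>
      witness the two given equalities, and the extra factor \<open>s\<close> is the middle
      denominator, which has to be cancelled.\<close>
    have "(u \<otimes> (v \<otimes> s)) \<otimes> (r \<otimes> b) = v \<otimes> (r \<otimes> (u \<otimes> (s \<otimes> b)))"
      using cl by (simp add: m_assoc S_mult S_lcomm)
    also have "\<dots> = u \<otimes> (t \<otimes> (v \<otimes> (r \<otimes> a)))"
      using cl by (simp add: m_assoc S_mult S_lcomm flip: u(2))
    also have "\<dots> = (u \<otimes> (v \<otimes> s)) \<otimes> (t \<otimes> c)"
      unfolding eq using cl by (simp add: m_assoc S_mult S_lcomm)
    finally show "(c, r) \<in> fr b t"
      unfolding frac_mem using cl S_mult by blast
  qed
  show ?thesis using *[OF assms] *[OF assms(2,1,4,3) u(1) u(2)[symmetric]] by blast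
qed

lemma frac_self: "\<lbrakk>a \<in> carrier R; s \<in> S\<rbrakk> \<Longrightarrow> (a, s) \<in> fr a s"
  unfolding frac_mem using S_one by blast

lemma frac_eqD:
  assumes "fr a s = fr b t" "b \<in> carrier R" "t \<in> S"
  shows "\<exists>u\<in>S. u \<otimes> (t \<otimes> a) = u \<otimes> (s \<otimes> b)"
  using assms frac_self frac_mem by metis

lemma frac_cancel: "\<lbrakk>a \<in> carrier R; s \<in> S; t \<in> S\<rbrakk> \<Longrightarrow> fr (t \<otimes> a) (t \<otimes> s) = fr a s"
  by (rule frac_eqI[where u = \<one>]) (simp_all add: S_one S_mult S_lcomm m_assoc)

lemma carrier_L: "carrier L = {fr a s | a s. a \<in> carrier R \<and> s \<in> S}"
  by (simp add: localization_def)

lemma frac_closed [simp, intro]: "\<lbrakk>a \<in> carrier R; s \<in> S\<rbrakk> \<Longrightarrow> fr a s \<in> carrier L"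
  by (auto simp: carrier_L)

lemma one_L: "\<one>\<^bsub>L\<^esub> = fr \<one> \<one>" and zero_L: "\<zero>\<^bsub>L\<^esub> = fr \<zero> \<one>"
  by (simp_all add: localization_def)

text \<open>Products of classes are unions over all representatives, so well-definedness amounts to
  all members of the union being the same class. Sums are treated in the same way.\<close>

lemma frac_mult:
  assumes c: "a \<in> carrier R" "b \<in> carrier R" "s \<in> S" "t \<in> S"
  shows "fr a s \<otimes>\<^bsub>L\<^esub> fr b t = fr (a \<otimes> b) (s \<otimes> t)"
proof -
  have "fr (a' \<otimes> b') (s' \<otimes> t') = fr (a \<otimes> b) (s \<otimes> t)"
    if "(a', s') \<in> fr a s" "(b', t') \<in> fr b t" for a' s' b' t'
  proof -
    from that obtain u v where c': "a' \<in> carrier R" "s' \<in> S" "u \<in> S" "b' \<in> carrier R" "t' \<in> S" "v \<in> S"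
      and eq: "u \<otimes> (s' \<otimes> a) = u \<otimes> (s \<otimes> a')" "v \<otimes> (t' \<otimes> b) = v \<otimes> (t \<otimes> b')"
      by (auto simp: frac_mem)
    have mv: "(u \<otimes> v) \<otimes> ((s \<otimes> t) \<otimes> (a \<otimes> b)) = (u \<otimes> (s \<otimes> a)) \<otimes> (v \<otimes> (t \<otimes> b))"
      if "a \<in> carrier R" "b \<in> carrier R" "s \<in> S" "t \<in> S" for a b s t
    proof -
      have "(u \<otimes> (s \<otimes> a)) \<otimes> (v \<otimes> (t \<otimes> b)) = u \<otimes> (s \<otimes> (a \<otimes> (v \<otimes> (t \<otimes> b))))"
        using that c' by (simp add: m_assoc)
      also have "a \<otimes> (v \<otimes> (t \<otimes> b)) = v \<otimes> (t \<otimes> (a \<otimes> b))"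
        using that c' by (simp add: S_lcomm[of v a] S_lcomm[of t a])
      also have "u \<otimes> (s \<otimes> (v \<otimes> (t \<otimes> (a \<otimes> b)))) = u \<otimes> (v \<otimes> (s \<otimes> (t \<otimes> (a \<otimes> b))))"
        using that c' by (simp add: S_lcomm[of v s])
      finally show ?thesis using that c' by (simp add: m_assoc)
    qed
    show ?thesis
      by (rule frac_eqI[where u = "u \<otimes> v"])
        (use c c' mv[of a b s' t'] mv[of a' b' s t] eq S_mult in simp_all)
  qed
  then have "(\<Union>(a', s')\<in>fr a s. \<Union>(b', t')\<in>fr b t. fr (a' \<otimes> b') (s' \<otimes> t')) = fr (a \<otimes> b) (s \<otimes> t)"
    by (intro UN_constant_eq[OF frac_self[OF c(1,3)]])
      (auto intro!: UN_constant_eq[OF frac_self[OF c(2,4)]])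
  then show ?thesis by (simp add: localization_def)
qed

lemma frac_add:
  assumes c: "a \<in> carrier R" "b \<in> carrier R" "s \<in> S" "t \<in> S"
  shows "fr a s \<oplus>\<^bsub>L\<^esub> fr b t = fr (t \<otimes> a \<oplus> s \<otimes> b) (s \<otimes> t)"
proof -
  have "fr (t' \<otimes> a' \<oplus> s' \<otimes> b') (s' \<otimes> t') = fr (t \<otimes> a \<oplus> s \<otimes> b) (s \<otimes> t)"
    if "(a', s') \<in> fr a s" "(b', t') \<in> fr b t" for a' s' b' t'
  proof -
    from that obtain u v where c': "a' \<in> carrier R" "s' \<in> S" "u \<in> S" "b' \<in> carrier R" "t' \<in> S" "v \<in> S"
      and eq: "u \<otimes> (s' \<otimes> a) = u \<otimes> (s \<otimes> a')" "v \<otimes> (t' \<otimes> b) = v \<otimes> (t \<otimes> b')"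
      by (auto simp: frac_mem)
    have mv: "(u \<otimes> v) \<otimes> ((s' \<otimes> t') \<otimes> (t \<otimes> a \<oplus> s \<otimes> b))
        = v \<otimes> (t' \<otimes> (t \<otimes> (u \<otimes> (s' \<otimes> a)))) \<oplus> u \<otimes> (s' \<otimes> (s \<otimes> (v \<otimes> (t' \<otimes> b))))"
      if "a \<in> carrier R" "b \<in> carrier R" "s \<in> S" "t \<in> S" "s' \<in> S" "t' \<in> S" for a b s t s' t'
      using that c'(3,6) by (simp add: m_assoc r_distr S_lcomm S_mult)
    have "(u \<otimes> v) \<otimes> ((s \<otimes> t) \<otimes> (t' \<otimes> a' \<oplus> s' \<otimes> b'))
        = v \<otimes> (t \<otimes> (t' \<otimes> (u \<otimes> (s' \<otimes> a)))) \<oplus> u \<otimes> (s \<otimes> (s' \<otimes> (v \<otimes> (t' \<otimes> b))))"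
      using mv[of a' b' s' t' s t] c c' by (simp add: eq)
    also have "\<dots> = (u \<otimes> v) \<otimes> ((s' \<otimes> t') \<otimes> (t \<otimes> a \<oplus> s \<otimes> b))"
      using mv[of a b s t s' t'] c c' S_lcomm[of t t'] S_lcomm[of s s'] by simp
    finally show ?thesis
      by (intro frac_eqI[where u = "u \<otimes> v"]) (use c c' S_mult in simp_all)
  qed
  then have "(\<Union>(a', s')\<in>fr a s. \<Union>(b', t')\<in>fr b t. fr (t' \<otimes> a' \<oplus> s' \<otimes> b') (s' \<otimes> t'))
      = fr (t \<otimes> a \<oplus> s \<otimes> b) (s \<otimes> t)"
    by (intro UN_constant_eq[OF frac_self[OF c(1,3)]])
      (auto intro!: UN_constant_eq[OF frac_self[OF c(2,4)]])
  then show ?thesis by (simp add: localization_def)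
qed

lemma frac_add_same:
  assumes "a \<in> carrier R" "b \<in> carrier R" "s \<in> S"
  shows "fr a s \<oplus>\<^bsub>L\<^esub> fr b s = fr (a \<oplus> b) s"
  using frac_add[of a b s s] frac_cancel[of "a \<oplus> b" s s] assms by (simp add: r_distr)

text \<open>A common denominator turns the ring axioms of the localization into those of the
  numerators.\<close>

lemma carrier_L_common2:
  assumes "x \<in> carrier L" "y \<in> carrier L"
  obtains a b s where "x = fr a s" "y = fr b s" "a \<in> carrier R" "b \<in> carrier R" "s \<in> S"
proof -
  from assms obtain a s b t where c: "x = fr a s" "y = fr b t" "a \<in> carrier R" "s \<in> S" "b \<in> carrier R" "t \<in> S"
    unfolding carrier_L by blast
  have "x = fr (t \<otimes> a) (t \<otimes> s)" "y = fr (s \<otimes> b) (t \<otimes> s)"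
    using c frac_cancel[of a s t] frac_cancel[of b t s] S_central[of t s] by simp_all
  then show ?thesis using that c S_mult by (metis S_closed m_closed)
qed

lemma carrier_L_common3:
  assumes "x \<in> carrier L" "y \<in> carrier L" "z \<in> carrier L"
  obtains a b c s where "x = fr a s" "y = fr b s" "z = fr c s"
    "a \<in> carrier R" "b \<in> carrier R" "c \<in> carrier R" "s \<in> S"
proof -
  obtain a b s where ab: "x = fr a s" "y = fr b s" "a \<in> carrier R" "b \<in> carrier R" "s \<in> S"
    using carrier_L_common2 assms(1,2) by blast
  from assms obtain c t where c: "z = fr c t" "c \<in> carrier R" "t \<in> S" unfolding carrier_L by blast
  have "x = fr (t \<otimes> a) (t \<otimes> s)" "y = fr (t \<otimes> b) (t \<otimes> s)" "z = fr (s \<otimes> c) (t \<otimes> s)"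
    using ab c frac_cancel[of a s t] frac_cancel[of b s t] frac_cancel[of c t s] S_central[of t s] by simp_all
  then show ?thesis using that ab c S_mult by (metis S_closed m_closed)
qed

lemma ring_localization: "ring L"
proof (rule ringI)
  show "abelian_group L"
  proof (rule abelian_groupI)
    fix x y assume "x \<in> carrier L" "y \<in> carrier L"
    then obtain a b s where *: "x = fr a s" "y = fr b s" "a \<in> carrier R" "b \<in> carrier R" "s \<in> S"
      by (rule carrier_L_common2)
    then show "x \<oplus>\<^bsub>L\<^esub> y \<in> carrier L" "x \<oplus>\<^bsub>L\<^esub> y = y \<oplus>\<^bsub>L\<^esub> x"
      by (simp_all add: frac_add_same a_comm)
  next
    fix x y z assume "x \<in> carrier L" "y \<in> carrier L" "z \<in> carrier L"
    then obtain a b c s where *: "x = fr a s" "y = fr b s" "z = fr c s"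
      "a \<in> carrier R" "b \<in> carrier R" "c \<in> carrier R" "s \<in> S" by (rule carrier_L_common3)
    then show "x \<oplus>\<^bsub>L\<^esub> y \<oplus>\<^bsub>L\<^esub> z = x \<oplus>\<^bsub>L\<^esub> (y \<oplus>\<^bsub>L\<^esub> z)" by (simp add: frac_add_same a_assoc)
  next
    fix x assume "x \<in> carrier L"
    then obtain a s where *: "x = fr a s" "a \<in> carrier R" "s \<in> S" unfolding carrier_L by blast
    show "\<zero>\<^bsub>L\<^esub> \<oplus>\<^bsub>L\<^esub> x = x" using * by (simp add: zero_L frac_add S_one)
    have "fr \<zero> s = \<zero>\<^bsub>L\<^esub>"
      unfolding zero_L by (rule frac_eqI[where u = \<one>]) (use * S_one in simp_all)
    then have "fr (\<ominus> a) s \<oplus>\<^bsub>L\<^esub> x = \<zero>\<^bsub>L\<^esub>" using * by (simp add: frac_add_same l_neg)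
    then show "\<exists>y\<in>carrier L. y \<oplus>\<^bsub>L\<^esub> x = \<zero>\<^bsub>L\<^esub>" using * by blast
  qed (simp add: zero_L S_one)
  show "monoid L"
  proof (rule monoidI)
    fix x y assume "x \<in> carrier L" "y \<in> carrier L"
    then obtain a b s where *: "x = fr a s" "y = fr b s" "a \<in> carrier R" "b \<in> carrier R" "s \<in> S"
      by (rule carrier_L_common2)
    then show "x \<otimes>\<^bsub>L\<^esub> y \<in> carrier L" by (simp add: frac_mult S_mult)
  next
    fix x y z assume "x \<in> carrier L" "y \<in> carrier L" "z \<in> carrier L"
    then obtain a b c s where *: "x = fr a s" "y = fr b s" "z = fr c s"
      "a \<in> carrier R" "b \<in> carrier R" "c \<in> carrier R" "s \<in> S" by (rule carrier_L_common3)
    then show "x \<otimes>\<^bsub>L\<^esub> y \<otimes>\<^bsub>L\<^esub> z = x \<otimes>\<^bsub>L\<^esub> (y \<otimes>\<^bsub>L\<^esub> z)" by (simp add: frac_mult m_assoc S_mult)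
  next
    fix x assume "x \<in> carrier L"
    then obtain a s where *: "x = fr a s" "a \<in> carrier R" "s \<in> S" unfolding carrier_L by blast
    then show "\<one>\<^bsub>L\<^esub> \<otimes>\<^bsub>L\<^esub> x = x" "x \<otimes>\<^bsub>L\<^esub> \<one>\<^bsub>L\<^esub> = x" by (simp_all add: one_L frac_mult S_one)
  qed (simp add: one_L S_one)
  fix x y z assume "x \<in> carrier L" "y \<in> carrier L" "z \<in> carrier L"
  then obtain a b c s where *: "x = fr a s" "y = fr b s" "z = fr c s"
    "a \<in> carrier R" "b \<in> carrier R" "c \<in> carrier R" "s \<in> S" by (rule carrier_L_common3)
  then show "(x \<oplus>\<^bsub>L\<^esub> y) \<otimes>\<^bsub>L\<^esub> z = x \<otimes>\<^bsub>L\<^esub> z \<oplus>\<^bsub>L\<^esub> y \<otimes>\<^bsub>L\<^esub> z"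
    "z \<otimes>\<^bsub>L\<^esub> (x \<oplus>\<^bsub>L\<^esub> y) = z \<otimes>\<^bsub>L\<^esub> x \<oplus>\<^bsub>L\<^esub> z \<otimes>\<^bsub>L\<^esub> y"
    by (simp_all add: frac_mult frac_add_same l_distr r_distr S_mult)
qed

lemma cring_localization:
  assumes "cring R" shows "cring L"
proof (rule cring.intro[OF ring_localization])
  interpret R: cring R by fact
  show "comm_monoid L"
  proof (rule monoid.monoid_comm_monoidI)
    show "monoid L" using ring_localization by (simp add: ring.is_monoid)
    fix x y assume "x \<in> carrier L" "y \<in> carrier L"
    then obtain a b s where *: "x = fr a s" "y = fr b s" "a \<in> carrier R" "b \<in> carrier R" "s \<in> S"
      by (rule carrier_L_common2)
    then show "x \<otimes>\<^bsub>L\<^esub> y = y \<otimes>\<^bsub>L\<^esub> x" by (simp add: frac_mult R.m_comm)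
  qed
qed

lemma loc_map_hom: "loc_map R S \<in> ring_hom R L"
  by (rule ring_hom_memI)
    (simp_all add: loc_map_def frac_mult frac_add_same one_L S_one)

end

section \<open>Tensor products of algebras\<close>

text \<open>For records of different extension types, where only the ring fields can be
  compared.\<close>

lemma ring_transfer:
  assumes "ring Q" "carrier T = carrier Q" "monoid.mult T = monoid.mult Q" "one T = one Q"
    "ring.zero T = ring.zero Q" "add T = add Q"
  shows "ring T"
proof -
  interpret Q: ring Q by fact
  show ?thesis
  proof (rule ringI)
    show "abelian_group T"
      by (rule abelian_groupI) (use Q.add.l_inv_ex in \<open>auto simp: assms(2-6) Q.a_assoc intro: Q.a_comm\<close>)
    show "monoid T"
      by (rule monoidI) (auto simp: assms(2-6) Q.m_assoc)
  qed (auto simp: assms(2-6) Q.l_distr Q.r_distr)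
qed

context abelian_group
begin

text \<open>In the shape in which \<^const>\<open>natural_map\<close> writes the extension to formal sums.\<close>

definition lext :: "('p \<Rightarrow> 'a) \<Rightarrow> ('p \<Rightarrow>\<^sub>0 int) \<Rightarrow> 'a" where
  "lext \<beta> u = (\<Oplus>p\<in>Poly_Mapping.keys u. add_pow G (Poly_Mapping.lookup u p) (\<beta> p))"

lemma lext_closed [simp]:
  assumes "\<And>p. p \<in> P \<Longrightarrow> \<beta> p \<in> carrier G" "Poly_Mapping.keys u \<subseteq> P" shows "lext \<beta> u \<in> carrier G"
  unfolding lext_def using assms by (intro finsum_closed) (auto intro: add.int_pow_closed)

lemma lext_superset:
  assumes \<beta>: "\<And>p. p \<in> P \<Longrightarrow> \<beta> p \<in> carrier G" and K: "finite K" "Poly_Mapping.keys u \<subseteq> K" "K \<subseteq> P"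
  shows "lext \<beta> u = (\<Oplus>p\<in>K. add_pow G (Poly_Mapping.lookup u p) (\<beta> p))"
  unfolding lext_def
proof (rule add.finprod_mono_neutral_cong_left[OF K(1,2)])
  fix p assume "p \<in> K - Poly_Mapping.keys u"
  then have "Poly_Mapping.lookup u p = 0" by (simp add: in_keys_iff)
  then show "add_pow G (Poly_Mapping.lookup u p) (\<beta> p) = \<zero>" by (simp add: add_pow_def)
qed (use assms in \<open>auto intro: add.int_pow_closed\<close>)

lemma lext_add:
  assumes \<beta>: "\<And>p. p \<in> P \<Longrightarrow> \<beta> p \<in> carrier G"
    and u: "Poly_Mapping.keys u \<subseteq> P" and v: "Poly_Mapping.keys v \<subseteq> P"
  shows "lext \<beta> (u + v) = lext \<beta> u \<oplus> lext \<beta> v"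
proof -
  let ?K = "Poly_Mapping.keys u \<union> Poly_Mapping.keys v"
  have K: "finite ?K" "?K \<subseteq> P" "Poly_Mapping.keys (u + v) \<subseteq> ?K" using u v by (auto dest: subsetD[OF keys_add])
  have c: "add_pow G i (\<beta> p) \<in> carrier G" if "p \<in> ?K" for i :: int and p
    using that K(2) \<beta> by (auto intro: add.int_pow_closed)
  have "lext \<beta> (u + v) = (\<Oplus>p\<in>?K. add_pow G (Poly_Mapping.lookup u p + Poly_Mapping.lookup v p) (\<beta> p))"
    using lext_superset[of P \<beta>, OF \<beta> K(1,3,2)] by (simp only: lookup_add)
  also have "\<dots> = (\<Oplus>p\<in>?K. add_pow G (Poly_Mapping.lookup u p) (\<beta> p) \<oplus> add_pow G (Poly_Mapping.lookup v p) (\<beta> p))"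
    by (intro add.finprod_cong') (use c K(2) \<beta> in \<open>auto intro!: add.int_pow_mult\<close>)
  also have "\<dots> = (\<Oplus>p\<in>?K. add_pow G (Poly_Mapping.lookup u p) (\<beta> p)) \<oplus> (\<Oplus>p\<in>?K. add_pow G (Poly_Mapping.lookup v p) (\<beta> p))"
    by (rule add.finprod_multf) (use c in auto)
  also have "\<dots> = lext \<beta> u \<oplus> lext \<beta> v"
    using lext_superset[OF \<beta> K(1) _ K(2), where u = u] lext_superset[OF \<beta> K(1) _ K(2), where u = v] by simp
  finally show ?thesis .
qed

lemma lext_frag_of [simp]: "\<beta> p \<in> carrier G \<Longrightarrow> lext \<beta> (frag_of p) = \<beta> p"
  by (simp add: lext_def)

lemma lext_0 [simp]: "lext \<beta> 0 = \<zero>"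
  by (simp add: lext_def)

lemma lext_minus:
  assumes \<beta>: "\<And>p. p \<in> P \<Longrightarrow> \<beta> p \<in> carrier G" and u: "Poly_Mapping.keys u \<subseteq> P"
  shows "lext \<beta> (- u) = \<ominus> lext \<beta> u"
proof -
  have "lext \<beta> (- u) \<oplus> lext \<beta> u = \<zero>"
    using lext_add[OF \<beta>, where u = "- u" and v = u] u by (simp add: keys_minus)
  then show ?thesis using \<beta> u by (metis lext_closed keys_minus minus_equality)
qed

lemma add_minus_minus: "\<lbrakk>x \<in> carrier G; y \<in> carrier G\<rbrakk> \<Longrightarrow> x \<oplus> y \<ominus> x \<ominus> y = \<zero>"
  using r_neg[of "x \<oplus> y"] by (simp add: a_minus_def minus_add a_assoc)

lemma lext_diff:
  assumes \<beta>: "\<And>p. p \<in> P \<Longrightarrow> \<beta> p \<in> carrier G"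
    and u: "Poly_Mapping.keys u \<subseteq> P" and v: "Poly_Mapping.keys v \<subseteq> P"
  shows "lext \<beta> (u - v) = lext \<beta> u \<ominus> lext \<beta> v"
  using lext_add[OF \<beta> u, where v = "- v"] lext_minus[OF \<beta> v] v by (simp add: keys_minus a_minus_def)

end

locale tensor = A: assoc_algebra R A + B: assoc_algebra R B
  for R and A :: "('r, 'a) module" and B :: "('r, 'b) module"
begin

abbreviation "P \<equiv> carrier A \<times> carrier B"
abbreviation "N \<equiv> tensor_subgroup R A B"
abbreviation "T \<equiv> tensor_algebra R A B"
abbreviation "fm \<equiv> formal_mult A B"
abbreviation "cls \<equiv> tensor_class R A B"
abbreviation "pure \<equiv> pure_tensor R A B"

text \<open>The integral monoid ring of the multiplicative monoid on A \<times> B. With it the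
  tensor algebra becomes a quotient ring by an ideal, and its ring axioms follow from this.\<close>

definition F :: "('a \<times> 'b \<Rightarrow>\<^sub>0 int) ring" where
  "F = \<lparr>carrier = {u. Poly_Mapping.keys u \<subseteq> P}, monoid.mult = fm, one = frag_of (\<one>\<^bsub>A\<^esub>, \<one>\<^bsub>B\<^esub>),
        ring.zero = 0, add = (+)\<rparr>"

lemma F_simps [simp]: "carrier F = {u. Poly_Mapping.keys u \<subseteq> P}" "u \<otimes>\<^bsub>F\<^esub> v = fm u v"
  "\<one>\<^bsub>F\<^esub> = frag_of (\<one>\<^bsub>A\<^esub>, \<one>\<^bsub>B\<^esub>)" "\<zero>\<^bsub>F\<^esub> = 0" "u \<oplus>\<^bsub>F\<^esub> v = u + v"
  by (simp_all add: F_def)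

lemma add_monoid_F: "add_monoid F = tensor_free A B"
  by (simp add: F_def tensor_free_def free_Abelian_group_def)

lemma fm_of [simp]: "fm (frag_of (a, b)) (frag_of (c, d)) = frag_of (a \<otimes>\<^bsub>A\<^esub> c, b \<otimes>\<^bsub>B\<^esub> d)"
  by (simp add: formal_mult_def)

lemma fm_add_left: "fm (u + u') v = fm u v + fm u' v"
  by (simp add: formal_mult_def frag_extend_add)

lemma fm_diff_left: "fm (u - u') v = fm u v - fm u' v"
  by (simp add: formal_mult_def frag_extend_diff)

lemma fm_0 [simp]: "fm 0 v = 0" "fm u 0 = 0"
  by (simp_all add: formal_mult_def frag_extend_eq_0 case_prod_beta)

lemma fm_diff_right: "fm u (v - v') = fm u v - fm u v'"
  using subset_UNIV[of "Poly_Mapping.keys u"]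
proof (induction u rule: frag_induction)
  case (one x)
  then show ?case by (cases x) (simp add: formal_mult_def frag_extend_diff)
qed (simp_all add: fm_diff_left)

lemma fm_add_right: "fm u (v + v') = fm u v + fm u v'"
  using fm_diff_right[of u v "- v'"] fm_diff_right[of u 0 v'] by simp

lemma F_induct [consumes 1, case_names zero diff one]:
  assumes "Poly_Mapping.keys u \<subseteq> P" "Q 0"
    "\<And>u v. \<lbrakk>Poly_Mapping.keys u \<subseteq> P; Poly_Mapping.keys v \<subseteq> P; Q u; Q v\<rbrakk> \<Longrightarrow> Q (u - v)"
    "\<And>a b. \<lbrakk>a \<in> carrier A; b \<in> carrier B\<rbrakk> \<Longrightarrow> Q (frag_of (a, b))"
  shows "Q u"
  using assms(1) by (rule free_Abelian_group_induct) (use assms in auto)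

lemma keys_diff_P: "\<lbrakk>Poly_Mapping.keys u \<subseteq> P; Poly_Mapping.keys v \<subseteq> P\<rbrakk> \<Longrightarrow> Poly_Mapping.keys (u - v) \<subseteq> P"
  using keys_diff[of u v] by blast

lemma keys_add_P: "\<lbrakk>Poly_Mapping.keys u \<subseteq> P; Poly_Mapping.keys v \<subseteq> P\<rbrakk> \<Longrightarrow> Poly_Mapping.keys (u + v) \<subseteq> P"
  using keys_add[of u v] by blast

lemma fm_closed: assumes "Poly_Mapping.keys u \<subseteq> P" "Poly_Mapping.keys v \<subseteq> P" shows "Poly_Mapping.keys (fm u v) \<subseteq> P"
  using assms(1)
proof (induction u rule: F_induct)
  case (one a b)
  show ?case using assms(2)
    by (induction v rule: F_induct) (use one in \<open>simp_all add: fm_diff_right keys_diff_P\<close>)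
qed (simp_all add: fm_diff_left keys_diff_P)

lemma fm_assoc:
  assumes "Poly_Mapping.keys u \<subseteq> P" "Poly_Mapping.keys v \<subseteq> P" "Poly_Mapping.keys w \<subseteq> P"
  shows "fm (fm u v) w = fm u (fm v w)"
  using assms(1)
proof (induction u rule: F_induct)
  case (one a b)
  show ?case using assms(2)
  proof (induction v rule: F_induct)
    case (one c d)
    show ?case using assms(3)
      by (induction w rule: F_induct)
        (use one \<open>a \<in> _\<close> \<open>b \<in> _\<close> in \<open>simp_all add: fm_diff_right A.m_assoc B.m_assoc\<close>)
  qed (simp_all add: fm_diff_left fm_diff_right)
qed (simp_all add: fm_diff_left)

lemma fm_one:
  assumes "Poly_Mapping.keys u \<subseteq> P"
  shows "fm (frag_of (\<one>\<^bsub>A\<^esub>, \<one>\<^bsub>B\<^esub>)) u = u" "fm u (frag_of (\<one>\<^bsub>A\<^esub>, \<one>\<^bsub>B\<^esub>)) = u"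
  using assms by (induction u rule: F_induct) (simp_all add: fm_diff_left fm_diff_right)

lemma ring_F: "ring F"
proof (rule ringI)
  show "abelian_group F"
  proof (rule abelian_groupI)
    fix x assume "x \<in> carrier F"
    then show "\<exists>y\<in>carrier F. y \<oplus>\<^bsub>F\<^esub> x = \<zero>\<^bsub>F\<^esub>" by (intro bexI[of _ "- x"]) (simp_all add: keys_minus)
  qed (simp_all add: keys_add_P)
  show "monoid F" by (rule monoidI) (simp_all add: fm_closed fm_assoc fm_one)
qed (simp_all add: fm_add_left fm_add_right)

sublocale F: ring F by (rule ring_F)

lemma relations_subset: "tensor_relations R A B \<subseteq> carrier F"
  unfolding tensor_relations_def by (auto dest!: subsetD[OF keys_diff])

lemma N_def': "N = generate (add_monoid F) (tensor_relations R A B)"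
  unfolding tensor_subgroup_def add_monoid_F ..

lemma subgroup_N: "subgroup N (add_monoid F)"
  unfolding N_def' using relations_subset by (intro F.add.generate_is_subgroup) simp

lemma N_subset: "u \<in> N \<Longrightarrow> Poly_Mapping.keys u \<subseteq> P"
  using subgroup.subset[OF subgroup_N] by auto

lemma N_zero: "0 \<in> N"
  using subgroup.one_closed[OF subgroup_N] by simp

lemma N_minus: "u \<in> N \<Longrightarrow> - u \<in> N"
proof -
  assume u: "u \<in> N"
  have "inv\<^bsub>add_monoid F\<^esub> u = - u"
    unfolding add_monoid_F tensor_free_def using N_subset[OF u] by simp
  then show ?thesis using subgroup.m_inv_closed[OF subgroup_N u] by simp
qed

lemma N_add: "\<lbrakk>u \<in> N; v \<in> N\<rbrakk> \<Longrightarrow> u + v \<in> N"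
  using subgroup.m_closed[OF subgroup_N, of u v] by simp

lemma N_diff: "\<lbrakk>u \<in> N; v \<in> N\<rbrakk> \<Longrightarrow> u - v \<in> N"
  using N_add[of u "- v"] N_minus[of v] by simp

lemma N_induct [consumes 1, case_names rel diff]:
  assumes "u \<in> N" and rel: "\<And>r. r \<in> tensor_relations R A B \<Longrightarrow> Q r"
    and diff: "\<And>u v. \<lbrakk>u \<in> N; v \<in> N; Q u; Q v\<rbrakk> \<Longrightarrow> Q (u - v)"
    and zero: "Q 0"
  shows "Q u"
proof -
  have "N \<subseteq> {u \<in> N. Q u}"
    unfolding N_def'
  proof (rule F.add.generate_subgroup_incl)
    show "tensor_relations R A B \<subseteq> {u \<in> generate (add_monoid F) (tensor_relations R A B). Q u}"
      using rel by (auto intro: generate.incl)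
    have neg: "Q (- u)" if "u \<in> N" "Q u" for u using diff[OF N_zero that(1) zero that(2)] by simp
    show "subgroup {u \<in> generate (add_monoid F) (tensor_relations R A B). Q u} (add_monoid F)"
      unfolding N_def'[symmetric]
    proof (rule F.add.subgroupI)
      fix u assume u: "u \<in> {u \<in> N. Q u}"
      have "inv\<^bsub>add_monoid F\<^esub> u = - u"
        unfolding add_monoid_F tensor_free_def using N_subset u by simp
      then show "\<ominus>\<^bsub>F\<^esub> u \<in> {u \<in> N. Q u}" using neg N_minus u unfolding a_inv_def by simp
      fix v assume "v \<in> {u \<in> N. Q u}"
      then have "Q (u - (- v))" "v \<in> N" using u neg N_minus diff[of u "- v"] by auto
      then show "u \<oplus>\<^bsub>F\<^esub> v \<in> {u \<in> N. Q u}" using u N_add by simp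
    qed (use N_subset N_zero zero in auto)
  qed
  then show ?thesis using assms(1) by auto
qed

lemma N_rel_left: "\<lbrakk>a \<in> carrier A; a' \<in> carrier A; b \<in> carrier B\<rbrakk>
    \<Longrightarrow> frag_of (a \<oplus>\<^bsub>A\<^esub> a', b) - frag_of (a, b) - frag_of (a', b) \<in> N"
  and N_rel_right: "\<lbrakk>a \<in> carrier A; b \<in> carrier B; b' \<in> carrier B\<rbrakk>
    \<Longrightarrow> frag_of (a, b \<oplus>\<^bsub>B\<^esub> b') - frag_of (a, b) - frag_of (a, b') \<in> N"
  and N_rel_smult: "\<lbrakk>r \<in> carrier R; a \<in> carrier A; b \<in> carrier B\<rbrakk>
    \<Longrightarrow> frag_of (r \<odot>\<^bsub>A\<^esub> a, b) - frag_of (a, r \<odot>\<^bsub>B\<^esub> b) \<in> N"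
proof -
  show "frag_of (a \<oplus>\<^bsub>A\<^esub> a', b) - frag_of (a, b) - frag_of (a', b) \<in> N"
    if "a \<in> carrier A" "a' \<in> carrier A" "b \<in> carrier B"
    unfolding tensor_subgroup_def by (rule generate.incl) (use that in \<open>unfold tensor_relations_def, blast\<close>)
  show "frag_of (a, b \<oplus>\<^bsub>B\<^esub> b') - frag_of (a, b) - frag_of (a, b') \<in> N"
    if "a \<in> carrier A" "b \<in> carrier B" "b' \<in> carrier B"
    unfolding tensor_subgroup_def by (rule generate.incl) (use that in \<open>unfold tensor_relations_def, blast\<close>)
  show "frag_of (r \<odot>\<^bsub>A\<^esub> a, b) - frag_of (a, r \<odot>\<^bsub>B\<^esub> b) \<in> N"
    if "r \<in> carrier R" "a \<in> carrier A" "b \<in> carrier B"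
    unfolding tensor_subgroup_def by (rule generate.incl) (use that in \<open>unfold tensor_relations_def, blast\<close>)
qed

text \<open>Multiplying a relation by a single pair gives a relation of the same kind:
  distributivity for the first two kinds, centrality of the scalars for the balancing
  relation.\<close>

lemma N_ideal: "ideal N F"
proof (rule idealI[OF ring_F subgroup_N])
  fix u x assume u: "u \<in> N" and x: "x \<in> carrier F"
  have x': "Poly_Mapping.keys x \<subseteq> P" using x by simp
  have 1: "fm x u \<in> N \<and> fm u x \<in> N"
    if u: "u \<in> N" and g: "\<And>c d. \<lbrakk>c \<in> carrier A; d \<in> carrier B\<rbrakk> \<Longrightarrow>
        fm (frag_of (c, d)) u \<in> N \<and> fm u (frag_of (c, d)) \<in> N" for u
    using x' by (induction x rule: F_induct) (use g in \<open>auto simp: N_zero fm_diff_left fm_diff_right N_diff\<close>)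
  have "fm (frag_of (c, d)) u \<in> N \<and> fm u (frag_of (c, d)) \<in> N"
    if cd: "c \<in> carrier A" "d \<in> carrier B" for c d
    using u
  proof (induction u rule: N_induct)
    case (rel r)
    then consider a a' b where "r = frag_of (a \<oplus>\<^bsub>A\<^esub> a', b) - frag_of (a, b) - frag_of (a', b)"
        "a \<in> carrier A" "a' \<in> carrier A" "b \<in> carrier B"
      | a b b' where "r = frag_of (a, b \<oplus>\<^bsub>B\<^esub> b') - frag_of (a, b) - frag_of (a, b')"
        "a \<in> carrier A" "b \<in> carrier B" "b' \<in> carrier B"
      | s a b where "r = frag_of (s \<odot>\<^bsub>A\<^esub> a, b) - frag_of (a, s \<odot>\<^bsub>B\<^esub> b)"
        "s \<in> carrier R" "a \<in> carrier A" "b \<in> carrier B"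
      unfolding tensor_relations_def by blast
    then show ?case
    proof cases
      case 1
      then show ?thesis using cd
        by (simp add: fm_diff_left fm_diff_right A.l_distr A.r_distr N_rel_left)
    next
      case 2
      then show ?thesis using cd
        by (simp add: fm_diff_left fm_diff_right B.l_distr B.r_distr N_rel_right)
    next
      case 3
      then show ?thesis using cd
        by (simp add: fm_diff_left fm_diff_right A.smult_mult_left A.smult_mult_right
            B.smult_mult_left B.smult_mult_right N_rel_smult)
    qed
  qed (simp_all add: N_zero fm_diff_left fm_diff_right N_diff)
  then show "x \<otimes>\<^bsub>F\<^esub> u \<in> N" "u \<otimes>\<^bsub>F\<^esub> x \<in> N" using 1[OF u] by auto
qed

sublocale N: ideal N F by (rule N_ideal)

lemma cls_eq: "cls u = N +>\<^bsub>F\<^esub> u"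
  unfolding tensor_class_def a_r_coset_def add_monoid_F ..

lemma T_Quot: "carrier T = carrier (F Quot N)" "monoid.mult T = monoid.mult (F Quot N)"
  "one T = one (F Quot N)" "ring.zero T = ring.zero (F Quot N)" "add T = add (F Quot N)"
proof -
  show "carrier T = carrier (F Quot N)"
    unfolding tensor_algebra_def Let_def FactRing_def A_RCOSETS_def add_monoid_F FactGroup_def by simp
  show "monoid.mult T = monoid.mult (F Quot N)"
    by (simp add: tensor_algebra_def Let_def FactRing_def rcoset_mult_def[abs_def] cls_eq)
  show "one T = one (F Quot N)"
    by (simp add: tensor_algebra_def Let_def FactRing_def pure_tensor_def cls_eq)
  show "ring.zero T = ring.zero (F Quot N)"
    by (simp add: tensor_algebra_def Let_def FactRing_def FactGroup_def)
  show "add T = add (F Quot N)"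
    unfolding tensor_algebra_def Let_def FactRing_def FactGroup_def set_add_def add_monoid_F by simp
qed

lemma ring_T: "ring T"
  by (rule ring_transfer[OF N.quotient_is_ring T_Quot])

sublocale T: ring T by (rule ring_T)

lemma carrier_T: "carrier T = {cls u | u. Poly_Mapping.keys u \<subseteq> P}"
  unfolding T_Quot FactRing_def A_RCOSETS_def' by (auto simp: cls_eq)

lemma cls_closed [simp]: "Poly_Mapping.keys u \<subseteq> P \<Longrightarrow> cls u \<in> carrier T"
  by (auto simp: carrier_T)

lemma cls_mult: "\<lbrakk>Poly_Mapping.keys u \<subseteq> P; Poly_Mapping.keys v \<subseteq> P\<rbrakk> \<Longrightarrow> cls u \<otimes>\<^bsub>T\<^esub> cls v = cls (fm u v)"
  unfolding T_Quot cls_eq using N.rcoset_mult_add[of u v] by (simp add: FactRing_def)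

lemma cls_add: "\<lbrakk>Poly_Mapping.keys u \<subseteq> P; Poly_Mapping.keys v \<subseteq> P\<rbrakk> \<Longrightarrow> cls u \<oplus>\<^bsub>T\<^esub> cls v = cls (u + v)"
  unfolding T_Quot cls_eq using N.a_rcos_sum[of u v] by (simp add: FactRing_def)

lemma cls_one: "\<one>\<^bsub>T\<^esub> = cls (frag_of (\<one>\<^bsub>A\<^esub>, \<one>\<^bsub>B\<^esub>))"
  unfolding T_Quot cls_eq by (simp add: FactRing_def)

lemma mem_cls: "v \<in> cls u \<longleftrightarrow> (\<exists>h\<in>N. v = h + u)"
  by (auto simp: cls_eq a_r_coset_def r_coset_def)

lemma cls_zero: "\<zero>\<^bsub>T\<^esub> = cls 0"
  unfolding T_Quot cls_eq by (auto simp: FactRing_def a_r_coset_def r_coset_def)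

lemma cls_cong:
  assumes "u - v \<in> N" shows "cls u = cls v"
proof -
  have *: "cls u \<subseteq> cls v" if "u - v \<in> N" for u v
  proof
    fix x assume "x \<in> cls u"
    then obtain h where "h \<in> N" "x = h + u" by (auto simp: mem_cls)
    then show "x \<in> cls v" using N_add[OF _ that, of h] unfolding mem_cls
      by (intro bexI[of _ "h + (u - v)"]) simp_all
  qed
  then show ?thesis using assms N_minus[OF assms] by (metis minus_diff_eq subset_antisym)
qed

lemma cls_self: "u \<in> cls u"
  using N_zero by (auto simp: mem_cls)

lemma cls_eqD: "cls u = cls v \<Longrightarrow> u - v \<in> N"
  using cls_self[of u] by (auto simp: mem_cls)

lemma cls_minus: "Poly_Mapping.keys u \<subseteq> P \<Longrightarrow> \<ominus>\<^bsub>T\<^esub> cls u = cls (- u)"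
proof (rule T.minus_equality)
  assume u: "Poly_Mapping.keys u \<subseteq> P"
  then show "cls (- u) \<oplus>\<^bsub>T\<^esub> cls u = \<zero>\<^bsub>T\<^esub>" by (simp add: cls_add keys_minus cls_zero)
qed (simp_all add: keys_minus)

lemma cls_diff: "\<lbrakk>Poly_Mapping.keys u \<subseteq> P; Poly_Mapping.keys v \<subseteq> P\<rbrakk> \<Longrightarrow> cls (u - v) = cls u \<ominus>\<^bsub>T\<^esub> cls v"
  using cls_add[of u "- v"] by (simp add: a_minus_def cls_minus keys_minus)

lemma pure_closed [simp]: "\<lbrakk>a \<in> carrier A; b \<in> carrier B\<rbrakk> \<Longrightarrow> pure a b \<in> carrier T"
  by (simp add: pure_tensor_def)

lemma pure_mult: "\<lbrakk>a \<in> carrier A; b \<in> carrier B; c \<in> carrier A; d \<in> carrier B\<rbrakk>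
    \<Longrightarrow> pure a b \<otimes>\<^bsub>T\<^esub> pure c d = pure (a \<otimes>\<^bsub>A\<^esub> c) (b \<otimes>\<^bsub>B\<^esub> d)"
  by (simp add: pure_tensor_def cls_mult)

lemma pure_one: "\<one>\<^bsub>T\<^esub> = pure \<one>\<^bsub>A\<^esub> \<one>\<^bsub>B\<^esub>"
  by (simp add: pure_tensor_def cls_one)

lemma pure_add_left: "\<lbrakk>a \<in> carrier A; a' \<in> carrier A; b \<in> carrier B\<rbrakk>
    \<Longrightarrow> pure (a \<oplus>\<^bsub>A\<^esub> a') b = pure a b \<oplus>\<^bsub>T\<^esub> pure a' b"
  using cls_cong[of "frag_of (a \<oplus>\<^bsub>A\<^esub> a', b)" "frag_of (a, b) + frag_of (a', b)"] N_rel_left[of a a' b]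
  by (simp add: pure_tensor_def cls_add diff_diff_eq)

lemma pure_add_right: "\<lbrakk>a \<in> carrier A; b \<in> carrier B; b' \<in> carrier B\<rbrakk>
    \<Longrightarrow> pure a (b \<oplus>\<^bsub>B\<^esub> b') = pure a b \<oplus>\<^bsub>T\<^esub> pure a b'"
  using cls_cong[of "frag_of (a, b \<oplus>\<^bsub>B\<^esub> b')" "frag_of (a, b) + frag_of (a, b')"] N_rel_right[of a b b']
  by (simp add: pure_tensor_def cls_add diff_diff_eq)

lemma pure_smult: "\<lbrakk>r \<in> carrier R; a \<in> carrier A; b \<in> carrier B\<rbrakk>
    \<Longrightarrow> pure (r \<odot>\<^bsub>A\<^esub> a) b = pure a (r \<odot>\<^bsub>B\<^esub> b)"
  using cls_cong N_rel_smult by (simp add: pure_tensor_def)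

text \<open>Sums suffice, because the negative of a pure tensor is again pure: the sign goes into
  the first factor.\<close>

lemma T_span: "t \<in> carrier T \<Longrightarrow> t \<in> add_span T {pure a b | a b. a \<in> carrier A \<and> b \<in> carrier B}"
proof -
  let ?S = "{pure a b | a b. a \<in> carrier A \<and> b \<in> carrier B}"
  have S: "?S \<subseteq> carrier T" by auto
  have neg: "\<ominus>\<^bsub>T\<^esub> x \<in> add_span T ?S" if "x \<in> add_span T ?S" for x
  proof (rule T.add_span_image[OF T.abelian_group_axioms S S that])
    fix s assume "s \<in> ?S"
    then obtain a b where s: "s = pure a b" "a \<in> carrier A" "b \<in> carrier B" by blast
    have z: "pure \<zero>\<^bsub>A\<^esub> b = \<zero>\<^bsub>T\<^esub>"
      using pure_add_left[of "\<zero>\<^bsub>A\<^esub>" "\<zero>\<^bsub>A\<^esub>" b] s(3) by (simp add: T.add.l_cancel_one')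
    have "pure (\<ominus>\<^bsub>A\<^esub> a) b \<oplus>\<^bsub>T\<^esub> pure a b = \<zero>\<^bsub>T\<^esub>"
      using pure_add_left[of "\<ominus>\<^bsub>A\<^esub> a" a b] s by (simp add: A.M.l_neg z)
    then have "\<ominus>\<^bsub>T\<^esub> s = pure (\<ominus>\<^bsub>A\<^esub> a) b" using s by (intro T.minus_equality) simp_all
    then show "\<ominus>\<^bsub>T\<^esub> s \<in> add_span T ?S" using s by (intro T.add_span_incl[OF S]) auto
  qed (simp_all add: T.minus_add)
  assume "t \<in> carrier T"
  then obtain u where u: "t = cls u" "Poly_Mapping.keys u \<subseteq> P" by (auto simp: carrier_T)
  show ?thesis
    unfolding u(1) using u(2)
  proof (induction u rule: F_induct)
    case zero
    then show ?case by (simp add: add_span.zero flip: cls_zero)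
  next
    case (diff u v)
    then show ?case
      unfolding cls_diff[OF diff(1,2)] a_minus_def by (intro T.add_span_plus[OF S] neg)
  next
    case (one a b)
    then show ?case by (intro T.add_span_incl[OF S]) (auto simp: pure_tensor_def)
  qed
qed

text \<open>The universal property of the tensor product for balanced biadditive maps. It is applied
  to the natural map and to the map into the localization of \<open>Dq\<close>.\<close>

lemma lext_N:
  assumes G: "abelian_group G"
    and cl: "\<And>a b. \<lbrakk>a \<in> carrier A; b \<in> carrier B\<rbrakk> \<Longrightarrow> \<beta> (a, b) \<in> carrier G"
    and l: "\<And>a a' b. \<lbrakk>a \<in> carrier A; a' \<in> carrier A; b \<in> carrier B\<rbrakk>
        \<Longrightarrow> \<beta> (a \<oplus>\<^bsub>A\<^esub> a', b) = \<beta> (a, b) \<oplus>\<^bsub>G\<^esub> \<beta> (a', b)"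
    and r: "\<And>a b b'. \<lbrakk>a \<in> carrier A; b \<in> carrier B; b' \<in> carrier B\<rbrakk>
        \<Longrightarrow> \<beta> (a, b \<oplus>\<^bsub>B\<^esub> b') = \<beta> (a, b) \<oplus>\<^bsub>G\<^esub> \<beta> (a, b')"
    and s: "\<And>s a b. \<lbrakk>s \<in> carrier R; a \<in> carrier A; b \<in> carrier B\<rbrakk>
        \<Longrightarrow> \<beta> (s \<odot>\<^bsub>A\<^esub> a, b) = \<beta> (a, s \<odot>\<^bsub>B\<^esub> b)"
    and u: "u \<in> N"
  shows "abelian_group.lext G \<beta> u = \<zero>\<^bsub>G\<^esub>"
proof -
  interpret G: abelian_group G by fact
  have cl': "\<beta> p \<in> carrier G" if "p \<in> P" for p using cl that by auto
  note diff = G.lext_diff[OF cl']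
  show ?thesis
    using u
  proof (induction u rule: N_induct)
    case (rel x)
    then consider a a' b where "x = frag_of (a \<oplus>\<^bsub>A\<^esub> a', b) - frag_of (a, b) - frag_of (a', b)"
        "a \<in> carrier A" "a' \<in> carrier A" "b \<in> carrier B"
      | a b b' where "x = frag_of (a, b \<oplus>\<^bsub>B\<^esub> b') - frag_of (a, b) - frag_of (a, b')"
        "a \<in> carrier A" "b \<in> carrier B" "b' \<in> carrier B"
      | s a b where "x = frag_of (s \<odot>\<^bsub>A\<^esub> a, b) - frag_of (a, s \<odot>\<^bsub>B\<^esub> b)"
        "s \<in> carrier R" "a \<in> carrier A" "b \<in> carrier B"
      unfolding tensor_relations_def by blast
    then show ?case
    proof cases
      case 1
      then show ?thesis
        by (simp add: diff keys_diff_P cl l) (simp add: G.add_minus_minus cl)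
    next
      case 2
      then show ?thesis
        by (simp add: diff keys_diff_P cl r) (simp add: G.add_minus_minus cl)
    next
      case 3
      then show ?thesis by (simp add: diff cl s G.minus_eq G.r_neg)
    qed
  next
    case (diff u v)
    then show ?case
      using G.lext_diff[of "carrier A \<times> carrier B" \<beta> u v] cl' N_subset by (simp add: G.minus_eq)
  qed simp
qed

end

section \<open>A criterion for Azumaya algebras\<close>

lemma opposite_algebra_simps [simp]:
  "carrier (opposite_algebra A) = carrier A" "a \<otimes>\<^bsub>opposite_algebra A\<^esub> b = b \<otimes>\<^bsub>A\<^esub> a"
  "\<one>\<^bsub>opposite_algebra A\<^esub> = \<one>\<^bsub>A\<^esub>" "\<zero>\<^bsub>opposite_algebra A\<^esub> = \<zero>\<^bsub>A\<^esub>"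
  "add (opposite_algebra A) = add A" "module.smult (opposite_algebra A) = module.smult A"
  by (simp_all add: opposite_algebra_def)

lemma assoc_algebra_opposite:
  assumes "assoc_algebra R A" shows "assoc_algebra R (opposite_algebra A)"
proof -
  interpret assoc_algebra R A by fact
  let ?O = "opposite_algebra A"
  have ag: "abelian_group ?O"
    by (rule abelian_groupI) (use add.l_inv_ex in \<open>auto simp: a_assoc intro: a_comm\<close>)
  have "ring ?O"
    by (rule ringI[OF ag monoidI]) (auto simp: m_assoc l_distr r_distr)
  moreover have "module R ?O"
    by (rule moduleI[OF R.cring_axioms ag])
      (auto simp: smult_l_distr smult_r_distr smult_assoc1)
  ultimately show ?thesis
    unfolding assoc_algebra_def assoc_algebra_axioms_def
    by (auto simp: smult_mult_left smult_mult_right)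
qed

lemma (in tensor) smult_T:
  assumes r: "r \<in> carrier R" and t: "t \<in> carrier T"
  shows "r \<odot>\<^bsub>T\<^esub> t = pure (r \<odot>\<^bsub>A\<^esub> \<one>\<^bsub>A\<^esub>) \<one>\<^bsub>B\<^esub> \<otimes>\<^bsub>T\<^esub> t"
proof -
  obtain u where u: "t = cls u" "Poly_Mapping.keys u \<subseteq> P" using t by (auto simp: carrier_T)
  have sm: "frag_extend (\<lambda>(a, b). frag_of (r \<odot>\<^bsub>A\<^esub> a, b)) v = fm (frag_of (r \<odot>\<^bsub>A\<^esub> \<one>\<^bsub>A\<^esub>, \<one>\<^bsub>B\<^esub>)) v"
    if "Poly_Mapping.keys v \<subseteq> P" for v
    using that by (induction v rule: F_induct)
      (use r in \<open>simp_all add: frag_extend_diff fm_diff_right A.smult_mult_left\<close>)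
  have "cls (frag_extend (\<lambda>(a, b). frag_of (r \<odot>\<^bsub>A\<^esub> a, b)) v) = pure (r \<odot>\<^bsub>A\<^esub> \<one>\<^bsub>A\<^esub>) \<one>\<^bsub>B\<^esub> \<otimes>\<^bsub>T\<^esub> t"
    if "v \<in> cls u" for v
  proof -
    from that obtain h where h: "h \<in> N" "v = h + u" by (auto simp: mem_cls)
    then have v: "Poly_Mapping.keys v \<subseteq> P" "cls v = t"
      using keys_add_P[OF N_subset[OF h(1)] u(2)] u(1) cls_cong[of "h + u" u] by simp_all
    then show ?thesis using r by (simp add: sm pure_tensor_def cls_mult flip: v(2))
  qed
  then have "(\<Union>v\<in>cls u. cls (frag_extend (\<lambda>(a, b). frag_of (r \<odot>\<^bsub>A\<^esub> a, b)) v))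
      = pure (r \<odot>\<^bsub>A\<^esub> \<one>\<^bsub>A\<^esub>) \<one>\<^bsub>B\<^esub> \<otimes>\<^bsub>T\<^esub> t"
    by (intro UN_constant_eq[OF cls_self]) blast
  then show ?thesis by (simp add: tensor_algebra_def Let_def u(1))
qed

locale enveloping_algebra = assoc_algebra R A
  for R :: "('r, 'x) ring_scheme" and A :: "('r, 'a) module" (structure) +
  fixes \<kappa>R :: "'k::field \<Rightarrow> 'r"
  assumes kR_closed [simp]: "\<kappa>R k \<in> carrier R"
    and kR_add: "\<kappa>R (k + m) = \<kappa>R k \<oplus>\<^bsub>R\<^esub> \<kappa>R m"
    and kR_mult: "\<kappa>R (k * m) = \<kappa>R k \<otimes>\<^bsub>R\<^esub> \<kappa>R m"
    and kR_one: "\<kappa>R 1 = \<one>\<^bsub>R\<^esub>"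
begin

sublocale Tn: tensor R A "opposite_algebra A"
  by (rule tensor.intro[OF assoc_algebra_axioms assoc_algebra_opposite[OF assoc_algebra_axioms]])

abbreviation "Ae \<equiv> Tn.T"
abbreviation Ae_mult (infixl "\<bullet>" 70) where "s \<bullet> t \<equiv> s \<otimes>\<^bsub>Ae\<^esub> t"
abbreviation "lam a \<equiv> Tn.pure a \<one>"
abbreviation "rho a \<equiv> Tn.pure \<one> a"
abbreviation "act \<equiv> natural_map A"
definition "Zc = {r \<odot> \<one> | r. r \<in> carrier R}"
definition "\<kappa> k = \<kappa>R k \<odot> \<one>"

text \<open>Representatives of a class differ by elements of the relation subgroup, on which the
  balanced map sending (a, b) to \<open>a x b\<close> vanishes. The image in the definition is
  therefore a singleton and \<open>the_elem\<close> is meaningful.\<close>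

lemma natural_map_cls:
  assumes u: "Poly_Mapping.keys u \<subseteq> carrier A \<times> carrier A"
  shows "act (Tn.cls u)
    = (\<lambda>x\<in>carrier A. lext (\<lambda>p. fst p \<otimes> x \<otimes> snd p) u)"
proof -
  have "(\<lambda>x\<in>carrier A. lext (\<lambda>p. fst p \<otimes> x \<otimes> snd p) v)
      = (\<lambda>x\<in>carrier A. lext (\<lambda>p. fst p \<otimes> x \<otimes> snd p) u)"
    if "v \<in> Tn.cls u" for v
  proof (rule restrict_ext)
    fix x assume x: "x \<in> carrier A"
    from that obtain h where h: "h \<in> Tn.N" "v = h + u" by (auto simp: Tn.mem_cls)
    have "lext (\<lambda>p. fst p \<otimes> x \<otimes> snd p) h = \<zero>"
      by (rule Tn.lext_N[OF abelian_group_axioms _ _ _ _ h(1)])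
        (use x in \<open>auto simp: l_distr r_distr smult_mult_left smult_mult_right\<close>)
    then show "lext (\<lambda>p. fst p \<otimes> x \<otimes> snd p) v = lext (\<lambda>p. fst p \<otimes> x \<otimes> snd p) u"
      unfolding h(2)
      using lext_add[of "carrier A \<times> carrier A" "\<lambda>p. fst p \<otimes> x \<otimes> snd p" h u] u x Tn.N_subset[OF h(1)]
        lext_closed[of "carrier A \<times> carrier A" "\<lambda>p. fst p \<otimes> x \<otimes> snd p" u]
      by (auto simp: mem_Times_iff)
  qed
  then have "(\<lambda>v. \<lambda>x\<in>carrier A. lext (\<lambda>p. fst p \<otimes> x \<otimes> snd p) v) ` Tn.cls u
      = {\<lambda>x\<in>carrier A. lext (\<lambda>p. fst p \<otimes> x \<otimes> snd p) u}"
    using Tn.cls_self[of u] by blast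
  then show ?thesis unfolding natural_map_def lext_def by simp
qed

lemma act_pure:
  assumes "a \<in> carrier A" "b \<in> carrier A" "x \<in> carrier A"
  shows "act (Tn.pure a b) x = a \<otimes> x \<otimes> b"
  using assms by (simp add: pure_tensor_def natural_map_cls)

lemma act_mem: "\<lbrakk>s \<in> carrier Ae; x \<in> carrier A\<rbrakk> \<Longrightarrow> act s x \<in> carrier A"
  using lext_closed[of "carrier A \<times> carrier A" "\<lambda>p. fst p \<otimes> x \<otimes> snd p"]
  by (auto simp: Tn.carrier_T natural_map_cls mem_Times_iff)

lemma act_plus: "\<lbrakk>s \<in> carrier Ae; t \<in> carrier Ae; x \<in> carrier A\<rbrakk> \<Longrightarrow> act (s \<oplus>\<^bsub>Ae\<^esub> t) x = act s x \<oplus> act t x"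
proof -
  assume a: "s \<in> carrier Ae" "t \<in> carrier Ae" and x: "x \<in> carrier A"
  then obtain u v where u: "s = Tn.cls u" "Poly_Mapping.keys u \<subseteq> carrier A \<times> carrier A"
    and v: "t = Tn.cls v" "Poly_Mapping.keys v \<subseteq> carrier A \<times> carrier A"
    by (auto simp: Tn.carrier_T)
  then show ?thesis
    using lext_add[of "carrier A \<times> carrier A" "\<lambda>p. fst p \<otimes> x \<otimes> snd p" u v] x
      Tn.keys_add_P[of u v]
    by (auto simp: Tn.cls_add natural_map_cls mem_Times_iff)
qed

lemma act_zero: "x \<in> carrier A \<Longrightarrow> act \<zero>\<^bsub>Ae\<^esub> x = \<zero>"
  by (simp add: Tn.cls_zero natural_map_cls)

lemma Ae_induct [consumes 1, case_names zero pure plus]: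
  assumes "t \<in> carrier Ae" and "Q \<zero>\<^bsub>Ae\<^esub>"
    and "\<And>a b. \<lbrakk>a \<in> carrier A; b \<in> carrier A\<rbrakk> \<Longrightarrow> Q (Tn.pure a b)"
    and "\<And>s t. \<lbrakk>s \<in> carrier Ae; t \<in> carrier Ae; Q s; Q t\<rbrakk> \<Longrightarrow> Q (s \<oplus>\<^bsub>Ae\<^esub> t)"
  shows "Q t"
proof -
  have "{Tn.pure a b | a b. a \<in> carrier A \<and> b \<in> carrier (opposite_algebra A)} \<subseteq> carrier Ae"
    by auto
  then show ?thesis
    using Tn.T_span[OF assms(1)] by (rule Tn.T.add_span_induct) (use assms in auto)
qed

lemma act_plus_right:
  assumes "s \<in> carrier Ae" and x: "x \<in> carrier A" "y \<in> carrier A"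
  shows "act s (x \<oplus> y) = act s x \<oplus> act s y"
  using assms(1)
proof (induction rule: Ae_induct)
  case (plus s t)
  note [simp] = act_mem[OF plus(1) x(1)] act_mem[OF plus(1) x(2)] act_mem[OF plus(2) x(1)] act_mem[OF plus(2) x(2)]
  show ?case using plus x by (simp add: act_plus a_ac)
qed (use x in \<open>simp_all add: act_zero act_pure l_distr r_distr\<close>)

lemma act_zero_r: "s \<in> carrier Ae \<Longrightarrow> act s \<zero> = \<zero>"
  using act_plus_right[of s "\<zero>" "\<zero>"] act_mem[of s "\<zero>"] by (simp add: add.l_cancel_one')

lemma act_comp:
  assumes "s \<in> carrier Ae" and t: "t \<in> carrier Ae" and x: "x \<in> carrier A"
  shows "act (s \<bullet> t) x = act s (act t x)"
  using assms(1)
proof (induction rule: Ae_induct)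
  case (pure a b)
  show ?case using t
    by (induction rule: Ae_induct)
      (use pure x in \<open>simp_all add: Tn.pure_mult Tn.T.r_distr act_plus act_zero act_zero_r act_pure m_assoc
        act_plus_right act_mem\<close>)
next
  case (plus s s')
  then show ?case using t x act_mem by (simp add: Tn.T.l_distr act_plus)
qed (use t x act_mem in \<open>simp_all add: act_zero\<close>)

lemma smult_one_mult: "\<lbrakk>r \<in> carrier R; a \<in> carrier A\<rbrakk> \<Longrightarrow> r \<odot> \<one> \<otimes> a = r \<odot> a"
  "\<lbrakk>r \<in> carrier R; a \<in> carrier A\<rbrakk> \<Longrightarrow> a \<otimes> (r \<odot> \<one>) = r \<odot> a"
  by (simp_all add: smult_mult_left smult_mult_right)

text \<open>The concrete tensor product fits the abstract setting. That \<open>lam\<close> and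
  \<open>rho\<close> agree on \<open>Zc\<close> is the balancing relation at the pure tensor of two
  units.\<close>

lemma enveloping: "enveloping A Ae Zc \<kappa> (\<lambda>a. lam a) (\<lambda>a. rho a) act"
proof (intro enveloping.intro enveloping_axioms.intro ring_axioms Tn.ring_T)
  show "subring Zc A"
  proof (rule subringI)
    show "\<one> \<in> Zc" unfolding Zc_def by (auto intro!: exI[of _ "\<one>\<^bsub>R\<^esub>"])
    fix h assume "h \<in> Zc"
    then obtain r where r: "h = r \<odot> \<one>" "r \<in> carrier R" by (auto simp: Zc_def)
    have "\<ominus> h = (\<ominus>\<^bsub>R\<^esub> r) \<odot> \<one>" using r by (simp add: smult_l_minus)
    then show "\<ominus> h \<in> Zc" using r by (auto simp: Zc_def)
    fix g assume "g \<in> Zc"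
    then obtain s where s: "g = s \<odot> \<one>" "s \<in> carrier R" by (auto simp: Zc_def)
    have "h \<otimes> g = (r \<otimes>\<^bsub>R\<^esub> s) \<odot> \<one>"
      using smult_one_mult(1)[of r g] r s by (simp add: smult_assoc1)
    moreover have "h \<oplus> g = (r \<oplus>\<^bsub>R\<^esub> s) \<odot> \<one>"
      using r s by (simp add: smult_l_distr)
    ultimately show "h \<otimes> g \<in> Zc" "h \<oplus> g \<in> Zc" using r s by (auto simp: Zc_def)
  qed (auto simp: Zc_def)
  show "z \<otimes> a = a \<otimes> z" if "z \<in> Zc" "a \<in> carrier A" for z a
    using that by (auto simp: Zc_def smult_one_mult)
  show "\<kappa> k \<in> Zc" for k by (auto simp: \<kappa>_def Zc_def)
  show "\<kappa> (k + m) = \<kappa> k \<oplus> \<kappa> m" for k m by (simp add: \<kappa>_def kR_add smult_l_distr)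
  show "\<kappa> (k * m) = \<kappa> k \<otimes> \<kappa> m" for k m by (simp add: \<kappa>_def kR_mult smult_assoc1 smult_one_mult(1))
  show "\<kappa> 1 = \<one>" by (simp add: \<kappa>_def kR_one)
  show "lam z = rho z" if "z \<in> Zc" for z
    using that Tn.pure_smult[of _ "\<one>" "\<one>"] by (auto simp: Zc_def)
  fix s assume s: "s \<in> carrier Ae"
  have "{Tn.pure a b | a b. a \<in> carrier A \<and> b \<in> carrier (opposite_algebra A)}
      = {lam a \<bullet> rho b | a b. a \<in> carrier A \<and> b \<in> carrier A}"
    by (intro Collect_cong ex_cong1) (auto simp: Tn.pure_mult)
  then show "s \<in> add_span Ae {lam a \<bullet> rho b | a b. a \<in> carrier A \<and> b \<in> carrier A}"
    using Tn.T_span[OF s] by simp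
qed (use act_mem act_plus act_plus_right act_comp in
      \<open>simp_all add: Tn.pure_add_left Tn.pure_add_right[simplified] Tn.pure_mult Tn.pure_one act_pure\<close>)

sublocale enveloping A Ae Zc \<kappa> "\<lambda>a. lam a" "\<lambda>a. rho a" act
  by (rule enveloping)

text \<open>An element of the span is a list-like sum in which a left factor may recur. To index by
  a finite set of left factors, terms with equal left factor are merged by adding their right
  factors.\<close>

lemma lam_span_finite:
  assumes e: "e \<in> carrier Ae" and t: "t \<in> lam_span e (carrier A)"
  shows "\<exists>U \<psi>. finite U \<and> U \<subseteq> carrier A \<and> \<psi> \<in> U \<rightarrow> carrier A
    \<and> t = (\<Oplus>\<^bsub>Ae\<^esub>u\<in>U. lam u \<bullet> e \<bullet> lam (\<psi> u))"
  using t unfolding lam_span_def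
proof induction
  case zero
  show ?case by (intro exI[of _ "{}"]) simp
next
  case (add s y)
  then obtain u v where s: "s = lam u \<bullet> e \<bullet> lam v" "u \<in> carrier A" "v \<in> carrier A" by blast
  from add.IH obtain U \<psi> where U: "finite U" "U \<subseteq> carrier A" "\<psi> \<in> U \<rightarrow> carrier A"
    and y: "y = (\<Oplus>\<^bsub>Ae\<^esub>u\<in>U. lam u \<bullet> e \<bullet> lam (\<psi> u))" by blast
  let ?f = "\<lambda>\<psi> u. lam u \<bullet> e \<bullet> lam (\<psi> u)"
  \<comment> \<open>If \<open>u\<close> already occurs, its old right factor is added to
    \<open>v\<close>; otherwise the default zero leaves \<open>v\<close> alone.\<close>
  define \<psi>' where "\<psi>' = \<psi>(u := v \<oplus> (if u \<in> U then \<psi> u else \<zero>))"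
  let ?W = "U - {u}"
  have \<psi>u: "u \<in> U \<Longrightarrow> \<psi> u \<in> carrier A" using U by auto
  have \<psi>': "\<psi>' \<in> insert u U \<rightarrow> carrier A" using U s(3) by (auto simp: \<psi>'_def Pi_iff)
  have pw: "\<psi>' w \<in> carrier A" "w \<in> carrier A" if "w \<in> insert u U" for w
    using \<psi>' U(2) s(2) that by (auto simp: Pi_iff)
  have \<psi>w: "\<psi> w \<in> carrier A" "w \<in> carrier A" if "w \<in> U" for w using U(2,3) that by auto
  have W: "finite ?W" "u \<notin> ?W" using U by auto
  have fc: "?f \<phi> w \<in> carrier Ae" if "w \<in> carrier A" "\<phi> w \<in> carrier A" for \<phi> w using e that by simp
  have eqW: "(\<Oplus>\<^bsub>Ae\<^esub>w\<in>?W. ?f \<psi> w) = (\<Oplus>\<^bsub>Ae\<^esub>w\<in>?W. ?f \<psi>' w)"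
  proof (rule Tn.T.add.finprod_cong')
    have "\<psi> w \<in> carrier A" "w \<in> carrier A" if "w \<in> U" for w using U that by auto
    then show "?f \<psi>' \<in> ?W \<rightarrow> carrier Ae" using e by (auto simp: \<psi>'_def)
  qed (auto simp: \<psi>'_def)
  have cW: "(\<Oplus>\<^bsub>Ae\<^esub>w\<in>?W. ?f \<psi>' w) \<in> carrier Ae"
    using pw e by (intro Tn.T.finsum_closed) auto
  have "y = (if u \<in> U then ?f \<psi> u else \<zero>\<^bsub>Ae\<^esub>) \<oplus>\<^bsub>Ae\<^esub> (\<Oplus>\<^bsub>Ae\<^esub>w\<in>?W. ?f \<psi>' w)"
  proof (cases "u \<in> U")
    case True
    have "y = (\<Oplus>\<^bsub>Ae\<^esub>w\<in>insert u ?W. ?f \<psi> w)" using True by (simp add: y insert_absorb)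
    also have "\<dots> = ?f \<psi> u \<oplus>\<^bsub>Ae\<^esub> (\<Oplus>\<^bsub>Ae\<^esub>w\<in>?W. ?f \<psi> w)"
      using \<psi>w W s True e by (intro Tn.T.finsum_insert) auto
    finally show ?thesis using True eqW by simp
  next
    case False
    then show ?thesis using eqW cW y by simp
  qed
  then have "s \<oplus>\<^bsub>Ae\<^esub> y = s \<oplus>\<^bsub>Ae\<^esub> (if u \<in> U then ?f \<psi> u else \<zero>\<^bsub>Ae\<^esub>) \<oplus>\<^bsub>Ae\<^esub> (\<Oplus>\<^bsub>Ae\<^esub>w\<in>?W. ?f \<psi>' w)"
    using s e \<psi>u cW by (auto simp: Tn.T.a_assoc)
  also have "s \<oplus>\<^bsub>Ae\<^esub> (if u \<in> U then ?f \<psi> u else \<zero>\<^bsub>Ae\<^esub>) = ?f \<psi>' u"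
    using s e \<psi>u by (auto simp: \<psi>'_def lam_add Tn.T.r_distr)
  also have "?f \<psi>' u \<oplus>\<^bsub>Ae\<^esub> (\<Oplus>\<^bsub>Ae\<^esub>w\<in>?W. ?f \<psi>' w) = (\<Oplus>\<^bsub>Ae\<^esub>w\<in>insert u ?W. ?f \<psi>' w)"
    using W pw e by (subst Tn.T.finsum_insert[OF W, symmetric]) auto
  finally show ?case using U \<psi>' s(2) by (intro exI[of _ "insert u U"] exI[of _ \<psi>']) auto
qed

text \<open>On \<open>e\<close> a right multiplication can be traded for a left one, so
  \<open>t e\<close> depends only on the value of \<open>t\<close> at the unit. This makes the left
  ideal generated by \<open>e\<close> a copy of \<open>A\<close>.\<close>

lemma mult_idem_left:
  assumes e: "azumaya_idem (carrier A) e" and t: "t \<in> carrier Ae"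
  shows "t \<bullet> e = lam (act t \<one>) \<bullet> e"
  using t
proof (induction rule: Ae_induct)
  have ec: "e \<in> carrier Ae" using e by (auto simp: azumaya_idem_def)
  {
    case zero
    then show ?case using ec by (simp add: act_zero)
  next
    case (pure a b)
    have "Tn.pure a b = lam a \<bullet> rho b" using pure by (simp add: Tn.pure_mult)
    then have "Tn.pure a b \<bullet> e = lam a \<bullet> (rho b \<bullet> e)"
      using pure ec by (simp add: Tn.T.m_assoc)
    also have "rho b \<bullet> e = lam b \<bullet> e" using e pure by (simp add: azumaya_idem_def)
    finally show ?case using pure ec by (simp add: act_pure lam_mult Tn.T.m_assoc)
  next
    case (plus s t)
    then show ?case using ec act_mem by (simp add: act_plus lam_add Tn.T.l_distr)
  }
qed

lemma finsum_act:
  assumes "finite U" "f \<in> U \<rightarrow> carrier Ae" "x \<in> carrier A"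
  shows "act (\<Oplus>\<^bsub>Ae\<^esub>u\<in>U. f u) x = (\<Oplus>u\<in>U. act (f u) x)"
  using assms
proof (induction U)
  case (insert u U)
  then have "(\<Oplus>\<^bsub>Ae\<^esub>u\<in>insert u U. f u) = f u \<oplus>\<^bsub>Ae\<^esub> (\<Oplus>\<^bsub>Ae\<^esub>u\<in>U. f u)"
    by (intro Tn.T.finsum_insert) auto
  moreover have "(\<Oplus>u\<in>insert u U. act (f u) x) = act (f u) x \<oplus> (\<Oplus>u\<in>U. act (f u) x)"
    using insert act_mem by (intro finsum_insert) auto
  ultimately show ?case using insert by (simp add: act_plus Pi_iff)
qed (simp add: act_zero)

lemma module_homs_finsum:
  assumes f: "f \<in> module_homs R A A" and "finite U" "g \<in> U \<rightarrow> carrier A"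
  shows "f (\<Oplus>u\<in>U. g u) = (\<Oplus>u\<in>U. f (g u))"
  using assms(2,3)
proof (induction U)
  case empty
  have fc: "f a \<in> carrier A" if "a \<in> carrier A" for a using f that by (auto simp: module_homs_def)
  have "f (\<zero> \<oplus> \<zero>) = f \<zero> \<oplus> f \<zero>"
    using f M.zero_closed unfolding module_homs_def by blast
  then show ?case using fc[of "\<zero>"] by (simp add: add.l_cancel_one')
next
  case (insert u U)
  have fc: "f a \<in> carrier A" if "a \<in> carrier A" for a using f that by (auto simp: module_homs_def)
  have fa: "f (a \<oplus> b) = f a \<oplus> f b" if "a \<in> carrier A" "b \<in> carrier A" for a b
    using f that by (auto simp: module_homs_def)
  have "(\<Oplus>u\<in>insert u U. g u) = g u \<oplus> (\<Oplus>u\<in>U. g u)"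
    using insert by (intro finsum_insert) auto
  moreover have "(\<Oplus>u\<in>insert u U. f (g u)) = f (g u) \<oplus> (\<Oplus>u\<in>U. f (g u))"
    using insert fc by (intro finsum_insert) auto
  ultimately show ?case using insert fa by (simp add: Pi_iff)
qed

lemma natural_map_hom: "natural_map A \<in> ring_hom Ae (endo_algebra R A)"
  "natural_map A \<in> module_homs R Ae (endo_algebra R A)"
proof -
  have ext: "act t \<in> extensional (carrier A)" if "t \<in> carrier Ae" for t
    using that by (auto simp: Tn.carrier_T natural_map_cls)
  have sm: "act t (r \<odot> a) = r \<odot> act t a" if "t \<in> carrier Ae" "r \<in> carrier R" "a \<in> carrier A" for t r a
    using act_central[of "r \<odot> \<one>" a t] that act_mem
    by (auto simp: smult_one_mult Zc_def)
  have cl: "act t \<in> carrier (endo_algebra R A)" if "t \<in> carrier Ae" for t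
    using that ext sm act_mem act_plus_right by (auto simp: endo_algebra_def module_homs_def)
  show "natural_map A \<in> ring_hom Ae (endo_algebra R A)"
  proof (rule ring_hom_memI)
    fix s t assume st: "s \<in> carrier Ae" "t \<in> carrier Ae"
    show "act (s \<bullet> t) = act s \<otimes>\<^bsub>endo_algebra R A\<^esub> act t"
      using st ext[of "s \<bullet> t"] by (intro extensionalityI[of _ "carrier A"]) (auto simp: endo_algebra_def act_comp)
    show "act (s \<oplus>\<^bsub>Ae\<^esub> t) = act s \<oplus>\<^bsub>endo_algebra R A\<^esub> act t"
      using st ext[of "s \<oplus>\<^bsub>Ae\<^esub> t"] by (intro extensionalityI[of _ "carrier A"]) (auto simp: endo_algebra_def act_plus)
  next
    show "act \<one>\<^bsub>Ae\<^esub> = \<one>\<^bsub>endo_algebra R A\<^esub>"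
      using ext[of "\<one>\<^bsub>Ae\<^esub>"] by (intro extensionalityI[of _ "carrier A"]) (auto simp: endo_algebra_def)
  qed (rule cl)
  have "act (r \<odot>\<^bsub>Ae\<^esub> t) = r \<odot>\<^bsub>endo_algebra R A\<^esub> act t" if rt: "r \<in> carrier R" "t \<in> carrier Ae" for r t
  proof -
    have *: "r \<odot>\<^bsub>Ae\<^esub> t = lam (r \<odot> \<one>) \<bullet> t" using Tn.smult_T[OF rt] by simp
    have "lam (r \<odot> \<one>) \<bullet> t \<in> carrier Ae" using rt by simp
    then show ?thesis
      unfolding * using rt ext[of "lam (r \<odot> \<one>) \<bullet> t"] act_mem
      by (intro extensionalityI[of _ "carrier A"]) (auto simp: endo_algebra_def act_comp act_pure smult_mult_left)
  qed
  then show "natural_map A \<in> module_homs R Ae (endo_algebra R A)"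
    using cl ext act_mem
    by (auto simp: module_homs_def[of R Ae] endo_algebra_def act_plus intro!: extensionalityI[of _ "carrier A"])
qed

theorem azumaya_criterion:
  assumes idem: "azumaya_idem (carrier A) e" and inj: "inj_on (\<lambda>r. r \<odot> \<one>) (carrier R)"
  shows "azumaya_algebra R A" "ring_centre A = Zc"
proof -
  note e' = idem[unfolded azumaya_idem_def]
  have ec [simp]: "e \<in> carrier Ae" using e' by auto
  have "\<one>\<^bsub>Ae\<^esub> \<in> lam_span e (carrier A)" using e' by blast
  from lam_span_finite[OF ec this]
  obtain U \<psi> where U: "finite U" "U \<subseteq> carrier A" and \<psi>': "\<psi> \<in> U \<rightarrow> carrier A"
    and one: "\<one>\<^bsub>Ae\<^esub> = (\<Oplus>\<^bsub>Ae\<^esub>u\<in>U. lam u \<bullet> e \<bullet> lam (\<psi> u))"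
    by blast
  have \<psi>: "\<psi> u \<in> carrier A" if "u \<in> U" for u using \<psi>' that by auto
  have Uc: "u \<in> carrier A" if "u \<in> U" for u using U that by auto
  \<comment> \<open>The values of \<open>e\<close> lie in the image of \<open>R\<close> in
    \<open>A\<close>; injectivity of the structure map allows reading them as elements of
    \<open>R\<close>, which turns \<open>e\<close> into an \<open>R\<close>-linear
    functional.\<close>
  define \<tau> where "\<tau> x = (THE r. r \<in> carrier R \<and> act e x = r \<odot> \<one>)" for x
  have \<tau>: "\<tau> x \<in> carrier R \<and> act e x = \<tau> x \<odot> \<one>" if "x \<in> carrier A" for x
    unfolding \<tau>_def
  proof (rule theI')
    have "act e x \<in> Zc" using e' that by auto
    then obtain r where r: "act e x = r \<odot> \<one>" "r \<in> carrier R" unfolding Zc_def by blast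
    then show "\<exists>!r. r \<in> carrier R \<and> act e x = r \<odot> \<one>"
      using inj_onD[OF inj] by (intro ex1I[of _ r]) auto
  qed
  have \<tau>_eq: "\<tau> x = r" if "x \<in> carrier A" "r \<in> carrier R" "act e x = r \<odot> \<one>" for x r
    using \<tau>[OF that(1)] that inj by (metis (no_types, lifting) inj_onD)
  have \<tau>_add: "\<tau> (x \<oplus> y) = \<tau> x \<oplus>\<^bsub>R\<^esub> \<tau> y" if "x \<in> carrier A" "y \<in> carrier A" for x y
    using that \<tau> by (intro \<tau>_eq) (auto simp: act_plus_right smult_l_distr)
  have \<tau>_smult: "\<tau> (r \<odot> x) = r \<otimes>\<^bsub>R\<^esub> \<tau> x" if "r \<in> carrier R" "x \<in> carrier A" for r x
  proof (rule \<tau>_eq)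
    have "act e (r \<odot> x) = r \<odot> act e x"
      using act_central[of "r \<odot> \<one>" x e] that act_mem by (auto simp: smult_one_mult Zc_def)
    then show "act e (r \<odot> x) = (r \<otimes>\<^bsub>R\<^esub> \<tau> x) \<odot> \<one>" using that \<tau> by (simp add: smult_assoc1)
  qed (use that \<tau> in auto)
  have term_act: "act (lam a \<bullet> e \<bullet> lam b) x = \<tau> (b \<otimes> x) \<odot> a"
    if "a \<in> carrier A" "b \<in> carrier A" "x \<in> carrier A" for a b x
    using that \<tau>[of "b \<otimes> x"] by (simp add: act_comp act_pure smult_mult_right)
  have dual: "x = (\<Oplus>u\<in>U. \<tau> (\<psi> u \<otimes> x) \<odot> u)" if x: "x \<in> carrier A" for x
  proof -
    have "x = act (\<Oplus>\<^bsub>Ae\<^esub>u\<in>U. lam u \<bullet> e \<bullet> lam (\<psi> u)) x" using x by (simp flip: one)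
    also have "\<dots> = (\<Oplus>u\<in>U. act (lam u \<bullet> e \<bullet> lam (\<psi> u)) x)"
      using U \<psi> Uc x by (intro finsum_act) auto
    also have "\<dots> = (\<Oplus>u\<in>U. \<tau> (\<psi> u \<otimes> x) \<odot> u)"
      by (rule add.finprod_cong') (use U \<psi> Uc x \<tau> term_act in auto)
    finally show ?thesis .
  qed
  have fg: "fin_gen_module R A"
    unfolding fin_gen_module_def
  proof (intro exI[of _ U] conjI ballI)
    fix x assume x: "x \<in> carrier A"
    show "\<exists>c. c \<in> U \<rightarrow> carrier R \<and> x = (\<Oplus>s\<in>U. c s \<odot> s)"
      using dual[OF x] \<tau> \<psi> x by (intro exI[of _ "\<lambda>u. \<tau> (\<psi> u \<otimes> x)"]) auto
  qed (use U in auto)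
  have proj: "projective_module R A"
    unfolding projective_module_def
  proof (intro exI conjI ballI)
    let ?\<iota> = "\<lambda>x u. if u \<in> U then \<tau> (\<psi> u \<otimes> x) else \<zero>\<^bsub>R\<^esub>"
    let ?\<pi> = "\<lambda>f. \<Oplus>u\<in>U. f u \<odot> u"
    show "?\<iota> \<in> module_homs R A (free_module R U)"
    proof -
      have "finite {i. ?\<iota> x i \<noteq> \<zero>\<^bsub>R\<^esub>}" for x
        by (rule finite_subset[OF _ U(1)]) auto
      moreover have "\<tau> (\<psi> u \<otimes> (r \<odot> x)) = r \<otimes>\<^bsub>R\<^esub> \<tau> (\<psi> u \<otimes> x)"
        if "u \<in> U" "r \<in> carrier R" "x \<in> carrier A" for u r x
        using that \<psi> by (simp add: smult_mult_right \<tau>_smult)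
      ultimately show ?thesis
        using \<tau> \<psi> by (auto simp: module_homs_def free_module_def r_distr \<tau>_add)
    qed
    show "?\<pi> \<in> module_homs R (free_module R U) A"
    proof -
      have 1: "(\<Oplus>u\<in>U. (f u \<oplus>\<^bsub>R\<^esub> g u) \<odot> u) = (\<Oplus>u\<in>U. f u \<odot> u) \<oplus> (\<Oplus>u\<in>U. g u \<odot> u)"
        if fg: "\<And>i. f i \<in> carrier R" "\<And>i. g i \<in> carrier R" for f g
      proof -
        have "(\<Oplus>u\<in>U. (f u \<oplus>\<^bsub>R\<^esub> g u) \<odot> u) = (\<Oplus>u\<in>U. f u \<odot> u \<oplus> g u \<odot> u)"
          by (rule add.finprod_cong') (use fg Uc in \<open>auto simp: smult_l_distr\<close>)
        then show ?thesis using fg Uc by (simp add: finsum_addf Pi_iff)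
      qed
      have 2: "(\<Oplus>u\<in>U. (r \<otimes>\<^bsub>R\<^esub> f u) \<odot> u) = r \<odot> (\<Oplus>u\<in>U. f u \<odot> u)"
        if fr: "\<And>i. f i \<in> carrier R" "r \<in> carrier R" for f r
      proof -
        have h: "(\<lambda>x. r \<odot> x) \<in> module_homs R A A"
          using fr(2) by (auto simp: module_homs_def smult_r_distr R.m_comm simp flip: smult_assoc1)
        have "(\<Oplus>u\<in>U. (r \<otimes>\<^bsub>R\<^esub> f u) \<odot> u) = (\<Oplus>u\<in>U. r \<odot> (f u \<odot> u))"
          by (rule add.finprod_cong') (use fr Uc in \<open>auto simp: smult_assoc1\<close>)
        also have "\<dots> = r \<odot> (\<Oplus>u\<in>U. f u \<odot> u)"
          using module_homs_finsum[OF h U(1), of "\<lambda>u. f u \<odot> u"] fr Uc by auto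
        finally show ?thesis .
      qed
      have 3: "(\<Oplus>u\<in>U. f u \<odot> u) \<in> carrier A" if "\<And>i. f i \<in> carrier R" for f
        using that Uc by (intro finsum_closed) auto
      show ?thesis using 1 2 3 by (auto simp: module_homs_def free_module_def)
    qed
    fix x assume x: "x \<in> carrier A"
    have "?\<pi> (?\<iota> x) = (\<Oplus>u\<in>U. \<tau> (\<psi> u \<otimes> x) \<odot> u)"
      by (rule add.finprod_cong') (use U \<psi> Uc x \<tau> in auto)
    then show "?\<pi> (?\<iota> x) = x" using dual[OF x] by simp
  qed
  have inj_nat: "inj_on (natural_map A) (carrier Ae)"
  proof (rule inj_onI)
    fix s t assume st: "s \<in> carrier Ae" "t \<in> carrier Ae" and eq: "act s = act t"
    \<comment> \<open>Multiplying the expansion of the unit by \<open>r\<close> and using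
      \<open>mult_idem_left\<close> recovers \<open>r\<close> from its values on the finite set
      \<open>U\<close>.\<close>
    have *: "r = (\<Oplus>\<^bsub>Ae\<^esub>u\<in>U. lam (act r u) \<bullet> e \<bullet> lam (\<psi> u))" if r: "r \<in> carrier Ae" for r
    proof -
      have tm: "r \<bullet> (lam u \<bullet> e \<bullet> lam (\<psi> u)) = lam (act r u) \<bullet> e \<bullet> lam (\<psi> u)"
        if "u \<in> U" for u
      proof -
        have "(r \<bullet> lam u) \<bullet> e = lam (act r u) \<bullet> e"
          using mult_idem_left[OF idem, of "r \<bullet> lam u"] r Uc[OF that] by (simp add: act_comp act_pure)
        then show ?thesis
          using r Uc[OF that] \<psi>[OF that] by (simp flip: Tn.T.m_assoc)
      qed
      have "r = r \<bullet> (\<Oplus>\<^bsub>Ae\<^esub>u\<in>U. lam u \<bullet> e \<bullet> lam (\<psi> u))" using r by (simp flip: one)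
      also have "\<dots> = (\<Oplus>\<^bsub>Ae\<^esub>u\<in>U. r \<bullet> (lam u \<bullet> e \<bullet> lam (\<psi> u)))"
        by (rule Tn.T.finsum_rdistr) (use r Uc \<psi> U in auto)
      also have "\<dots> = (\<Oplus>\<^bsub>Ae\<^esub>u\<in>U. lam (act r u) \<bullet> e \<bullet> lam (\<psi> u))"
        by (rule Tn.T.add.finprod_cong') (use r Uc \<psi> tm act_mem in auto)
      finally show ?thesis .
    qed
    show "s = t" using *[OF st(1)] *[OF st(2)] eq by simp
  qed
  have surj: "f \<in> natural_map A ` carrier Ae" if "f \<in> carrier (endo_algebra R A)" for f
  proof -
    have f: "f \<in> module_homs R A A" "f \<in> extensional (carrier A)" using that by (auto simp: endo_algebra_def)
    have fc: "f a \<in> carrier A" if "a \<in> carrier A" for a using f(1) that by (auto simp: module_homs_def)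
    \<comment> \<open>The recovery formula from the injectivity argument, with the prescribed values
      \<open>f u\<close> in place of \<open>act r u\<close>.\<close>
    let ?t = "\<Oplus>\<^bsub>Ae\<^esub>u\<in>U. lam (f u) \<bullet> e \<bullet> lam (\<psi> u)"
    have t: "?t \<in> carrier Ae" using Uc \<psi> fc by (intro Tn.T.finsum_closed) auto
    have "act ?t x = f x" if x: "x \<in> carrier A" for x
    proof -
      have "act ?t x = (\<Oplus>u\<in>U. act (lam (f u) \<bullet> e \<bullet> lam (\<psi> u)) x)"
        using U \<psi> Uc x fc by (intro finsum_act) auto
      also have "\<dots> = (\<Oplus>u\<in>U. f (\<tau> (\<psi> u \<otimes> x) \<odot> u))"
      proof (rule add.finprod_cong')
        fix u assume u: "u \<in> U"
        have "f (\<tau> (\<psi> u \<otimes> x) \<odot> u) = \<tau> (\<psi> u \<otimes> x) \<odot> f u"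
          using f(1) \<tau>[of "\<psi> u \<otimes> x"] \<psi>[OF u] Uc[OF u] x unfolding module_homs_def by auto
        then show "act (lam (f u) \<bullet> e \<bullet> lam (\<psi> u)) x = f (\<tau> (\<psi> u \<otimes> x) \<odot> u)"
          using term_act \<psi>[OF u] Uc[OF u] fc x by simp
      qed (use \<tau> \<psi> Uc x fc in auto)
      also have "\<dots> = f x"
        using module_homs_finsum[OF f(1) U(1), of "\<lambda>u. \<tau> (\<psi> u \<otimes> x) \<odot> u"] \<tau> \<psi> Uc x dual[OF x]
        by auto
      finally show ?thesis .
    qed
    moreover have "act ?t \<in> extensional (carrier A)" using t by (auto simp: Tn.carrier_T natural_map_cls)
    ultimately have eq: "act ?t = f" using f(2) by (intro extensionalityI[of _ "carrier A"]) auto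
    show ?thesis using imageI[OF t, of act] unfolding eq .
  qed
  have "natural_map A ` carrier Ae \<subseteq> carrier (endo_algebra R A)"
    using natural_map_hom(1) by (auto simp: ring_hom_def)
  then have "bij_betw (natural_map A) (carrier Ae) (carrier (endo_algebra R A))"
    using inj_nat surj by (auto simp: bij_betw_def)
  then have "natural_map A \<in> algebra_isos R Ae (endo_algebra R A)"
    using natural_map_hom by (auto simp: algebra_isos_def ring_iso_def)
  then show "azumaya_algebra R A"
    using assoc_algebra_axioms fg proj by (simp add: azumaya_algebra_def)
  show "ring_centre A = Zc"
  proof (intro equalityI subsetI)
    fix z assume "z \<in> Zc"
    then show "z \<in> ring_centre A" using Zc_central by (auto simp: ring_centre_def)
  next
    fix z assume "z \<in> ring_centre A"
    then have z: "z \<in> carrier A" "\<And>a. a \<in> carrier A \<Longrightarrow> z \<otimes> a = a \<otimes> z" by (auto simp: ring_centre_def)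
    \<comment> \<open>A central \<open>z\<close> passes through \<open>e\<close>, so the value of
      \<open>e\<close> at \<open>z\<close> is \<open>z\<close> times its value at 1. Thus
      \<open>z\<close> itself lies in the range of \<open>e\<close>.\<close>
    have "act e z = act (e \<bullet> lam z) \<one>" using z(1) by (simp add: act_comp act_pure)
    also have "e \<bullet> lam z = lam z \<bullet> e" by (rule central_commutes[OF z ec])
    also have "act (lam z \<bullet> e) \<one> = z" using z(1) e' by (simp add: act_comp act_pure)
    finally show "z \<in> Zc" using e' z(1) by metis
  qed
qed

end

section \<open>The algebra of quantum differential operators\<close>

lemma ring_of_type_algebra_simps [simp]:
  "carrier ring_of_type_algebra = (UNIV :: 'a::ring_1 set)"
  "x \<otimes>\<^bsub>ring_of_type_algebra\<^esub> y = x * (y :: 'a)" "\<one>\<^bsub>ring_of_type_algebra\<^esub> = (1 :: 'a)"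
  "\<zero>\<^bsub>ring_of_type_algebra\<^esub> = (0 :: 'a)" "x \<oplus>\<^bsub>ring_of_type_algebra\<^esub> y = x + (y :: 'a)"
  by (simp_all add: ring_of_type_algebra_def)

definition qgens :: "nat \<Rightarrow> qgen set" where
  "qgens n = Xgen ` {1..n} \<union> Dgen ` {1..n}"

lemma carrier_free_algebra: "carrier (free_algebra n) = {p. \<forall>w\<in>Poly_Mapping.keys p. set w \<subseteq> qgens n}"
  by (simp add: free_algebra_def qgens_def)

lemma free_algebra_simps [simp]:
  "x \<otimes>\<^bsub>free_algebra n\<^esub> y = x * y" "\<one>\<^bsub>free_algebra n\<^esub> = 1"
  "\<zero>\<^bsub>free_algebra n\<^esub> = 0" "x \<oplus>\<^bsub>free_algebra n\<^esub> y = x + y"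
  by (simp_all add: free_algebra_def ring_of_type_algebra_def)

lemma ring_free_algebra: "ring (free_algebra n :: 'k::field free_alg ring)"
proof (rule ringI)
  show "abelian_group (free_algebra n :: 'k free_alg ring)"
  proof (rule abelian_groupI)
    fix x y :: "'k free_alg" assume "x \<in> carrier (free_algebra n)" "y \<in> carrier (free_algebra n)"
    then show "x \<oplus>\<^bsub>free_algebra n\<^esub> y \<in> carrier (free_algebra n)"
      using keys_add[of x y] by (auto simp: carrier_free_algebra)
  next
    fix x :: "'k free_alg" assume "x \<in> carrier (free_algebra n)"
    then show "\<exists>y\<in>carrier (free_algebra n). y \<oplus>\<^bsub>free_algebra n\<^esub> x = \<zero>\<^bsub>free_algebra n\<^esub>"
      by (intro bexI[of _ "- x"]) (auto simp: carrier_free_algebra keys_minus)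
  qed (auto simp: carrier_free_algebra ac_simps)
  show "monoid (free_algebra n :: 'k free_alg ring)"
  proof (rule monoidI)
    fix x y :: "'k free_alg" assume "x \<in> carrier (free_algebra n)" "y \<in> carrier (free_algebra n)"
    then show "x \<otimes>\<^bsub>free_algebra n\<^esub> y \<in> carrier (free_algebra n)"
      using keys_mult[of x y] by (fastforce simp: carrier_free_algebra plus_list_def)
  qed (auto simp: carrier_free_algebra mult.assoc zero_list_def)
qed (auto simp: algebra_simps)

lemma single_closed [simp]: "set w \<subseteq> qgens n \<Longrightarrow> Poly_Mapping.single w c \<in> carrier (free_algebra n)"
  by (auto simp: carrier_free_algebra split: if_splits)

lemma fscalar_closed [simp]: "fscalar c \<in> carrier (free_algebra n)"
  by (simp add: fscalar_def)

lemma fx_closed [simp]: "i \<in> {1..n} \<Longrightarrow> fx i \<in> carrier (free_algebra n)"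
  and fd_closed [simp]: "i \<in> {1..n} \<Longrightarrow> fd i \<in> carrier (free_algebra n)"
  by (simp_all add: fx_def fd_def qgens_def)

lemma fscalar_add: "fscalar (a + b) = fscalar a + fscalar b"
  and fscalar_mult: "fscalar (a * b) = fscalar a * fscalar b"
  and fscalar_1: "fscalar 1 = 1"
  by (simp_all add: fscalar_def single_add mult_single plus_list_def zero_list_def flip: single_one)

lemma sum_single_lookup: "(\<Sum>w\<in>Poly_Mapping.keys p. Poly_Mapping.single w (Poly_Mapping.lookup p w)) = p"
  by (rule poly_mapping_eqI) (simp add: lookup_sum lookup_single when_def in_keys_iff)

lemma fscalar_central: "p * fscalar c = fscalar c * p"
proof -
  have "Poly_Mapping.single w a * fscalar c = fscalar c * Poly_Mapping.single w a" for w a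
    by (simp add: fscalar_def mult_single plus_list_def mult.commute)
  then have "(\<Sum>w\<in>Poly_Mapping.keys p. Poly_Mapping.single w (Poly_Mapping.lookup p w)) * fscalar c
      = fscalar c * (\<Sum>w\<in>Poly_Mapping.keys p. Poly_Mapping.single w (Poly_Mapping.lookup p w))"
    by (simp add: sum_distrib_left sum_distrib_right)
  then show ?thesis by (simp add: sum_single_lookup)
qed

locale Dq_presentation =
  fixes n :: nat and q :: "'k::field"
begin

interpretation F: ring "free_algebra n :: 'k free_alg ring"
  by (rule ring_free_algebra)

abbreviation "D \<equiv> Dq n q"
abbreviation "cl \<equiv> Dq_class n q"

lemma F_minus: "x \<in> carrier (free_algebra n) \<Longrightarrow> \<ominus>\<^bsub>free_algebra n\<^esub> x = - (x :: 'k free_alg)"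
  by (rule F.minus_equality) (auto simp: carrier_free_algebra keys_minus)

lemma Dq_relations_closed: "Dq_relations n q \<subseteq> carrier (free_algebra n)"
proof -
  have d: "a - b \<in> carrier (free_algebra n)"
    if "a \<in> carrier (free_algebra n)" "b \<in> carrier (free_algebra n)" for a b :: "'k free_alg"
    using F.minus_closed[OF that] that by (simp add: a_minus_def F_minus)
  have m: "a * b \<in> carrier (free_algebra n)" "a + b \<in> carrier (free_algebra n)"
    if "a \<in> carrier (free_algebra n)" "b \<in> carrier (free_algebra n)" for a b :: "'k free_alg"
    using F.m_closed[OF that] F.a_closed[OF that] by simp_all
  show ?thesis unfolding Dq_relations_def by (auto intro!: d m simp del: One_nat_def)
qed

interpretation I: ideal "Dq_ideal n q" "free_algebra n"
  unfolding Dq_ideal_def by (rule F.genideal_ideal[OF Dq_relations_closed])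

lemma ring_Dq: "ring D"
  unfolding Dq_def by (rule I.quotient_is_ring)

interpretation D: ring D by (rule ring_Dq)

lemma carrier_Dq: "carrier D = cl ` carrier (free_algebra n)"
  unfolding Dq_def FactRing_def A_RCOSETS_def' Dq_class_def by auto

lemma cl_closed [simp]: "p \<in> carrier (free_algebra n) \<Longrightarrow> cl p \<in> carrier D"
  by (simp add: carrier_Dq)

lemma cl_mult: "\<lbrakk>p \<in> carrier (free_algebra n); r \<in> carrier (free_algebra n)\<rbrakk> \<Longrightarrow> cl (p * r) = cl p \<otimes>\<^bsub>D\<^esub> cl r"
  using I.rcoset_mult_add[of p r] by (simp add: Dq_def FactRing_def Dq_class_def)

lemma cl_add: "\<lbrakk>p \<in> carrier (free_algebra n); r \<in> carrier (free_algebra n)\<rbrakk> \<Longrightarrow> cl (p + r) = cl p \<oplus>\<^bsub>D\<^esub> cl r"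
  using I.a_rcos_sum[of p r] by (simp add: Dq_def FactRing_def Dq_class_def)

lemma cl_one: "cl 1 = \<one>\<^bsub>D\<^esub>"
  by (simp add: Dq_def FactRing_def Dq_class_def)

lemma cl_relation:
  assumes "p - r \<in> Dq_relations n q" "p \<in> carrier (free_algebra n)" "r \<in> carrier (free_algebra n)"
  shows "cl p = cl r"
proof -
  have "p \<ominus>\<^bsub>free_algebra n\<^esub> r \<in> Dq_ideal n q"
    using F.genideal_self[OF Dq_relations_closed] assms by (auto simp: a_minus_def F_minus Dq_ideal_def)
  then show ?thesis
    unfolding Dq_class_def using I.a_rcos_module_minus[OF F.ring_axioms assms(3,2)] assms
    by (intro I.a_repr_independence'[symmetric]) auto
qed

lemma free_algebra_closed [simp]:
  "\<lbrakk>p \<in> carrier (free_algebra n); r \<in> carrier (free_algebra n)\<rbrakk> \<Longrightarrow> p * r \<in> carrier (free_algebra n :: 'k free_alg ring)"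
  "\<lbrakk>p \<in> carrier (free_algebra n); r \<in> carrier (free_algebra n)\<rbrakk> \<Longrightarrow> p + r \<in> carrier (free_algebra n :: 'k free_alg ring)"
  using F.m_closed[of p r] F.a_closed[of p r] by simp_all

lemma scalar_ring_Dq: "scalar_ring D (Dq_scalar n q)"
proof
  fix x a assume "x \<in> carrier D"
  then obtain p where p: "x = cl p" "p \<in> carrier (free_algebra n)" by (auto simp: carrier_Dq)
  then show "x \<otimes>\<^bsub>D\<^esub> Dq_scalar n q a = Dq_scalar n q a \<otimes>\<^bsub>D\<^esub> x"
    by (simp add: Dq_scalar_def fscalar_central flip: cl_mult)
qed (simp_all add: Dq_scalar_def fscalar_add fscalar_mult fscalar_1 cl_add cl_mult cl_one)

lemma Dq_x_closed [simp]: "i \<in> {1..n} \<Longrightarrow> Dq_x n q i \<in> carrier D"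
  and Dq_d_closed [simp]: "i \<in> {1..n} \<Longrightarrow> Dq_d n q i \<in> carrier D"
  unfolding Dq_x_def Dq_d_def by (simp_all del: atLeastAtMost_iff)

lemma Dq_relations_memI:
  "\<lbrakk>i \<in> {1..n}; j \<in> {1..n}; i \<noteq> j\<rbrakk> \<Longrightarrow> fx i * fx j - fscalar (qsgn q i j) * fx j * fx i \<in> Dq_relations n q"
  "\<lbrakk>i \<in> {1..n}; j \<in> {1..n}; i \<noteq> j\<rbrakk> \<Longrightarrow> fd i * fd j - fscalar (qsgn q i j) * fd j * fd i \<in> Dq_relations n q"
  "\<lbrakk>i \<in> {1..n}; j \<in> {1..n}; i \<noteq> j\<rbrakk>
    \<Longrightarrow> fd i * fx j - fscalar (inverse (qsgn q i j)) * fx j * fd i \<in> Dq_relations n q"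
  "i \<in> {1..n} \<Longrightarrow> fd i * fx i - (fscalar q * fx i * fd i + fscalar (q - 1)) \<in> Dq_relations n q"
  unfolding Dq_relations_def by blast+

text \<open>The generators are numbered from 1 and the system from 0. The shift by
  \<open>Suc\<close> keeps the order of indices, on which alone \<open>qsgn\<close> depends.\<close>

lemma weyl_system_Dq:
  assumes "q \<noteq> 0"
  shows "weyl_system D (Dq_scalar n q) q n (\<lambda>i. Dq_x n q (Suc i)) (\<lambda>i. Dq_d n q (Suc i))"
proof (intro weyl_system.intro weyl_system_axioms.intro scalar_ring_Dq assms)
  fix i j assume ij: "i < n" "j < n"
  then have ij': "Suc i \<in> {1..n}" "Suc j \<in> {1..n}" by auto
  note [simp] = fx_closed[OF ij'(1)] fx_closed[OF ij'(2)] fd_closed[OF ij'(1)] fd_closed[OF ij'(2)]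
  have qs: "qsgn q (Suc i) (Suc j) = qsgn q i j" by (simp add: qsgn_def)
  {
    assume ne: "i \<noteq> j"
    have "cl (fx (Suc i) * fx (Suc j)) = cl (fscalar (qsgn q i j) * fx (Suc j) * fx (Suc i))"
      using Dq_relations_memI(1)[OF ij'] ne qs by (intro cl_relation) simp_all
    then show "Dq_x n q (Suc i) \<otimes>\<^bsub>D\<^esub> Dq_x n q (Suc j)
        = Dq_scalar n q (qsgn q i j) \<otimes>\<^bsub>D\<^esub> (Dq_x n q (Suc j) \<otimes>\<^bsub>D\<^esub> Dq_x n q (Suc i))"
      by (simp add: cl_mult Dq_x_def Dq_scalar_def D.m_assoc)
    have "cl (fd (Suc i) * fd (Suc j)) = cl (fscalar (qsgn q i j) * fd (Suc j) * fd (Suc i))"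
      using Dq_relations_memI(2)[OF ij'] ne qs by (intro cl_relation) simp_all
    then show "Dq_d n q (Suc i) \<otimes>\<^bsub>D\<^esub> Dq_d n q (Suc j)
        = Dq_scalar n q (qsgn q i j) \<otimes>\<^bsub>D\<^esub> (Dq_d n q (Suc j) \<otimes>\<^bsub>D\<^esub> Dq_d n q (Suc i))"
      by (simp add: cl_mult Dq_d_def Dq_scalar_def D.m_assoc)
    have "cl (fd (Suc i) * fx (Suc j)) = cl (fscalar (inverse (qsgn q i j)) * fx (Suc j) * fd (Suc i))"
      using Dq_relations_memI(3)[OF ij'] ne qs by (intro cl_relation) simp_all
    then show "Dq_d n q (Suc i) \<otimes>\<^bsub>D\<^esub> Dq_x n q (Suc j)
        = Dq_scalar n q (inverse (qsgn q i j)) \<otimes>\<^bsub>D\<^esub> (Dq_x n q (Suc j) \<otimes>\<^bsub>D\<^esub> Dq_d n q (Suc i))"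
      by (simp add: cl_mult Dq_x_def Dq_d_def Dq_scalar_def D.m_assoc)
  }
next
  fix i assume i: "i < n"
  then have i': "Suc i \<in> {1..n}" by auto
  note [simp] = fx_closed[OF i'] fd_closed[OF i']
  have "cl (fd (Suc i) * fx (Suc i)) = cl (fscalar q * fx (Suc i) * fd (Suc i) + fscalar (q - 1))"
    using Dq_relations_memI(4)[OF i'] by (intro cl_relation) simp_all
  then show "Dq_d n q (Suc i) \<otimes>\<^bsub>D\<^esub> Dq_x n q (Suc i)
      = Dq_scalar n q q \<otimes>\<^bsub>D\<^esub> (Dq_x n q (Suc i) \<otimes>\<^bsub>D\<^esub> Dq_d n q (Suc i)) \<oplus>\<^bsub>D\<^esub> Dq_scalar n q (q - 1)"
    by (simp add: cl_mult cl_add Dq_x_def Dq_d_def Dq_scalar_def D.m_assoc)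
qed (auto intro!: Dq_x_closed Dq_d_closed)

text \<open>Every class is a finite sum of scaled words. The applications take \<open>T\<close> to
  be a centralizer or the preimage of a subring.\<close>

lemma Dq_generated:
  assumes T: "subring T D" and sc: "range (Dq_scalar n q) \<subseteq> T"
    and gen: "\<And>i. i \<in> {1..n} \<Longrightarrow> Dq_x n q i \<in> T \<and> Dq_d n q i \<in> T"
  shows "carrier D \<subseteq> T"
proof
  note E = subringE[OF T]
  have single: "cl (Poly_Mapping.single w c) \<in> T" if "set w \<subseteq> qgens n" for w c
    using that
  proof (induction w arbitrary: c)
    case Nil
    then show ?case using sc by (auto simp: Dq_scalar_def fscalar_def)
  next
    case (Cons a w)
    have "Poly_Mapping.single (a # w) c = Poly_Mapping.single [a] 1 * Poly_Mapping.single w c"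
      by (simp add: mult_single plus_list_def)
    moreover have "cl (Poly_Mapping.single [a] 1) \<in> T"
      using Cons.prems gen by (auto simp: qgens_def Dq_x_def Dq_d_def fx_def fd_def)
    ultimately show ?case using Cons by (simp add: cl_mult E(6))
  qed
  have sum: "cl (\<Sum>w\<in>W. Poly_Mapping.single w (f w)) \<in> T \<and> (\<Sum>w\<in>W. Poly_Mapping.single w (f w)) \<in> carrier (free_algebra n)"
    if "finite W" "\<And>w. w \<in> W \<Longrightarrow> set w \<subseteq> qgens n" for W f
    using that
  proof (induction W)
    case empty
    have "cl (Poly_Mapping.single [] 0) \<in> T" by (rule single) simp
    then show ?case using F.zero_closed by simp
  qed (simp add: cl_add E(7) single)
  fix x assume "x \<in> carrier D"
  then obtain p where p: "x = cl p" "p \<in> carrier (free_algebra n)" by (auto simp: carrier_Dq)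
  have "p = (\<Sum>w\<in>Poly_Mapping.keys p. Poly_Mapping.single w (Poly_Mapping.lookup p w))"
    by (simp add: sum_single_lookup)
  then show "x \<in> T"
    using sum[of "Poly_Mapping.keys p" "Poly_Mapping.lookup p"] p by (auto simp: carrier_free_algebra)
qed

end

section \<open>Algebras given by a central structure homomorphism\<close>

lemma algebra_of_hom_simps [simp]:
  "carrier (algebra_of_hom \<phi> A) = carrier A" "monoid.mult (algebra_of_hom \<phi> A) = monoid.mult A"
  "\<one>\<^bsub>algebra_of_hom \<phi> A\<^esub> = \<one>\<^bsub>A\<^esub>" "\<zero>\<^bsub>algebra_of_hom \<phi> A\<^esub> = \<zero>\<^bsub>A\<^esub>"
  "add (algebra_of_hom \<phi> A) = add A" "r \<odot>\<^bsub>algebra_of_hom \<phi> A\<^esub> a = \<phi> r \<otimes>\<^bsub>A\<^esub> a"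
  by (simp_all add: algebra_of_hom_def)

lemma assoc_algebra_of_hom:
  assumes R: "cring R" and A: "ring A" and hom: "\<phi> \<in> ring_hom R A"
    and central: "\<And>r a. \<lbrakk>r \<in> carrier R; a \<in> carrier A\<rbrakk> \<Longrightarrow> \<phi> r \<otimes>\<^bsub>A\<^esub> a = a \<otimes>\<^bsub>A\<^esub> \<phi> r"
  shows "assoc_algebra R (algebra_of_hom \<phi> A)"
proof -
  interpret R: cring R by fact
  interpret A: ring A by fact
  let ?B = "algebra_of_hom \<phi> A"
  have cl: "\<phi> r \<in> carrier A" if "r \<in> carrier R" for r using ring_hom_closed[OF hom that] .
  have rB: "ring ?B" by (rule ring_transfer[OF A]) simp_all
  have "module R ?B"
    by (rule moduleI[OF R ring.is_abelian_group[OF rB]])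
      (simp_all add: cl ring_hom_add[OF hom] ring_hom_mult[OF hom] ring_hom_one[OF hom]
        A.l_distr A.r_distr A.m_assoc)
  moreover have "assoc_algebra_axioms R ?B"
  proof
    fix r a b assume r: "r \<in> carrier R" "a \<in> carrier ?B" "b \<in> carrier ?B"
    then show "r \<odot>\<^bsub>?B\<^esub> a \<otimes>\<^bsub>?B\<^esub> b = r \<odot>\<^bsub>?B\<^esub> (a \<otimes>\<^bsub>?B\<^esub> b)" by (simp add: cl A.m_assoc)
    have "a \<otimes>\<^bsub>A\<^esub> (\<phi> r \<otimes>\<^bsub>A\<^esub> b) = (a \<otimes>\<^bsub>A\<^esub> \<phi> r) \<otimes>\<^bsub>A\<^esub> b" using r by (simp add: cl A.m_assoc)
    also have "a \<otimes>\<^bsub>A\<^esub> \<phi> r = \<phi> r \<otimes>\<^bsub>A\<^esub> a" using r central by simp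
    finally show "a \<otimes>\<^bsub>?B\<^esub> (r \<odot>\<^bsub>?B\<^esub> b) = r \<odot>\<^bsub>?B\<^esub> (a \<otimes>\<^bsub>?B\<^esub> b)" using r by (simp add: cl A.m_assoc)
  qed
  ultimately show ?thesis using rB by (simp add: assoc_algebra_def)
qed

lemma ring_hom_nat_pow:
  assumes "ring R" "ring A" "h \<in> ring_hom R A" "x \<in> carrier R"
  shows "h (x [^]\<^bsub>R\<^esub> (m::nat)) = h x [^]\<^bsub>A\<^esub> m"
proof -
  interpret ring_hom_ring R A h using assms by (intro ring_hom_ringI2)
  show ?thesis using assms(4) by (rule hom_nat_pow)
qed

section \<open>The \<open>l\<close>-centre and the powers of \<Delta>^l\<close>

locale dq_root = Dq_presentation n q for n :: nat and q :: "'k::field" +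
  fixes l :: nat
  assumes root: "primitive_root_of_unity l q" and odd_l: "odd l" and l_gt_1: "l > 1"
    and char_l: "of_nat l \<noteq> (0::'k)"
begin

abbreviation "sc \<equiv> Dq_scalar n q"
abbreviation "dx i \<equiv> Dq_x n q (Suc i)"
abbreviation "dd i \<equiv> Dq_d n q (Suc i)"

sublocale W: weyl_system D sc q n dx dd
  by (rule weyl_system_Dq[OF primitive_root_of_unity_nonzero[OF root]])

lemma q_pow: "q ^ l = 1" using root by (simp add: primitive_root_of_unity_def)

definition "Zgens = range sc \<union> {Dq_x n q i [^]\<^bsub>D\<^esub> l | i. i \<in> {1..n}} \<union> {Dq_d n q i [^]\<^bsub>D\<^esub> l | i. i \<in> {1..n}}"
definition "Zs = generate_ring D Zgens"

lemma l_centre_eq: "l_centre n q l = D\<lparr>carrier := Zs\<rparr>"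
  by (simp add: l_centre_def Zs_def Zgens_def)

lemma Suc_pred_range: "i \<in> {1..n} \<Longrightarrow> \<exists>j<n. i = Suc j"
  by (cases i) auto

lemma Zgens_closed: "Zgens \<subseteq> carrier D"
  unfolding Zgens_def by (auto dest!: Suc_pred_range simp del: atLeastAtMost_iff)

text \<open>The centralizer of a generator of the \<open>l\<close>-centre is a subring, so
  commutation with the scalars and with the generators of \<open>Dq\<close> is enough.\<close>

lemma Zgens_central: assumes "g \<in> Zgens" "a \<in> carrier D" shows "g \<otimes>\<^bsub>D\<^esub> a = a \<otimes>\<^bsub>D\<^esub> g"
proof -
  let ?C = "{h \<in> carrier D. \<forall>a\<in>{g}. a \<otimes>\<^bsub>D\<^esub> h = h \<otimes>\<^bsub>D\<^esub> a}"
  have gc: "g \<in> carrier D" using assms Zgens_closed by auto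
  have C: "subring ?C D" using gc by (intro W.subring_centralizer) auto
  have l0: "l > 0" using l_gt_1 by simp
  have "carrier D \<subseteq> ?C"
  proof (rule Dq_generated[OF C])
    show "range sc \<subseteq> ?C" using gc W.kappa_central[OF gc] by auto
    fix i assume "i \<in> {1..n}"
    then obtain j where j: "i = Suc j" "j < n" using Suc_pred_range by blast
    consider k where "g = sc k" | k where "k < n" "g = dx k [^]\<^bsub>D\<^esub> l" | k where "k < n" "g = dd k [^]\<^bsub>D\<^esub> l"
      using assms(1) unfolding Zgens_def by (blast dest: Suc_pred_range)
    then have "g \<otimes>\<^bsub>D\<^esub> dx j = dx j \<otimes>\<^bsub>D\<^esub> g \<and> g \<otimes>\<^bsub>D\<^esub> dd j = dd j \<otimes>\<^bsub>D\<^esub> g"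
    proof cases
      case 1
      then show ?thesis using W.kappa_central[of "dx j" k] W.kappa_central[of "dd j" k] j by auto
    qed (use W.pow_central[OF q_pow l0 _ j(2)] in auto)
    then show "Dq_x n q i \<in> ?C \<and> Dq_d n q i \<in> ?C" using j by auto
  qed
  then show ?thesis using assms(2) by auto
qed

lemma Zs_subring: "subring Zs D"
  unfolding Zs_def by (rule W.generate_ring_is_subring[OF Zgens_closed])

lemma Zs_closed: "z \<in> Zs \<Longrightarrow> z \<in> carrier D"
  using subringE(1)[OF Zs_subring] by auto

lemma Zs_central: assumes "z \<in> Zs" "a \<in> carrier D" shows "z \<otimes>\<^bsub>D\<^esub> a = a \<otimes>\<^bsub>D\<^esub> z"
proof -
  have "Zs \<subseteq> {h \<in> carrier D. \<forall>a\<in>carrier D. a \<otimes>\<^bsub>D\<^esub> h = h \<otimes>\<^bsub>D\<^esub> a}"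
    unfolding Zs_def
  proof (rule W.generate_ring_min_subring1[OF Zgens_closed W.subring_centralizer])
    show "Zgens \<subseteq> {h \<in> carrier D. \<forall>a\<in>carrier D. a \<otimes>\<^bsub>D\<^esub> h = h \<otimes>\<^bsub>D\<^esub> a}"
    proof (intro subsetI CollectI conjI ballI)
      fix g a assume "g \<in> Zgens" "a \<in> carrier D"
      then show "a \<otimes>\<^bsub>D\<^esub> g = g \<otimes>\<^bsub>D\<^esub> a" by (rule Zgens_central[symmetric])
    qed (use Zgens_closed in auto)
  qed simp
  then show ?thesis using assms by auto
qed

abbreviation "Z \<equiv> l_centre n q l"

lemma carrier_Z [simp]: "carrier Z = Zs" and mult_Z [simp]: "a \<otimes>\<^bsub>Z\<^esub> b = a \<otimes>\<^bsub>D\<^esub> b"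
  and one_Z [simp]: "\<one>\<^bsub>Z\<^esub> = \<one>\<^bsub>D\<^esub>" and zero_Z [simp]: "\<zero>\<^bsub>Z\<^esub> = \<zero>\<^bsub>D\<^esub>" and add_Z [simp]: "add Z = add D"
  by (simp_all add: l_centre_eq)

lemma cring_Z: "cring Z"
proof (rule cring.intro)
  show rZ: "ring Z"
    unfolding l_centre_eq Zs_def by (rule W.generate_ring_is_ring[OF Zgens_closed])
  show "comm_monoid Z"
    by (rule monoid.monoid_comm_monoidI[OF ring.is_monoid[OF rZ]]) (simp add: Zs_central Zs_closed)
qed

lemma gen_pow_Zs: "i < n \<Longrightarrow> dx i [^]\<^bsub>D\<^esub> l \<in> Zs" "i < n \<Longrightarrow> dd i [^]\<^bsub>D\<^esub> l \<in> Zs" and sc_Zs: "sc c \<in> Zs"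
  unfolding Zs_def by (rule generate_ring.incl, force simp: Zgens_def)+

lemma alpha_eq: "Dq_alpha n q (Suc i) = W.al i"
  by (simp add: Dq_alpha_def W.al_def)

lemma al_pow_Zs: "i < n \<Longrightarrow> W.al i [^]\<^bsub>D\<^esub> l \<in> Zs"
  using weyl_pair.al_pow_root[OF W.weyl_pair_XD root odd_l, of i] gen_pow_Zs subringE(3,6,7)[OF Zs_subring]
  by (simp add: W.weyl_al)

text \<open>Generalized to an arbitrary list of indices for the induction. The factors commute, so
  the \<open>l\<close>-th power of the product is the product of the central \<open>al^l\<close>.
  Splitting off one of them is what later makes each \<open>al i\<close> invertible once \<Delta>^l
  is.\<close>

lemma al_foldr:
  assumes "set js \<subseteq> {1..n}"
  defines "P \<equiv> foldr (\<lambda>i y. Dq_alpha n q i \<otimes>\<^bsub>D\<^esub> y) js \<one>\<^bsub>D\<^esub>"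
  shows "P \<in> carrier D \<and> (\<forall>i<n. W.al i \<otimes>\<^bsub>D\<^esub> P = P \<otimes>\<^bsub>D\<^esub> W.al i) \<and> P [^]\<^bsub>D\<^esub> l \<in> Zs
    \<and> (\<forall>i<n. Suc i \<in> set js \<longrightarrow> (\<exists>r\<in>Zs. P [^]\<^bsub>D\<^esub> l = W.al i [^]\<^bsub>D\<^esub> l \<otimes>\<^bsub>D\<^esub> r))"
  using assms(1) unfolding P_def
proof (induction js)
  case Nil
  then show ?case using subringE(3)[OF Zs_subring] by simp
next
  case (Cons k ks)
  let ?P = "foldr (\<lambda>i y. Dq_alpha n q i \<otimes>\<^bsub>D\<^esub> y) ks \<one>\<^bsub>D\<^esub>"
  obtain j where j: "k = Suc j" "j < n" using Cons.prems Suc_pred_range[of k] by auto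
  have P: "?P \<in> carrier D" "\<And>i. i < n \<Longrightarrow> W.al i \<otimes>\<^bsub>D\<^esub> ?P = ?P \<otimes>\<^bsub>D\<^esub> W.al i" "?P [^]\<^bsub>D\<^esub> l \<in> Zs"
    "\<And>i. \<lbrakk>i < n; Suc i \<in> set ks\<rbrakk> \<Longrightarrow> \<exists>r\<in>Zs. ?P [^]\<^bsub>D\<^esub> l = W.al i [^]\<^bsub>D\<^esub> l \<otimes>\<^bsub>D\<^esub> r"
    using Cons by auto
  have a: "W.al j \<in> carrier D" using j by simp
  have pow: "(W.al j \<otimes>\<^bsub>D\<^esub> ?P) [^]\<^bsub>D\<^esub> l = W.al j [^]\<^bsub>D\<^esub> l \<otimes>\<^bsub>D\<^esub> ?P [^]\<^bsub>D\<^esub> l"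
    by (rule W.pow_mult_distrib[OF P(2)[OF j(2)] a P(1)])
  have comm: "W.al i \<otimes>\<^bsub>D\<^esub> (W.al j \<otimes>\<^bsub>D\<^esub> ?P) = (W.al j \<otimes>\<^bsub>D\<^esub> ?P) \<otimes>\<^bsub>D\<^esub> W.al i" if i: "i < n" for i
  proof -
    have "W.al i \<otimes>\<^bsub>D\<^esub> (W.al j \<otimes>\<^bsub>D\<^esub> ?P) = (W.al j \<otimes>\<^bsub>D\<^esub> W.al i) \<otimes>\<^bsub>D\<^esub> ?P"
      using W.al_al[OF i j(2)] a i P(1) by (simp flip: W.m_assoc)
    also have "\<dots> = W.al j \<otimes>\<^bsub>D\<^esub> (?P \<otimes>\<^bsub>D\<^esub> W.al i)" using P(2)[OF i] a i P(1) by (simp add: W.m_assoc)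
    finally show ?thesis using a i P(1) by (simp add: W.m_assoc)
  qed
  have "\<exists>r\<in>Zs. (W.al j \<otimes>\<^bsub>D\<^esub> ?P) [^]\<^bsub>D\<^esub> l = W.al i [^]\<^bsub>D\<^esub> l \<otimes>\<^bsub>D\<^esub> r" if i: "i < n" "Suc i \<in> set (k # ks)" for i
  proof (cases "i = j")
    case True
    then show ?thesis using pow P(3) by auto
  next
    case False
    then obtain r where r: "r \<in> Zs" "?P [^]\<^bsub>D\<^esub> l = W.al i [^]\<^bsub>D\<^esub> l \<otimes>\<^bsub>D\<^esub> r" using P(4)[of i] i j by auto
    let ?a = "W.al i [^]\<^bsub>D\<^esub> l" and ?b = "W.al j [^]\<^bsub>D\<^esub> l"
    have "(W.al j \<otimes>\<^bsub>D\<^esub> ?P) [^]\<^bsub>D\<^esub> l = (?b \<otimes>\<^bsub>D\<^esub> ?a) \<otimes>\<^bsub>D\<^esub> r"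
      using r i j Zs_closed[OF r(1)] by (simp add: pow W.m_assoc)
    also have "?b \<otimes>\<^bsub>D\<^esub> ?a = ?a \<otimes>\<^bsub>D\<^esub> ?b" by (rule Zs_central[OF al_pow_Zs[OF j(2)]]) (use i in simp)
    finally have "(W.al j \<otimes>\<^bsub>D\<^esub> ?P) [^]\<^bsub>D\<^esub> l = ?a \<otimes>\<^bsub>D\<^esub> (?b \<otimes>\<^bsub>D\<^esub> r)"
      using r i j Zs_closed[OF r(1)] by (simp add: W.m_assoc)
    then show ?thesis using subringE(6)[OF Zs_subring al_pow_Zs[OF j(2)] r(1)] by blast
  qed
  moreover have "(W.al j \<otimes>\<^bsub>D\<^esub> ?P) [^]\<^bsub>D\<^esub> l \<in> Zs"
    unfolding pow by (rule subringE(6)[OF Zs_subring al_pow_Zs[OF j(2)] P(3)])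
  ultimately show ?case using comm a P(1) by (simp add: j(1) alpha_eq del: set_simps(2))
qed

definition "Dl = Dq_Delta n q [^]\<^bsub>D\<^esub> l"
abbreviation "S \<equiv> Delta_powers n q l"

lemma set_upt_Suc: "set [1..<Suc n] \<subseteq> {1..n}"
  by auto

lemmas Delta_facts = al_foldr[OF set_upt_Suc, folded Dq_Delta_def, folded Dl_def]

lemma Dl_Zs: "Dl \<in> Zs"
  using Delta_facts by blast

lemma Dl_factor: assumes "i < n" shows "\<exists>r\<in>Zs. Dl = W.al i [^]\<^bsub>D\<^esub> l \<otimes>\<^bsub>D\<^esub> r"
proof -
  have "Suc i \<in> set [1..<Suc n]" using assms by (simp del: upt_Suc)
  then show ?thesis using Delta_facts assms by blast
qed

lemma S_eq: "S = {Dl [^]\<^bsub>D\<^esub> k | k :: nat. True}"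
  by (simp add: Delta_powers_def Dl_def)

lemma S_Zs: "S \<subseteq> Zs"
proof -
  have "Dl [^]\<^bsub>D\<^esub> k \<in> Zs" for k :: nat
    using Dl_Zs subringE(3,6)[OF Zs_subring] by (induction k) auto
  then show ?thesis by (auto simp: S_eq)
qed

lemma S_props: "\<one>\<^bsub>D\<^esub> \<in> S" "\<lbrakk>s \<in> S; t \<in> S\<rbrakk> \<Longrightarrow> s \<otimes>\<^bsub>D\<^esub> t \<in> S" "Dl \<in> S"
proof -
  have c: "Dl \<in> carrier D" using Zs_closed[OF Dl_Zs] .
  show "\<one>\<^bsub>D\<^esub> \<in> S" unfolding S_eq by (auto intro!: exI[of _ 0])
  show "Dl \<in> S" unfolding S_eq using c by (auto intro!: exI[of _ 1])
  assume "s \<in> S" "t \<in> S"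
  then show "s \<otimes>\<^bsub>D\<^esub> t \<in> S" unfolding S_eq using c by (auto simp: W.nat_pow_mult)
qed

sublocale LZ: central_localization Z S
proof (intro central_localization.intro central_localization_axioms.intro cring.axioms(1)[OF cring_Z])
  fix s a assume "s \<in> S" "a \<in> carrier Z"
  then show "a \<otimes>\<^bsub>Z\<^esub> s = s \<otimes>\<^bsub>Z\<^esub> a" using S_Zs Zs_central[of a s] Zs_closed[of s] by auto
qed (use S_Zs S_props in auto)

sublocale LD: central_localization D S
proof (intro central_localization.intro central_localization_axioms.intro W.ring_axioms)
  fix s a assume "s \<in> S" "a \<in> carrier D"
  then show "a \<otimes>\<^bsub>D\<^esub> s = s \<otimes>\<^bsub>D\<^esub> a" using S_Zs Zs_central[of s a] by auto
qed (use S_Zs S_props Zs_closed in auto)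

abbreviation "Rl \<equiv> l_centre_loc n q l"
abbreviation "Dz \<equiv> Dq_over_l_centre n q"
abbreviation "Lz \<equiv> loc_over_l_centre n q l"

lemma Rl_eq: "Rl = localization Z S"
  by (simp add: l_centre_loc_def)

lemma cring_Rl: "cring Rl"
  unfolding Rl_eq by (rule LZ.cring_localization[OF cring_Z])

sublocale Rl: cring Rl by (rule cring_Rl)

lemma loc_map_hom: "loc_map Z S \<in> ring_hom Z Rl"
  unfolding Rl_eq by (rule LZ.loc_map_hom)

section \<open>The localized algebra as a tensor product over the \<open>l\<close>-centre\<close>

sublocale T: tensor Z Dz Lz
proof (rule tensor.intro)
  show "assoc_algebra Z Dz"
    unfolding Dq_over_l_centre_def
  proof (rule assoc_algebra_of_hom[OF cring_Z W.ring_axioms])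
    show "(\<lambda>z. z) \<in> ring_hom Z D" by (rule ring_hom_memI) (simp_all add: Zs_closed)
  qed (auto intro!: Zs_central)
  show "assoc_algebra Z Lz"
    unfolding loc_over_l_centre_def
    by (rule assoc_algebra_of_hom[OF cring_Z Rl.ring_axioms loc_map_hom])
      (auto intro!: Rl.m_comm ring_hom_closed[OF loc_map_hom])
qed

lemma Dz_simps [simp]: "carrier Dz = carrier D" "monoid.mult Dz = monoid.mult D" "\<one>\<^bsub>Dz\<^esub> = \<one>\<^bsub>D\<^esub>"
  "add Dz = add D" "z \<odot>\<^bsub>Dz\<^esub> a = z \<otimes>\<^bsub>D\<^esub> a"
  by (simp_all add: Dq_over_l_centre_def)

lemma Lz_simps [simp]: "carrier Lz = carrier Rl" "monoid.mult Lz = monoid.mult Rl" "\<one>\<^bsub>Lz\<^esub> = \<one>\<^bsub>Rl\<^esub>"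
  "add Lz = add Rl" "z \<odot>\<^bsub>Lz\<^esub> a = loc_map Z S z \<otimes>\<^bsub>Rl\<^esub> a"
  by (simp_all add: loc_over_l_centre_def)

abbreviation "\<phi> \<equiv> loc_structure_map n q l"

lemma phi_pure: "\<phi> w = T.pure \<one>\<^bsub>D\<^esub> w"
  by (simp add: loc_structure_map_def)

lemma phi_hom_T: "\<phi> \<in> ring_hom Rl T.T"
  by (rule ring_hom_memI)
    (simp_all add: phi_pure T.pure_mult T.pure_add_right[simplified] T.pure_one)

lemma phi_central_T: assumes "w \<in> carrier Rl" "t \<in> carrier T.T" shows "\<phi> w \<otimes>\<^bsub>T.T\<^esub> t = t \<otimes>\<^bsub>T.T\<^esub> \<phi> w"
proof -
  have S: "{T.pure a b | a b. a \<in> carrier Dz \<and> b \<in> carrier Lz} \<subseteq> carrier T.T" by auto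
  have w: "\<phi> w \<in> carrier T.T" using assms by (simp add: phi_pure)
  show ?thesis
    using S T.T_span[OF assms(2)]
  proof (induction rule: T.T.add_span_induct)
    case (incl s)
    then show ?case using assms(1) by (auto simp: phi_pure T.pure_mult Rl.m_comm)
  qed (use w in \<open>simp_all add: T.T.l_distr T.T.r_distr\<close>)
qed

abbreviation "A \<equiv> Dq_loc n q l"

lemma A_simps [simp]: "carrier A = carrier T.T" "monoid.mult A = monoid.mult T.T" "\<one>\<^bsub>A\<^esub> = \<one>\<^bsub>T.T\<^esub>"
  "\<zero>\<^bsub>A\<^esub> = \<zero>\<^bsub>T.T\<^esub>" "add A = add T.T" "r \<odot>\<^bsub>A\<^esub> a = \<phi> r \<otimes>\<^bsub>T.T\<^esub> a"
  by (simp_all add: Dq_loc_def)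

sublocale AA: assoc_algebra Rl A
  unfolding Dq_loc_def
  by (rule assoc_algebra_of_hom[OF cring_Rl T.ring_T phi_hom_T phi_central_T])

definition j :: "'k free_alg set \<Rightarrow> 'k Dq_loc_elem" where "j d = T.pure d \<one>\<^bsub>Rl\<^esub>"

lemma j_hom: "j \<in> ring_hom D A"
  by (rule ring_hom_memI)
    (simp_all add: j_def T.pure_mult T.pure_add_left[simplified] T.pure_one)

lemma phi_hom: "\<phi> \<in> ring_hom Rl A"
  using phi_hom_T by (simp add: ring_hom_def)

lemma phi_central: "\<lbrakk>w \<in> carrier Rl; t \<in> carrier A\<rbrakk> \<Longrightarrow> \<phi> w \<otimes>\<^bsub>A\<^esub> t = t \<otimes>\<^bsub>A\<^esub> \<phi> w"
  using phi_central_T by simp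

text \<open>An element of the \<open>l\<close>-centre may be moved across the tensor sign. In this
  way the \<open>l\<close>-th powers of the generators become scalars from the base ring.\<close>

lemma j_Zs: assumes "z \<in> Zs" shows "j z = \<phi> (loc_map Z S z)"
proof -
  have "loc_map Z S z \<in> carrier Rl" using ring_hom_closed[OF loc_map_hom] assms by simp
  then show ?thesis
    using T.pure_smult[of z "\<one>\<^bsub>D\<^esub>" "\<one>\<^bsub>Rl\<^esub>"] assms by (simp add: j_def phi_pure Zs_closed)
qed

definition "\<kappa>R c = loc_map Z S (sc c)"

sublocale EA: enveloping_algebra Rl A \<kappa>R
proof
  note h = loc_map_hom
  have c: "sc c \<in> carrier Z" for c by (simp add: sc_Zs)
  show "\<kappa>R k \<in> carrier Rl" for k unfolding \<kappa>R_def by (rule ring_hom_closed[OF h c])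
  show "\<kappa>R (k + m) = \<kappa>R k \<oplus>\<^bsub>Rl\<^esub> \<kappa>R m" for k m
    unfolding \<kappa>R_def W.kappa_add using ring_hom_add[OF h c c] by simp
  show "\<kappa>R (k * m) = \<kappa>R k \<otimes>\<^bsub>Rl\<^esub> \<kappa>R m" for k m
    unfolding \<kappa>R_def W.kappa_mult using ring_hom_mult[OF h c c] by simp
  show "\<kappa>R 1 = \<one>\<^bsub>Rl\<^esub>" unfolding \<kappa>R_def W.kappa_1 using ring_hom_one[OF h] by simp
qed

lemma Zc_eq: "EA.Zc = \<phi> ` carrier Rl"
proof -
  have *: "r \<odot>\<^bsub>A\<^esub> \<one>\<^bsub>A\<^esub> = \<phi> r" if "r \<in> carrier Rl" for r
    using ring_hom_closed[OF phi_hom that] by simp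
  show ?thesis
    unfolding EA.Zc_def image_def by (intro Collect_cong) (use * in blast)
qed

lemma kappa_eq: "EA.\<kappa> c = j (sc c)"
  using ring_hom_closed[OF phi_hom, of "\<kappa>R c"] EA.kR_closed by (simp add: EA.\<kappa>_def j_Zs sc_Zs \<kappa>R_def)

lemma j_closed [simp]: "a \<in> carrier D \<Longrightarrow> j a \<in> carrier T.T"
  using ring_hom_closed[OF j_hom] by simp

lemmas j_mult = ring_hom_mult[OF j_hom] and j_add = ring_hom_add[OF j_hom] and j_one = ring_hom_one[OF j_hom]

lemma j_pow: "a \<in> carrier D \<Longrightarrow> j (a [^]\<^bsub>D\<^esub> (m::nat)) = j a [^]\<^bsub>A\<^esub> m"
  using ring_hom_nat_pow[OF W.ring_axioms AA.ring_axioms j_hom] .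

lemma weyl_system_A: "weyl_system A EA.\<kappa> q n (\<lambda>i. j (dx i)) (\<lambda>i. j (dd i))"
proof (intro weyl_system.intro weyl_system_axioms.intro EA.KA.scalar_ring_axioms W.q_nz)
  fix i k assume i: "i < n" and k: "k < n"
  then have c: "dx i \<in> carrier D" "dd i \<in> carrier D" "dx k \<in> carrier D" "dd k \<in> carrier D" by auto
  note [simp] = c
  {
    assume ne: "i \<noteq> k"
    show "j (dx i) \<otimes>\<^bsub>A\<^esub> j (dx k) = EA.\<kappa> (qsgn q i k) \<otimes>\<^bsub>A\<^esub> (j (dx k) \<otimes>\<^bsub>A\<^esub> j (dx i))"
      using W.XX[OF i k ne] by (simp add: kappa_eq flip: j_mult[simplified])
    show "j (dd i) \<otimes>\<^bsub>A\<^esub> j (dd k) = EA.\<kappa> (qsgn q i k) \<otimes>\<^bsub>A\<^esub> (j (dd k) \<otimes>\<^bsub>A\<^esub> j (dd i))"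
      using W.DD[OF i k ne] by (simp add: kappa_eq flip: j_mult[simplified])
    show "j (dd i) \<otimes>\<^bsub>A\<^esub> j (dx k) = EA.\<kappa> (inverse (qsgn q i k)) \<otimes>\<^bsub>A\<^esub> (j (dx k) \<otimes>\<^bsub>A\<^esub> j (dd i))"
      using W.DX[OF i k ne] by (simp add: kappa_eq flip: j_mult[simplified])
  }
next
  fix i assume i: "i < n"
  then have c: "dx i \<in> carrier D" "dd i \<in> carrier D" by auto
  then show "j (dd i) \<otimes>\<^bsub>A\<^esub> j (dx i) = EA.\<kappa> q \<otimes>\<^bsub>A\<^esub> (j (dx i) \<otimes>\<^bsub>A\<^esub> j (dd i)) \<oplus>\<^bsub>A\<^esub> EA.\<kappa> (q - 1)"
    using W.DXi[OF i] by (simp add: kappa_eq flip: j_mult[simplified] j_add[simplified])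
qed auto

section \<open>Inverses of the \<alpha>_i in the localized algebra\<close>

definition Dinv :: "'k Dq_loc_elem" where "Dinv = \<phi> (loc_frac Z S \<one>\<^bsub>D\<^esub> Dl)"

lemma fr_one_Dl: "loc_frac Z S \<one>\<^bsub>D\<^esub> Dl \<in> carrier Rl"
  unfolding Rl_eq by (rule LZ.frac_closed) (use subringE(3)[OF Zs_subring] S_props(3) in auto)

lemma Dinv: "Dinv \<in> carrier A" "j Dl \<otimes>\<^bsub>A\<^esub> Dinv = \<one>\<^bsub>A\<^esub>" "t \<in> carrier A \<Longrightarrow> Dinv \<otimes>\<^bsub>A\<^esub> t = t \<otimes>\<^bsub>A\<^esub> Dinv"
proof -
  note one = subringE(3)[OF Zs_subring]
  show "Dinv \<in> carrier A" unfolding Dinv_def by (rule ring_hom_closed[OF phi_hom fr_one_Dl])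
  show "t \<in> carrier A \<Longrightarrow> Dinv \<otimes>\<^bsub>A\<^esub> t = t \<otimes>\<^bsub>A\<^esub> Dinv" unfolding Dinv_def by (rule phi_central[OF fr_one_Dl])
  have l: "loc_map Z S Dl \<in> carrier Rl" using ring_hom_closed[OF loc_map_hom] Dl_Zs by simp
  have "loc_map Z S Dl \<otimes>\<^bsub>Rl\<^esub> loc_frac Z S \<one>\<^bsub>D\<^esub> Dl = \<one>\<^bsub>Rl\<^esub>"
    using LZ.frac_mult[of Dl "\<one>\<^bsub>D\<^esub>" "\<one>\<^bsub>D\<^esub>" Dl] LZ.frac_cancel[of "\<one>\<^bsub>D\<^esub>" "\<one>\<^bsub>D\<^esub>" Dl] Dl_Zs one S_props Zs_closed[OF Dl_Zs]
    by (simp add: Rl_eq loc_map_def LZ.one_L)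
  then show "j Dl \<otimes>\<^bsub>A\<^esub> Dinv = \<one>\<^bsub>A\<^esub>"
    unfolding Dinv_def j_Zs[OF Dl_Zs] ring_hom_mult[OF phi_hom l fr_one_Dl, symmetric]
    by (simp only: ring_hom_one[OF phi_hom])
qed

text \<open>From \<Delta>^l = \<alpha>^l r with \<open>r\<close> in the \<open>l\<close>-centre, the
  inverse of \<alpha> is \<alpha>^(l-1) r \<Delta>^(-l), and its \<open>l\<close>-th power r
  \<Delta>^(-l) comes from the base ring.\<close>

lemma alpha_inverse:
  assumes i: "i < n"
  shows "\<exists>b\<in>carrier A. j (W.al i) \<otimes>\<^bsub>A\<^esub> b = \<one>\<^bsub>A\<^esub> \<and> b \<otimes>\<^bsub>A\<^esub> j (W.al i) = \<one>\<^bsub>A\<^esub> \<and> b [^]\<^bsub>A\<^esub> l \<in> EA.Zc"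
proof -
  obtain r where r: "r \<in> Zs" "Dl = W.al i [^]\<^bsub>D\<^esub> l \<otimes>\<^bsub>D\<^esub> r" using Dl_factor[OF i] by blast
  have rc: "r \<in> carrier D" using Zs_closed[OF r(1)] .
  let ?a = "W.al i" and ?p = "W.al i [^]\<^bsub>D\<^esub> (l - 1)"
  have a: "?a \<in> carrier D" "?p \<in> carrier D" using i by simp_all
  have l: "?a [^]\<^bsub>D\<^esub> l = ?p \<otimes>\<^bsub>D\<^esub> ?a"
    using l_gt_1 W.nat_pow_Suc[of ?a "l - 1"] by simp
  have pa: "?p \<otimes>\<^bsub>D\<^esub> ?a = ?a \<otimes>\<^bsub>D\<^esub> ?p" using W.nat_pow_Suc2[OF a(1), of "l - 1"] by simp
  define b where "b = j (?p \<otimes>\<^bsub>D\<^esub> r) \<otimes>\<^bsub>A\<^esub> Dinv"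
  have jc: "j (?p \<otimes>\<^bsub>D\<^esub> r) \<in> carrier A" "j ?a \<in> carrier A" "j r \<in> carrier A" "Dinv \<in> carrier A"
    using a rc Dinv(1) by simp_all
  have b: "b \<in> carrier A" unfolding b_def using jc by (intro AA.m_closed)
  have "?a \<otimes>\<^bsub>D\<^esub> (?p \<otimes>\<^bsub>D\<^esub> r) = Dl" unfolding r(2) l pa using a rc by (simp only: W.m_assoc)
  then have 1: "j ?a \<otimes>\<^bsub>A\<^esub> b = \<one>\<^bsub>A\<^esub>"
    unfolding b_def AA.m_assoc[OF jc(2,1,4), symmetric] j_mult[OF a(1) W.m_closed[OF a(2) rc], symmetric]
    using Dinv(2) by simp
  have "(?p \<otimes>\<^bsub>D\<^esub> r) \<otimes>\<^bsub>D\<^esub> ?a = Dl"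
    unfolding r(2) l W.m_assoc[OF a(2) rc a(1)] W.m_assoc[OF a(2) a(1) rc] Zs_central[OF r(1) a(1)] ..
  then have "j (?p \<otimes>\<^bsub>D\<^esub> r) \<otimes>\<^bsub>A\<^esub> j ?a \<otimes>\<^bsub>A\<^esub> Dinv = \<one>\<^bsub>A\<^esub>"
    unfolding j_mult[OF W.m_closed[OF a(2) rc] a(1), symmetric] using Dinv(2) by simp
  then have 2: "b \<otimes>\<^bsub>A\<^esub> j ?a = \<one>\<^bsub>A\<^esub>"
    unfolding b_def AA.m_assoc[OF jc(1,4,2)] Dinv(3)[OF jc(2)] AA.m_assoc[OF jc(1,2,4), symmetric] .
  have "b [^]\<^bsub>A\<^esub> l \<otimes>\<^bsub>A\<^esub> j ?a [^]\<^bsub>A\<^esub> l = (b \<otimes>\<^bsub>A\<^esub> j ?a) [^]\<^bsub>A\<^esub> l"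
    by (rule AA.pow_mult_distrib[OF _ b jc(2), symmetric]) (simp only: 1 2)
  then have 3: "b [^]\<^bsub>A\<^esub> l \<otimes>\<^bsub>A\<^esub> j (?a [^]\<^bsub>D\<^esub> l) = \<one>\<^bsub>A\<^esub>"
    unfolding 2 AA.nat_pow_one j_pow[OF a(1)] .
  have cs: "b [^]\<^bsub>A\<^esub> l \<in> carrier A" "j (?a [^]\<^bsub>D\<^esub> l) \<in> carrier A" "j r \<otimes>\<^bsub>A\<^esub> Dinv \<in> carrier A"
    using AA.nat_pow_closed[OF b] AA.m_closed[OF jc(3,4)] a by simp_all
  \<comment> \<open>The unit is inserted as \<alpha>^l r \<Delta>^(-l), and \<open>b^l\<close>
    cancels \<alpha>^l.\<close>
  have "b [^]\<^bsub>A\<^esub> l = b [^]\<^bsub>A\<^esub> l \<otimes>\<^bsub>A\<^esub> (j Dl \<otimes>\<^bsub>A\<^esub> Dinv)" unfolding Dinv(2) using AA.r_one[OF cs(1)] by simp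
  also have "j Dl = j (?a [^]\<^bsub>D\<^esub> l) \<otimes>\<^bsub>A\<^esub> j r"
    unfolding r(2) by (rule j_mult[OF W.nat_pow_closed[OF a(1)] rc])
  also have "b [^]\<^bsub>A\<^esub> l \<otimes>\<^bsub>A\<^esub> (j (?a [^]\<^bsub>D\<^esub> l) \<otimes>\<^bsub>A\<^esub> j r \<otimes>\<^bsub>A\<^esub> Dinv) = j r \<otimes>\<^bsub>A\<^esub> Dinv"
    unfolding AA.m_assoc[OF cs(2) jc(3,4)] AA.m_assoc[OF cs, symmetric] 3 by (rule AA.l_one[OF cs(3)])
  finally have "b [^]\<^bsub>A\<^esub> l = \<phi> (loc_map Z S r) \<otimes>\<^bsub>A\<^esub> \<phi> (loc_frac Z S \<one>\<^bsub>D\<^esub> Dl)"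
    unfolding Dinv_def j_Zs[OF r(1)] .
  also have "\<dots> = \<phi> (loc_map Z S r \<otimes>\<^bsub>Rl\<^esub> loc_frac Z S \<one>\<^bsub>D\<^esub> Dl)"
    using ring_hom_mult[OF phi_hom _ fr_one_Dl] ring_hom_closed[OF loc_map_hom] r(1) by simp
  also have "\<dots> \<in> EA.Zc"
    unfolding Zc_eq using fr_one_Dl ring_hom_closed[OF loc_map_hom] r(1) by (intro imageI Rl.m_closed) auto
  finally show ?thesis using b 1 2 by blast
qed

text \<open>The preimage of \<open>H\<close> under \<open>j\<close> is a subring of
  \<open>Dq\<close> containing the scalars and the generators, hence everything; and each pure
  tensor is a product of a value of \<open>j\<close> and a value of \<phi>.\<close>

lemma generated_A:
  assumes T: "subring H A" and Zc: "EA.Zc \<subseteq> H" and gen: "\<And>i. i < n \<Longrightarrow> j (dx i) \<in> H \<and> j (dd i) \<in> H"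
  shows "carrier A \<subseteq> H"
proof -
  note E = subringE[OF T]
  let ?K = "{d \<in> carrier D. j d \<in> H}"
  have "subring ?K D"
  proof (rule W.subringI)
    have jm: "j (\<ominus>\<^bsub>D\<^esub> h) = \<ominus>\<^bsub>A\<^esub> j h" if "h \<in> carrier D" for h
    proof -
      interpret J: ring_hom_ring D A j by (rule ring_hom_ringI2[OF W.ring_axioms AA.ring_axioms j_hom])
      show ?thesis using that by (rule J.hom_a_inv)
    qed
    show "\<ominus>\<^bsub>D\<^esub> h \<in> ?K" if "h \<in> ?K" for h using that jm E(5) by auto
    show "\<one>\<^bsub>D\<^esub> \<in> ?K" using j_one E(3) by simp
    show "h \<otimes>\<^bsub>D\<^esub> g \<in> ?K" if "h \<in> ?K" "g \<in> ?K" for h g using that j_mult[of h g] E(6) by auto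
    show "h \<oplus>\<^bsub>D\<^esub> g \<in> ?K" if "h \<in> ?K" "g \<in> ?K" for h g using that j_add[of h g] E(7) by auto
  qed auto
  moreover have "range sc \<subseteq> ?K"
    using Zc EA.kappa_Zc W.kappa_closed by (auto simp flip: kappa_eq)
  moreover have "Dq_x n q i \<in> ?K \<and> Dq_d n q i \<in> ?K" if i: "i \<in> {1..n}" for i
    using Suc_pred_range[OF i] gen by auto
  ultimately have "carrier D \<subseteq> ?K" by (rule Dq_generated)
  then have jH: "j d \<in> H" if "d \<in> carrier D" for d using that by auto
  have phiH: "\<phi> w \<in> H" if "w \<in> carrier Rl" for w using Zc that unfolding Zc_eq by auto
  have pure: "T.pure d w \<in> H" if "d \<in> carrier D" "w \<in> carrier Rl" for d w
  proof -
    have "T.pure d w = j d \<otimes>\<^bsub>A\<^esub> \<phi> w" using that by (simp add: j_def phi_pure T.pure_mult)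
    then show ?thesis using E(6)[OF jH[OF that(1)] phiH[OF that(2)]] by simp
  qed
  show ?thesis
  proof
    fix t assume "t \<in> carrier A"
    then have t: "t \<in> carrier T.T" by simp
    have S: "{T.pure a b | a b. a \<in> carrier Dz \<and> b \<in> carrier Lz} \<subseteq> carrier T.T" by auto
    show "t \<in> H"
      using S T.T_span[OF t]
      by (rule T.T.add_span_induct) (use pure E(2,7) in auto)
  qed
qed

lemma azumaya_idem_exists: "\<exists>e. EA.azumaya_idem (carrier A) e"
proof -
  obtain AI where AI: "\<And>i. i < n \<Longrightarrow> AI i \<in> carrier A \<and> j (W.al i) \<otimes>\<^bsub>A\<^esub> AI i = \<one>\<^bsub>A\<^esub>
      \<and> AI i \<otimes>\<^bsub>A\<^esub> j (W.al i) = \<one>\<^bsub>A\<^esub> \<and> AI i [^]\<^bsub>A\<^esub> l \<in> EA.Zc"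
    using alpha_inverse by metis
  have al: "j (W.al i) = \<one>\<^bsub>A\<^esub> \<oplus>\<^bsub>A\<^esub> j (dx i) \<otimes>\<^bsub>A\<^esub> j (dd i)" if "i < n" for i
    using that j_add[of "\<one>\<^bsub>D\<^esub>" "dx i \<otimes>\<^bsub>D\<^esub> dd i"] j_mult[of "dx i" "dd i"] j_one by (simp add: W.al_def)
  have pow: "j (dx i) [^]\<^bsub>A\<^esub> l \<in> EA.Zc" "j (dd i) [^]\<^bsub>A\<^esub> l \<in> EA.Zc" if "i < n" for i
  proof -
    have "j z \<in> EA.Zc" if "z \<in> Zs" for z
      using that ring_hom_closed[OF loc_map_hom] by (simp add: j_Zs Zc_eq)
    then show "j (dx i) [^]\<^bsub>A\<^esub> l \<in> EA.Zc" "j (dd i) [^]\<^bsub>A\<^esub> l \<in> EA.Zc"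
      using gen_pow_Zs[OF that] j_pow[of "dx i" l] j_pow[of "dd i" l] that by (metis W.X_closed W.D_closed)+
  qed
  interpret ES: enveloping_system A EA.Ae EA.Zc EA.\<kappa> "\<lambda>a. EA.lam a" "\<lambda>a. EA.rho a" EA.act q n
    "\<lambda>i. j (dx i)" "\<lambda>i. j (dd i)" l AI
    by (intro enveloping_system.intro enveloping_system_axioms.intro EA.enveloping weyl_system_A
        root odd_l l_gt_1 char_l generated_A pow) (use AI al in simp_all)
  show ?thesis by (rule ES.azumaya_idem_carrier)
qed

text \<open>The structure map is injective since \<open>D \<otimes> Z\<^sub>S\<close> maps to the localization of \<open>D\<close> itself.\<close>

definition \<iota> :: "('k free_alg set \<times> 'k free_alg set) set \<Rightarrow> ('k free_alg set \<times> 'k free_alg set) set" where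
  "\<iota> w = (\<Union>(a, s)\<in>w. loc_frac D S a s)"

lemma iota_frac: assumes "a \<in> Zs" "s \<in> S" shows "\<iota> (loc_frac Z S a s) = loc_frac D S a s"
  unfolding \<iota>_def
proof (rule UN_constant_eq[OF LZ.frac_self])
  show "\<forall>p\<in>loc_frac Z S a s. (case p of (a, s) \<Rightarrow> loc_frac D S a s) = loc_frac D S a s"
  proof (clarify)
    fix b t assume "(b, t) \<in> loc_frac Z S a s"
    then obtain u where u: "b \<in> Zs" "t \<in> S" "u \<in> S" "u \<otimes>\<^bsub>D\<^esub> (t \<otimes>\<^bsub>D\<^esub> a) = u \<otimes>\<^bsub>D\<^esub> (s \<otimes>\<^bsub>D\<^esub> b)"
      by (auto simp: LZ.frac_mem)
    show "loc_frac D S b t = loc_frac D S a s"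
      by (rule LD.frac_eqI[OF _ _ u(2) assms(2) u(3) u(4)[symmetric]]) (use u(1) assms(1) Zs_closed in auto)
  qed
qed (use assms in auto)

lemma phi_inj: "inj_on \<phi> (carrier Rl)"
proof (rule inj_onI)
  fix w w' assume w: "w \<in> carrier Rl" "w' \<in> carrier Rl" and eq: "\<phi> w = \<phi> w'"
  interpret G: ring "localization D S" by (rule LD.ring_localization)
  \<comment> \<open>The map sending \<open>d\<close> and \<open>a / s\<close> to
    \<open>(d a) / s\<close> in the localization of \<open>D\<close>. It is balanced because the
    \<open>l\<close>-centre is central in \<open>D\<close>.\<close>
  define \<beta> where "\<beta> = (\<lambda>(d, w). loc_map D S d \<otimes>\<^bsub>localization D S\<^esub> \<iota> w)"
  have one: "\<one>\<^bsub>D\<^esub> \<in> S" by (rule S_props)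
  have lm: "loc_map D S d \<in> carrier (localization D S)" if "d \<in> carrier D" for d
    using that one by (simp add: loc_map_def)
  have iota: "\<iota> v \<in> carrier (localization D S)" if "v \<in> carrier Rl" for v
    using that iota_frac Zs_closed unfolding Rl_eq LZ.carrier_L by auto
  have iota_add: "\<iota> (v \<oplus>\<^bsub>Rl\<^esub> v') = \<iota> v \<oplus>\<^bsub>localization D S\<^esub> \<iota> v'" if vv: "v \<in> carrier Rl" "v' \<in> carrier Rl" for v v'
  proof -
    obtain a b s where *: "v = loc_frac Z S a s" "v' = loc_frac Z S b s" "a \<in> carrier Z" "b \<in> carrier Z" "s \<in> S"
      by (rule LZ.carrier_L_common2[OF vv[unfolded Rl_eq]])
    then show ?thesis
      using LZ.frac_add_same[of a b s] LD.frac_add_same[of a b s] subringE(7)[OF Zs_subring]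
      by (simp add: Rl_eq iota_frac Zs_closed)
  qed
  have \<beta>_frac: "\<beta> (d, loc_frac Z S a s) = loc_frac D S (d \<otimes>\<^bsub>D\<^esub> a) s"
    if "d \<in> carrier D" "a \<in> Zs" "s \<in> S" for d a s
    using that one Zs_closed LD.frac_mult[of d a "\<one>\<^bsub>D\<^esub>" s] LD.S_closed by (simp add: \<beta>_def iota_frac loc_map_def)
  have "T.cls (frag_of (\<one>\<^bsub>D\<^esub>, w)) = T.cls (frag_of (\<one>\<^bsub>D\<^esub>, w'))"
    using eq by (simp add: phi_pure pure_tensor_def)
  then have N: "frag_of (\<one>\<^bsub>D\<^esub>, w) - frag_of (\<one>\<^bsub>D\<^esub>, w') \<in> T.N" by (rule T.cls_eqD)
  have "G.lext \<beta> (frag_of (\<one>\<^bsub>D\<^esub>, w) - frag_of (\<one>\<^bsub>D\<^esub>, w')) = \<zero>\<^bsub>localization D S\<^esub>"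
  proof (rule T.lext_N[OF G.abelian_group_axioms _ _ _ _ N])
    fix z d v assume z: "z \<in> carrier Z" "d \<in> carrier Dz" "v \<in> carrier Lz"
    then obtain a s where v: "v = loc_frac Z S a s" "a \<in> Zs" "s \<in> S" by (auto simp: Rl_eq LZ.carrier_L)
    have "loc_map Z S z \<otimes>\<^bsub>Rl\<^esub> v = loc_frac Z S (z \<otimes>\<^bsub>D\<^esub> a) s"
      using z v one LZ.frac_mult[of z a "\<one>\<^bsub>D\<^esub>" s] LD.S_closed by (simp add: Rl_eq loc_map_def)
    moreover have "z \<otimes>\<^bsub>D\<^esub> d \<otimes>\<^bsub>D\<^esub> a = d \<otimes>\<^bsub>D\<^esub> (z \<otimes>\<^bsub>D\<^esub> a)"
      using z v Zs_closed Zs_central[of z d] by (simp add: W.m_assoc)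
    ultimately show "\<beta> (z \<odot>\<^bsub>Dz\<^esub> d, v) = \<beta> (d, z \<odot>\<^bsub>Lz\<^esub> v)"
      using z v Zs_closed subringE(6)[OF Zs_subring] by (simp add: \<beta>_frac)
  next
    show "\<beta> (a \<oplus>\<^bsub>Dz\<^esub> a', b) = \<beta> (a, b) \<oplus>\<^bsub>localization D S\<^esub> \<beta> (a', b)"
      if "a \<in> carrier Dz" "a' \<in> carrier Dz" "b \<in> carrier Lz" for a a' b
      using that lm iota ring_hom_add[OF LD.loc_map_hom, of a a'] by (simp add: \<beta>_def G.l_distr)
  qed (use lm iota iota_add in \<open>simp_all add: \<beta>_def G.r_distr\<close>)
  moreover have \<beta>P: "\<beta> p \<in> carrier (localization D S)" if "p \<in> carrier D \<times> carrier Rl" for p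
    using that lm iota by (auto simp: \<beta>_def)
  ultimately have "\<beta> (\<one>\<^bsub>D\<^esub>, w) \<ominus>\<^bsub>localization D S\<^esub> \<beta> (\<one>\<^bsub>D\<^esub>, w') = \<zero>\<^bsub>localization D S\<^esub>"
    using G.lext_diff[of "carrier D \<times> carrier Rl" \<beta> "frag_of (\<one>\<^bsub>D\<^esub>, w)" "frag_of (\<one>\<^bsub>D\<^esub>, w')"] w by simp
  then have \<beta>eq: "\<beta> (\<one>\<^bsub>D\<^esub>, w) = \<beta> (\<one>\<^bsub>D\<^esub>, w')" using \<beta>P w by simp
  obtain a b s where *: "w = loc_frac Z S a s" "w' = loc_frac Z S b s" "a \<in> carrier Z" "b \<in> carrier Z" "s \<in> S"
    by (rule LZ.carrier_L_common2[OF w[unfolded Rl_eq]])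
  have "loc_frac D S a s = loc_frac D S b s"
    using \<beta>eq * Zs_closed by (simp add: \<beta>_frac)
  \<comment> \<open>The witness \<open>u\<close> of equality over \<open>D\<close> lies in
    \<open>S\<close>, inside the \<open>l\<close>-centre, so the same equation is an equality of
    fractions over the \<open>l\<close>-centre.\<close>
  then obtain u where "u \<in> S" "u \<otimes>\<^bsub>D\<^esub> (s \<otimes>\<^bsub>D\<^esub> a) = u \<otimes>\<^bsub>D\<^esub> (s \<otimes>\<^bsub>D\<^esub> b)"
    using LD.frac_eqD[of a s b s] * Zs_closed by auto
  then show "w = w'" unfolding *(1,2) using *(3-5) by (intro LZ.frac_eqI[of a b s s u]) auto
qed

theorem azumaya_Dq_loc:
  "azumaya_algebra Rl A" "\<phi> \<in> ring_iso Rl (A\<lparr>carrier := ring_centre A\<rparr>)"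
proof -
  obtain e where e: "EA.azumaya_idem (carrier A) e" using azumaya_idem_exists ..
  have "(\<lambda>r. r \<odot>\<^bsub>A\<^esub> \<one>\<^bsub>A\<^esub>) r = \<phi> r" if "r \<in> carrier Rl" for r
    using ring_hom_closed[OF phi_hom that] by simp
  then have inj: "inj_on (\<lambda>r. r \<odot>\<^bsub>A\<^esub> \<one>\<^bsub>A\<^esub>) (carrier Rl)"
    using phi_inj by (simp cong: inj_on_cong)
  show "azumaya_algebra Rl A" by (rule EA.azumaya_criterion(1)[OF e inj])
  have centre: "ring_centre A = \<phi> ` carrier Rl" using EA.azumaya_criterion(2)[OF e inj] by (simp add: Zc_eq)
  show "\<phi> \<in> ring_iso Rl (A\<lparr>carrier := ring_centre A\<rparr>)"
    unfolding centre ring_iso_def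
    using phi_hom phi_inj by (auto simp: ring_hom_def bij_betw_def)
qed

end

text \<open>The second conjunct makes precise that the base ring is the centre: the structure map
  identifies the localized \<open>l\<close>-centre with it.\<close>

theorem corollary4p7:
  fixes q :: "'k::{alg_closed_field, field_char_0}" and n l :: nat
  assumes "n \<ge> 1"
    and "l > 1" and "odd l"
    and "primitive_root_of_unity l q"
  shows "azumaya_algebra (l_centre_loc n q l) (Dq_loc n q l) \<and>
    loc_structure_map n q l \<in>
      ring_iso (l_centre_loc n q l)
        ((Dq_loc n q l)\<lparr>carrier := ring_centre (Dq_loc n q l)\<rparr>)"
proof -
  \<comment> \<open>Characteristic zero supplies \<open>of_nat l \<noteq> 0\<close>, by which the
    averaging polynomial divides.\<close>
  interpret dq_root n q l
    by unfold_locales (use assms in auto)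
  show ?thesis using azumaya_Dq_loc by blast
qed

end
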